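(* There exists a universal constant $c$ (independent of $d,\lambda,y,r$) such that for all $d\ge2$, $\lambda>0$, $y\in\mathbb R^d$ and $r\ge 0$ with $$r\sqrt\lambda\le\frac12\sqrt{(d-1)/2},$$ the measure $\mu_{\lambda,r}$ satisfies a Poincaré inequality with $C_P(\lambda,y,r)\le\dfrac{c}{\lambda}$.
   Context: For $d\ge2$, $\lambda>0$, $y\in\mathbb R^d$, $r\ge0$, let $\mu_{\lambda,r}$ be the probability measure $\mu_{\lambda,r}(dx)=Z^{-1}\mathbf 1_{|x-y|>r}\,e^{-\lambda|x|^2}\,dx$ on $\mathbb R^d$, where $|\cdot|$ is the Euclidean norm and $Z$ the normalizing constant. $C_P(\lambda,y,r)$ is its Poincaré constant: the smallest $C$ such that $\mathrm{Var}_{\mu_{\lambda,r}}(f)\le C\int|\nabla f|^2\,d\mu_{\lambda,r}$ for all smooth $f:\mathbb R^d\to\mathbb R$ (with $f,|\nabla f|\in L^2(\mu_{\lambda,r})$). *)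

theory Defs
  imports "HOL-Probability.Probability"
begin

text \<open>
  The constant in the theorem must be uniform in the dimension, so the dimension cannot be a type.
  The space \<open>\<real>\<^sup>d\<close> is represented by the functions \<open>nat \<Rightarrow> real\<close> that are \<open>undefined\<close> outside
  \<open>{..<d}\<close>.  Functions on \<open>\<real>\<^sup>d\<close> have type \<open>(nat \<Rightarrow> real) \<Rightarrow> real\<close>; only their
  values on this carrier matter below.
\<close>

definition Rd :: "nat \<Rightarrow> (nat \<Rightarrow> real) set" where
  "Rd d = (\<Pi>\<^sub>E i\<in>{..<d}. UNIV)"

definition lborel_Rd :: "nat \<Rightarrow> (nat \<Rightarrow> real) measure" where
  "lborel_Rd d = (\<Pi>\<^sub>M i\<in>{..<d}. lborel)"

definition norm_Rd :: "nat \<Rightarrow> (nat \<Rightarrow> real) \<Rightarrow> real" where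
  "norm_Rd d x = L2_set x {..<d}"

definition dist_Rd :: "nat \<Rightarrow> (nat \<Rightarrow> real) \<Rightarrow> (nat \<Rightarrow> real) \<Rightarrow> real" where
  "dist_Rd d x y = L2_set (\<lambda>i. x i - y i) {..<d}"

definition partial :: "nat \<Rightarrow> ((nat \<Rightarrow> real) \<Rightarrow> real) \<Rightarrow> (nat \<Rightarrow> real) \<Rightarrow> real" where
  "partial i f x = deriv (\<lambda>t. f (x(i := t))) (x i)"

definition grad_norm :: "nat \<Rightarrow> ((nat \<Rightarrow> real) \<Rightarrow> real) \<Rightarrow> (nat \<Rightarrow> real) \<Rightarrow> real" where
  "grad_norm d f x = norm_Rd d (\<lambda>i. partial i f x)"

text \<open>
  \<open>C\<^sup>\<infinity>\<close>: all iterated partial derivatives, of every order (including order 0, the empty list of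
  indices), exist on \<open>\<real>\<^sup>d\<close> and are continuous there.  Since \<open>deriv\<close> is total, existence is
  stated separately.  Continuity is with respect to the product topology on \<open>nat \<Rightarrow> real\<close>, which
  induces the Euclidean topology on the carrier.
\<close>

definition smooth_Rd :: "nat \<Rightarrow> ((nat \<Rightarrow> real) \<Rightarrow> real) \<Rightarrow> bool" where
  "smooth_Rd d f \<longleftrightarrow>
     (\<forall>is. set is \<subseteq> {..<d} \<longrightarrow>
        continuous_on (Rd d) (foldr partial is f) \<and>
        (\<forall>i<d. \<forall>x\<in>Rd d. (\<lambda>t. foldr partial is f (x(i := t))) differentiable (at (x i))))"

definition gauss_weight ::
    "nat \<Rightarrow> real \<Rightarrow> (nat \<Rightarrow> real) \<Rightarrow> real \<Rightarrow> (nat \<Rightarrow> real) \<Rightarrow> real" where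
  "gauss_weight d lam y r x = indicator {x. dist_Rd d x y > r} x * exp (- lam * (norm_Rd d x)\<^sup>2)"

definition mu :: "nat \<Rightarrow> real \<Rightarrow> (nat \<Rightarrow> real) \<Rightarrow> real \<Rightarrow> (nat \<Rightarrow> real) measure" where
  "mu d lam y r =
     (let Z = (LINT x|lborel_Rd d. gauss_weight d lam y r x)
      in density (lborel_Rd d) (\<lambda>x. ennreal (gauss_weight d lam y r x / Z)))"

definition poincare_inequality :: "nat \<Rightarrow> (nat \<Rightarrow> real) measure \<Rightarrow> real \<Rightarrow> bool" where
  "poincare_inequality d M C \<longleftrightarrow>
     (\<forall>f. smooth_Rd d f \<and> integrable M (\<lambda>x. (f x)\<^sup>2) \<and> integrable M (\<lambda>x. (grad_norm d f x)\<^sup>2) \<longrightarrow>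
        prob_space.variance M f \<le> C * (LINT x|M. (grad_norm d f x)\<^sup>2))"

text \<open>
  The value is meaningful only if a least constant exists; this is the case for \<open>d \<ge> 1\<close> as soon as some
  Poincare inequality holds, and is implied by asserting the inequality with this constant.
\<close>

definition poincare_constant :: "nat \<Rightarrow> real \<Rightarrow> (nat \<Rightarrow> real) \<Rightarrow> real \<Rightarrow> real" where
  "poincare_constant d lam y r = (LEAST C. poincare_inequality d (mu d lam y r) C)"

end

(*
  Put z = x - y, n = d - 1, tau = lam |z|^2 / n; the hypothesis says that tau <= 1/8 on the removed ball B.
  Let h = f - a on the complement D of B. If chi vanishes for tau <= 1/8, the Gaussian Poincare inequality on the whole
  space applies to chi(tau) h and, when a makes its mean vanish, bounds int chi^2 h^2 by a multiple of int_D |grad h|^2 / lam,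
  up to an error int tau chi'^2 h^2 / n. It remains to control h near the ball, uniformly in y.
  Integrating by parts against the field Q(|z|^2) (z + (2 lam / n) ((y.z) z - |z|^2 y)), whose Gaussian divergence
  dominates Q (n - 2 lam |z|^2 + 1) + 2 |z|^2 Q' for every y and whose flux has the favourable sign on the sphere, gives a
  weighted Hardy inequality on D whose potential is positive for small tau. A suitable choice of Q and chi makes the sum
  of the two coefficients of h^2 bounded below by a positive universal constant.

  The Gaussian inequality itself is obtained from the Efron-Stein inequality and, on the line, from the Hardy-type
  inequality 2 lam int g^2 <= int g'^2 for g(0) = 0.
*)
theory Submission
  imports Defs
begin

section \<open>Tensorisation of the variance\<close>

text \<open>The obstacle is the centre y, on which no bound is assumed: the plain radial field z has
  Gaussian divergence d - 2 lam |z|^2 - 2 lam y.z, whose last term is unbounded and has no sign.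
  Adding a field orthogonal to z leaves the flux through spheres around y unchanged, and the
  coefficient 2 lam / n is the one for which y.z disappears. Neither inequality suffices alone. The
  Hardy potential is negative for large tau, and the Gaussian inequality for a cut-off function says
  nothing where the cutoff vanishes. In both, h enters only through products with C^1 cutoffs that
  vanish on the ball, so no extension operator across the sphere is involved, and square
  integrability outside the ball is enough. What remains is an inequality in the single variable
  tau, with the dimension as a parameter. All constants are explicit rationals, so that it reduces
  to positivity of polynomials with integer coefficients.\<close>

text \<open>For \<open>f \<in> L\<^sup>2(M)\<close> this is twice the variance; the double integral makes sense without integrability.\<close>

definition dvar :: "'a measure \<Rightarrow> ('a \<Rightarrow> real) \<Rightarrow> ennreal" where
  "dvar M f = (\<integral>\<^sup>+s. \<integral>\<^sup>+t. ennreal ((f s - f t)\<^sup>2) \<partial>M \<partial>M)"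

lemma dvar_eq_variance:
  assumes "prob_space M" and k: "integrable M k" and k2: "integrable M (\<lambda>x. (k x)\<^sup>2)"
  shows "dvar M k = ennreal (2 * ((LINT x|M. (k x)\<^sup>2) - (LINT x|M. k x)\<^sup>2))"
proof -
  interpret prob_space M by fact
  let ?m = "LINT x|M. k x" and ?m2 = "LINT x|M. (k x)\<^sup>2"
  have sq: "(k s - k t)\<^sup>2 = (k s)\<^sup>2 - 2 * k s * k t + (k t)\<^sup>2" for s t
    by (simp add: power2_eq_square algebra_simps)
  have inner: "(\<integral>\<^sup>+t. ennreal ((k s - k t)\<^sup>2) \<partial>M) = ennreal ((k s)\<^sup>2 - 2 * k s * ?m + ?m2)" for s
  proof -
    have "(\<integral>\<^sup>+t. ennreal ((k s - k t)\<^sup>2) \<partial>M) = ennreal (LINT t|M. (k s - k t)\<^sup>2)"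
      proof (rule nn_integral_eq_integral)
      show "integrable M (\<lambda>t. (k s - k t)\<^sup>2)" using k k2 by (auto simp: sq)
    qed auto
    also have "(LINT t|M. (k s - k t)\<^sup>2) = (k s)\<^sup>2 - 2 * k s * ?m + ?m2"
      unfolding sq using k k2 by (simp add: prob_space)
    finally show ?thesis .
  qed
  have "0 \<le> (LINT x|M. (k x - ?m)\<^sup>2)" by (rule Bochner_Integration.integral_nonneg) auto
  also have "\<dots> = ?m2 - ?m\<^sup>2"
    using k k2 by (simp add: power2_diff prob_space power2_eq_square algebra_simps)
  finally have var: "?m\<^sup>2 \<le> ?m2" by simp
  have pos: "0 \<le> (k s)\<^sup>2 - 2 * k s * ?m + ?m2" for s
    using zero_le_power2[of "k s - ?m"] var by (simp add: power2_diff)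
  have "dvar M k = (\<integral>\<^sup>+s. ennreal ((k s)\<^sup>2 - 2 * k s * ?m + ?m2) \<partial>M)"
    unfolding dvar_def inner ..
  also have "\<dots> = ennreal (LINT s|M. (k s)\<^sup>2 - 2 * k s * ?m + ?m2)"
    by (rule nn_integral_eq_integral) (use k k2 pos in auto)
  also have "(LINT s|M. (k s)\<^sup>2 - 2 * k s * ?m + ?m2) = 2 * (?m2 - ?m\<^sup>2)"
    using k k2 by (simp add: prob_space power2_eq_square)
  finally show ?thesis .
qed

lemma dvar_le_second_moment:
  assumes "prob_space M" and k [measurable]: "k \<in> borel_measurable M"
  shows "dvar M k \<le> 2 * (\<integral>\<^sup>+x. ennreal ((k x)\<^sup>2) \<partial>M)"
proof (cases "(\<integral>\<^sup>+x. ennreal ((k x)\<^sup>2) \<partial>M) = \<infinity>")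
  case False
  interpret prob_space M by fact
  have k2: "integrable M (\<lambda>x. (k x)\<^sup>2)"
    by (rule integrableI_bounded) (use False in \<open>auto simp: top.not_eq_extremum\<close>)
  have k1: "integrable M k"
    by (rule square_integrable_imp_integrable) (use k2 in auto)
  have "dvar M k \<le> ennreal (2 * (LINT x|M. (k x)\<^sup>2))"
    unfolding dvar_eq_variance[OF assms(1) k1 k2] by (intro ennreal_leI) auto
  also have "\<dots> = 2 * (\<integral>\<^sup>+x. ennreal ((k x)\<^sup>2) \<partial>M)"
    using k2 by (subst nn_integral_eq_integral) (auto simp: ennreal_mult')
  finally show ?thesis .
qed (auto simp: ennreal_mult_eq_top_iff)

text \<open>The diagonals of a quadrilateral against its sides: applied to the four values of \<open>f\<close> at the corners
  of a rectangle, this gives the Efron--Stein inequality without any integrability assumption.\<close>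

lemma quadrilateral_diagonals:
  fixes a b c d :: real
  shows "(a - c)\<^sup>2 + (b - d)\<^sup>2 \<le> (a - b)\<^sup>2 + (b - c)\<^sup>2 + (c - d)\<^sup>2 + (d - a)\<^sup>2"
proof -
  have "(a - b)\<^sup>2 + (b - c)\<^sup>2 + (c - d)\<^sup>2 + (d - a)\<^sup>2 - (a - c)\<^sup>2 - (b - d)\<^sup>2 = (a + c - b - d)\<^sup>2"
    by (simp add: power2_eq_square algebra_simps)
  then show ?thesis using zero_le_power2[of "a + c - b - d"] by linarith
qed

text \<open>The left side is \<open>dvar\<close> of f on the product of A and B, written with
  iterated integrals. Over the corners of a random rectangle both diagonals have the same integral,
  and so do opposite sides; the inequality for quadrilaterals therefore integrates to twice the
  claim.\<close>

lemma dvar_split: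
  assumes "prob_space A" "prob_space B"
    and [measurable]: "(\<lambda>(a, b). f a b) \<in> borel_measurable (A \<Otimes>\<^sub>M B)"
  shows "(\<integral>\<^sup>+a. \<integral>\<^sup>+b. \<integral>\<^sup>+a'. \<integral>\<^sup>+b'. ennreal ((f a b - f a' b')\<^sup>2) \<partial>B \<partial>A \<partial>B \<partial>A)
    \<le> (\<integral>\<^sup>+b. dvar A (\<lambda>a. f a b) \<partial>B) + (\<integral>\<^sup>+a. dvar B (f a) \<partial>A)" (is "?L \<le> ?RA + ?RB")
proof -
  interpret A: prob_space A by fact
  interpret B: prob_space B by fact
  interpret AB: pair_sigma_finite A B by unfold_locales
  interpret BA: pair_sigma_finite B A by unfold_locales
  interpret AA: pair_sigma_finite A A by unfold_locales
  interpret BB: pair_sigma_finite B B by unfold_locales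
  let ?d = "\<lambda>a b a' b'. ennreal ((f a b - f a' b')\<^sup>2)"
  let ?I = "\<lambda>g. \<integral>\<^sup>+a. \<integral>\<^sup>+b. \<integral>\<^sup>+a'. \<integral>\<^sup>+b'. (g a b a' b' :: ennreal) \<partial>B \<partial>A \<partial>B \<partial>A"
  \<comment> \<open>Fubini exchanges only neighbouring integrals, so a and a' trade places in three
    moves: b past a', then a past a', then b back.\<close>
  have diag: "?I (\<lambda>a b a' b'. ?d a' b a b') = ?L"
  proof -
    have "?I (\<lambda>a b a' b'. ?d a' b a b') = (\<integral>\<^sup>+a. \<integral>\<^sup>+a'. \<integral>\<^sup>+b. \<integral>\<^sup>+b'. ?d a' b a b' \<partial>B \<partial>B \<partial>A \<partial>A)"
      by (intro nn_integral_cong AB.Fubini') measurable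
    also have "\<dots> = (\<integral>\<^sup>+a'. \<integral>\<^sup>+a. \<integral>\<^sup>+b. \<integral>\<^sup>+b'. ?d a' b a b' \<partial>B \<partial>B \<partial>A \<partial>A)"
      by (intro AA.Fubini') measurable
    also have "\<dots> = ?L"
      by (intro nn_integral_cong BA.Fubini') measurable
    finally show ?thesis .
  qed
  have s1: "?I (\<lambda>a b a' b'. ?d a b a' b) = ?RA"
  proof -
    have "?I (\<lambda>a b a' b'. ?d a b a' b) = (\<integral>\<^sup>+a. \<integral>\<^sup>+b. \<integral>\<^sup>+a'. ?d a b a' b \<partial>A \<partial>B \<partial>A)"
      by (simp add: B.emeasure_space_1)
    also have "\<dots> = (\<integral>\<^sup>+b. \<integral>\<^sup>+a. \<integral>\<^sup>+a'. ?d a b a' b \<partial>A \<partial>A \<partial>B)"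
      by (rule BA.Fubini') measurable
    finally show ?thesis by (simp add: dvar_def)
  qed
  have s3: "?I (\<lambda>a b a' b'. ?d a b' a' b') = ?RA"
  proof -
    have "?I (\<lambda>a b a' b'. ?d a b' a' b') = (\<integral>\<^sup>+a. \<integral>\<^sup>+a'. \<integral>\<^sup>+b'. ?d a b' a' b' \<partial>B \<partial>A \<partial>A)"
      by (simp add: B.emeasure_space_1)
    also have "\<dots> = (\<integral>\<^sup>+a. \<integral>\<^sup>+b'. \<integral>\<^sup>+a'. ?d a b' a' b' \<partial>A \<partial>B \<partial>A)"
      by (intro nn_integral_cong BA.Fubini') measurable
    also have "\<dots> = (\<integral>\<^sup>+b'. \<integral>\<^sup>+a. \<integral>\<^sup>+a'. ?d a b' a' b' \<partial>A \<partial>A \<partial>B)"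
      by (rule BA.Fubini') measurable
    finally show ?thesis by (simp add: dvar_def)
  qed
  have s2: "?I (\<lambda>a b a' b'. ?d a' b a' b') = ?RB"
  proof -
    have "?I (\<lambda>a b a' b'. ?d a' b a' b') = (\<integral>\<^sup>+b. \<integral>\<^sup>+a'. \<integral>\<^sup>+b'. ?d a' b a' b' \<partial>B \<partial>A \<partial>B)"
      by (simp add: A.emeasure_space_1)
    also have "\<dots> = (\<integral>\<^sup>+a'. \<integral>\<^sup>+b. \<integral>\<^sup>+b'. ?d a' b a' b' \<partial>B \<partial>B \<partial>A)"
      by (rule AB.Fubini') measurable
    finally show ?thesis by (simp add: dvar_def)
  qed
  have s4: "?I (\<lambda>a b a' b'. ?d a b a b') = ?RB"
    by (simp add: A.emeasure_space_1 dvar_def)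
  have I_add: "?I (\<lambda>a b a' b'. g (a, b, a', b') + h (a, b, a', b'))
      = ?I (\<lambda>a b a' b'. g (a, b, a', b')) + ?I (\<lambda>a b a' b'. h (a, b, a', b'))"
    if [measurable]: "g \<in> borel_measurable (A \<Otimes>\<^sub>M B \<Otimes>\<^sub>M A \<Otimes>\<^sub>M B)"
      "h \<in> borel_measurable (A \<Otimes>\<^sub>M B \<Otimes>\<^sub>M A \<Otimes>\<^sub>M B)" for g h
    by (simp add: nn_integral_add cong: nn_integral_cong_simp)
  note I_add = I_add[of "\<lambda>(a, b, a', b'). G a b a' b'" "\<lambda>(a, b, a', b'). H a b a' b'" for G H, simplified]
  have "2 * ?L = ?I ?d + ?I (\<lambda>a b a' b'. ?d a' b a b')"
    unfolding diag by (simp add: mult_2)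
  also have "\<dots> = ?I (\<lambda>a b a' b'. ?d a b a' b' + ?d a' b a b')"
    by (rule I_add[symmetric]) measurable
  also have "\<dots> \<le> ?I (\<lambda>a b a' b'. ?d a b a' b + ?d a' b a' b' + ?d a b' a' b' + ?d a b a b')"
  proof (intro nn_integral_mono)
    fix a b a' b'
    show "?d a b a' b' + ?d a' b a b' \<le> ?d a b a' b + ?d a' b a' b' + ?d a b' a' b' + ?d a b a b'"
      using quadrilateral_diagonals[of "f a b" "f a' b'" "f a' b" "f a b'"]
      by (simp flip: ennreal_plus add: ennreal_leI power2_commute add_ac)
  qed
  also have "\<dots> = ?I (\<lambda>a b a' b'. ?d a b a' b) + ?I (\<lambda>a b a' b'. ?d a' b a' b')
      + ?I (\<lambda>a b a' b'. ?d a b' a' b') + ?I (\<lambda>a b a' b'. ?d a b a b')"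
    by (simp add: I_add del: nn_integral_const)
  also have "\<dots> = ?RA + ?RB + ?RA + ?RB" unfolding s1 s2 s3 s4 ..
  also have "\<dots> = 2 * (?RA + ?RB)" by (simp add: mult_2 add_ac)
  finally show ?thesis by (subst (asm) ennreal_mult_le_mult_iff) auto
qed

lemma measurable_dvar_fun_upd:
  assumes "prob_space N" "j \<in> I" and [measurable]: "f \<in> borel_measurable (PiM I (\<lambda>_. N))"
  shows "(\<lambda>x. dvar N (\<lambda>t. f (x(j := t)))) \<in> borel_measurable (PiM I (\<lambda>_. N))"
proof -
  interpret prob_space N by fact
  have [measurable]: "(\<lambda>(x, t). f (x(j := t))) \<in> borel_measurable (PiM I (\<lambda>_. N) \<Otimes>\<^sub>M N)"
  proof -
    have "(\<lambda>z. (fst z)(j := snd z)) \<in> measurable (PiM I (\<lambda>_. N) \<Otimes>\<^sub>M N) (PiM I (\<lambda>_. N))"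
      by (rule measurable_fun_upd[of I I j]) (use assms(2) in auto)
    then show ?thesis by (simp add: case_prod_beta')
  qed
  show ?thesis unfolding dvar_def by measurable
qed

text \<open>Induction on the index set: \<open>dvar_split\<close> separates the new coordinate, and
  the induction hypothesis is applied to the slices in which this coordinate is fixed. The constant
  stays 1 at every step, which makes the Gaussian inequality below independent of the
  dimension.\<close>

lemma efron_stein_PiM:
  assumes N: "prob_space N" and "finite I" and "f \<in> borel_measurable (PiM I (\<lambda>_. N))"
  shows "dvar (PiM I (\<lambda>_. N)) f \<le> (\<Sum>i\<in>I. \<integral>\<^sup>+x. dvar N (\<lambda>t. f (x(i := t))) \<partial>PiM I (\<lambda>_. N))"
  using assms(2,3)
proof (induction I arbitrary: f rule: finite_induct)
  case empty
  show ?case by (simp add: dvar_def PiM_empty nn_integral_count_space_finite)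
next
  case (insert i I)
  interpret N: prob_space N by fact
  interpret product_prob_space "\<lambda>_. N" by unfold_locales
  let ?P = "PiM I (\<lambda>_. N)" and ?P' = "PiM (insert i I) (\<lambda>_. N)"
  note f [measurable] = insert.prems
  have P: "prob_space ?P" by (intro prob_space_PiM N)
  interpret PP: prob_space ?P by fact
  interpret PP': prob_space ?P' by (intro prob_space_PiM N)
  have m2 [measurable]: "(\<lambda>(x, t). f (x(i := t))) \<in> borel_measurable (?P \<Otimes>\<^sub>M N)"
  proof -
    have "(\<lambda>z. (fst z)(i := snd z)) \<in> measurable (?P \<Otimes>\<^sub>M N) ?P'"
      by (rule measurable_fun_upd[of _ I]) (use insert.hyps in auto)
    then show ?thesis by (simp add: case_prod_beta')
  qed
  have "dvar ?P' f = (\<integral>\<^sup>+x. \<integral>\<^sup>+t. \<integral>\<^sup>+x'. \<integral>\<^sup>+t'. ennreal ((f (x(i := t)) - f (x'(i := t')))\<^sup>2) \<partial>N \<partial>?P \<partial>N \<partial>?P)"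
  proof -
    have "dvar ?P' f = (\<integral>\<^sup>+x. \<integral>\<^sup>+t. \<integral>\<^sup>+z. ennreal ((f (x(i := t)) - f z)\<^sup>2) \<partial>?P' \<partial>N \<partial>?P)"
      unfolding dvar_def by (rule product_nn_integral_insert) (use insert.hyps in measurable)
    also have "\<dots> = (\<integral>\<^sup>+x. \<integral>\<^sup>+t. \<integral>\<^sup>+x'. \<integral>\<^sup>+t'. ennreal ((f (x(i := t)) - f (x'(i := t')))\<^sup>2) \<partial>N \<partial>?P \<partial>N \<partial>?P)"
      by (intro nn_integral_cong product_nn_integral_insert) (use insert.hyps in measurable)
    finally show ?thesis .
  qed
  also have "\<dots> \<le> (\<integral>\<^sup>+t. dvar ?P (\<lambda>x. f (x(i := t))) \<partial>N) + (\<integral>\<^sup>+x. dvar N (\<lambda>t. f (x(i := t))) \<partial>?P)"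
    by (rule dvar_split[OF P N m2])
  \<comment> \<open>The integrand overwrites coordinate i, so integrating over this coordinate too,
    against a probability measure, changes nothing.\<close>
  also have "(\<integral>\<^sup>+x. dvar N (\<lambda>t. f (x(i := t))) \<partial>?P) = (\<integral>\<^sup>+x. dvar N (\<lambda>t. f (x(i := t))) \<partial>?P')"
    by (subst product_nn_integral_insert[OF insert.hyps(1,2) measurable_dvar_fun_upd[OF N insertI1 f]])
       (simp add: N.emeasure_space_1)
  also have "(\<integral>\<^sup>+t. dvar ?P (\<lambda>x. f (x(i := t))) \<partial>N)
      \<le> (\<integral>\<^sup>+t. (\<Sum>j\<in>I. \<integral>\<^sup>+x. dvar N (\<lambda>s. f (x(j := s, i := t))) \<partial>?P) \<partial>N)"
    by (rule nn_integral_mono, rule insert.IH) measurable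
  also have "\<dots> = (\<Sum>j\<in>I. \<integral>\<^sup>+t. \<integral>\<^sup>+x. dvar N (\<lambda>s. f (x(i := t, j := s))) \<partial>?P \<partial>N)"
  proof (subst nn_integral_sum)
    fix j assume j: "j \<in> I"
    have ij: "x(j := s, i := t) = x(i := t, j := s)" for x :: "'b \<Rightarrow> 'a" and s t
      using j insert.hyps by (auto simp: fun_eq_iff)
    have "(\<lambda>z. (snd z)(i := fst z)) \<in> measurable (N \<Otimes>\<^sub>M ?P) ?P'"
      by (rule measurable_fun_upd[where J = I]) auto
    from measurable_compose[OF this measurable_dvar_fun_upd[OF N insertI2[OF j] f]]
    have [measurable]: "(\<lambda>(t, x). dvar N (\<lambda>s. f (x(i := t, j := s)))) \<in> borel_measurable (N \<Otimes>\<^sub>M ?P)"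
      unfolding case_prod_beta' .
    show "(\<lambda>t. \<integral>\<^sup>+x. dvar N (\<lambda>s. f (x(j := s, i := t))) \<partial>?P) \<in> borel_measurable N"
      unfolding ij by measurable
  next
    show "(\<Sum>j\<in>I. \<integral>\<^sup>+t. \<integral>\<^sup>+x. dvar N (\<lambda>s. f (x(j := s, i := t))) \<partial>?P \<partial>N)
        = (\<Sum>j\<in>I. \<integral>\<^sup>+t. \<integral>\<^sup>+x. dvar N (\<lambda>s. f (x(i := t, j := s))) \<partial>?P \<partial>N)"
      using insert.hyps by (intro sum.cong refl nn_integral_cong) (metis fun_upd_twist)
  qed
  also have "\<dots> = (\<Sum>j\<in>I. \<integral>\<^sup>+x. dvar N (\<lambda>s. f (x(j := s))) \<partial>?P')"
    by (intro sum.cong refl product_nn_integral_insert_rev[symmetric] insert.hyps measurable_dvar_fun_upd N f)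
      simp
  finally have "dvar ?P' f \<le> (\<Sum>j\<in>I. \<integral>\<^sup>+x. dvar N (\<lambda>s. f (x(j := s))) \<partial>?P')
      + (\<integral>\<^sup>+x. dvar N (\<lambda>t. f (x(i := t))) \<partial>?P')"
    by (blast intro: add_right_mono)
  then show ?case
    using insert.hyps by (simp only: sum.insert add.commute not_False_eq_True)
qed

section \<open>The Gaussian Poincare inequality\<close>

text \<open>The normal law of variance 1 / (2 lam), whose density is proportional to exp (- lam
  t^2).\<close>

definition gauss1 :: "real \<Rightarrow> real measure" where
  "gauss1 lam = density lborel (normal_density 0 (1 / sqrt (2 * lam)))"

lemma normal_density_gauss1:
  "lam > 0 \<Longrightarrow> normal_density 0 (1 / sqrt (2 * lam)) t = sqrt (lam / pi) * exp (- lam * t\<^sup>2)"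
  by (simp add: normal_density_def power_divide real_sqrt_divide field_simps real_sqrt_mult)

lemma sets_gauss1 [measurable_cong, simp]: "sets (gauss1 lam) = sets borel"
  and space_gauss1 [simp]: "space (gauss1 lam) = UNIV"
  by (simp_all add: gauss1_def)

lemma prob_space_gauss1: "lam > 0 \<Longrightarrow> prob_space (gauss1 lam)"
  unfolding gauss1_def by (rule prob_space_normal_density) simp

lemma nn_integral_gauss1:
  assumes "lam > 0" and [measurable]: "f \<in> borel_measurable borel"
  shows "(\<integral>\<^sup>+t. f t \<partial>gauss1 lam) = ennreal (sqrt (lam / pi)) * (\<integral>\<^sup>+t. ennreal (exp (- lam * t\<^sup>2)) * f t \<partial>lborel)"
  using assms(1) unfolding gauss1_def
  by (subst nn_integral_density)
     (auto simp: normal_density_gauss1 ennreal_mult' mult.assoc simp flip: nn_integral_cmult)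

text \<open>The left side is the derivative of (g t / t) g t exp (- lam t^2) at s as the product
  rule delivers it, with u, v, E for the values of g, g' and the exponential. In terms of w = u / s
  it becomes polynomial.\<close>

lemma hardy_derivative_identity: fixes E :: real assumes "s \<noteq> 0"
  shows "((v * s - u * 1) / (s * s) * u + v * (u / s)) * E + E * (- lam * (2 * s)) * (u / s * u)
      = E * (2 * u * v / s - u\<^sup>2 / s\<^sup>2 - 2 * lam * u\<^sup>2)"
proof -
  define w where "w = u / s"
  have u: "u = w * s" using assms by (simp add: w_def)
  have "v * s - u * 1 = (v - w) * s" by (simp add: u left_diff_distrib)
  then have "(v * s - u * 1) / (s * s) * u = (v - w) * w" using assms by (simp add: u)
  moreover have "2 * u * v / s = 2 * w * v" "u\<^sup>2 / s\<^sup>2 = w\<^sup>2" using assms by (simp_all add: u power_mult_distrib)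
  moreover have "((v - w) * w + v * w) * E + E * (- lam * (2 * s)) * (w * u) = E * (2 * w * v - w\<^sup>2 - 2 * lam * u\<^sup>2)"
    unfolding u by (simp add: power2_eq_square algebra_simps)
  ultimately show ?thesis unfolding w_def[symmetric] by metis
qed
text \<open>The difference is E (v - u / s)^2. It vanishes for linear g, which is why the constant 2
  lam is sharp.\<close>

lemma hardy_square_nonneg: fixes E :: real assumes "E \<ge> 0"
  shows "0 \<le> E * (v\<^sup>2 - 2 * lam * u\<^sup>2) - E * (2 * u * v / s - u\<^sup>2 / s\<^sup>2 - 2 * lam * u\<^sup>2)"
proof -
  define w where "w = u / s"
  have "2 * u * v / s = 2 * w * v" "u\<^sup>2 / s\<^sup>2 = w\<^sup>2"
    by (simp_all add: power_divide w_def)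
  moreover have "E * (v\<^sup>2 - 2 * lam * u\<^sup>2) - E * (2 * w * v - w\<^sup>2 - 2 * lam * u\<^sup>2) = E * (v - w)\<^sup>2"
    by (simp add: power2_eq_square algebra_simps)
  ultimately show ?thesis using assms by simp
qed

text \<open>The function \<open>g\<^sup>2 \<phi> / t\<close> with \<open>\<phi> = exp (- lam t\<^sup>2)\<close> has derivative
  at most \<open>(g'\<^sup>2 - 2 lam g\<^sup>2) \<phi>\<close>; integrating this gives the sharp constant.\<close>

lemma gaussian_hardy_interval:
  fixes g g' :: "real \<Rightarrow> real"
  assumes lam: "lam > 0" and g: "\<And>t. (g has_real_derivative g' t) (at t)"
    and g': "continuous_on UNIV g'" and g0: "g 0 = 0" and R: "0 < R"
  shows "0 \<le> integral {0..R} (\<lambda>t. exp (- lam * t\<^sup>2) * ((g' t)\<^sup>2 - 2 * lam * (g t)\<^sup>2))"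
proof -
  define p where "p = (\<lambda>t. exp (- lam * t\<^sup>2) * ((g' t)\<^sup>2 - 2 * lam * (g t)\<^sup>2))"
  define F where "F = (\<lambda>t. g t / t * g t * exp (- lam * t\<^sup>2))"
  \<comment> \<open>K is nondecreasing and vanishes at 0, so the integral up to R is at least
    \<open>F R\<close>, which is nonnegative.\<close>
  define K where "K = (\<lambda>t. integral {0..t} p - F t)"
  have cg: "continuous_on UNIV g"
    using g by (meson DERIV_continuous_on has_field_derivative_at_within)
  have cp: "continuous_on A p" for A
    unfolding p_def by (intro continuous_intros continuous_on_subset[OF g'] continuous_on_subset[OF cg]) auto
  \<comment> \<open>Division by zero gives F the value 0 at 0. This is also its limit there, because
    g t / t tends to g' 0 while the other factor g t tends to 0; hence K is continuous up to the
    endpoint.\<close>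
  have F0: "F 0 = 0" by (simp add: F_def)
  have contF: "isCont F t" if "t \<ge> 0" for t
  proof (cases "t = 0")
    case True
    have "(\<lambda>t. g t / t) \<midarrow>0\<rightarrow> g' 0"
      using g[of 0] by (simp add: has_field_derivative_iff g0)
    moreover have "g \<midarrow>0\<rightarrow> 0"
      using cg g0 by (metis UNIV_I continuous_on_eq_continuous_at isCont_def open_UNIV)
    moreover have "(\<lambda>t. exp (- lam * t\<^sup>2)) \<midarrow>0\<rightarrow> exp (- lam * 0\<^sup>2)"
      by (intro tendsto_intros)
    ultimately have "F \<midarrow>0\<rightarrow> g' 0 * 0 * exp (- lam * 0\<^sup>2)"
      unfolding F_def by (intro tendsto_mult)
    then show ?thesis using True F0 by (simp add: isCont_def)
  next
    case False
    then show ?thesis unfolding F_def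
      using g by (intro continuous_intros) (auto intro: DERIV_isCont)
  qed
  have "K 0 \<le> K R"
  proof (rule DERIV_nonneg_imp_increasing_open[where f = K])
    show "continuous_on {0..R} K" unfolding K_def
    proof (intro continuous_on_diff)
      show "continuous_on {0..R} (\<lambda>t. integral {0..t} p)"
        by (intro indefinite_integral_continuous_1 integrable_continuous_real cp)
      show "continuous_on {0..R} F"
        using contF by (intro continuous_at_imp_continuous_on) auto
    qed
  next
    fix t assume t: "0 < t" "t < R"
    let ?F' = "exp (- lam * t\<^sup>2) * (2 * g t * g' t / t - (g t)\<^sup>2 / t\<^sup>2 - 2 * lam * (g t)\<^sup>2)"
    have dE: "((\<lambda>t. exp (- lam * t\<^sup>2)) has_real_derivative exp (- lam * t\<^sup>2) * (- lam * (2 * t))) (at t)"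
      by (auto intro!: derivative_eq_intros)
    have dG: "((\<lambda>t. g t / t) has_real_derivative (g' t * t - g t * 1) / (t * t)) (at t)"
      by (rule DERIV_divide[OF g DERIV_ident]) (use t in simp)
    have "(F has_real_derivative ((g' t * t - g t * 1) / (t * t) * g t + g' t * (g t / t)) * exp (- lam * t\<^sup>2)
        + exp (- lam * t\<^sup>2) * (- lam * (2 * t)) * (g t / t * g t)) (at t)"
      unfolding F_def by (rule DERIV_mult[OF DERIV_mult[OF dG g] dE])
    moreover have "((g' t * t - g t * 1) / (t * t) * g t + g' t * (g t / t)) * exp (- lam * t\<^sup>2)
        + exp (- lam * t\<^sup>2) * (- lam * (2 * t)) * (g t / t * g t) = ?F'"
      by (rule hardy_derivative_identity) (use t in auto)
    ultimately have dF: "(F has_real_derivative ?F') (at t)" by (simp only:)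
    have "((\<lambda>t. integral {0..t} p) has_real_derivative p t) (at t within {0..R})"
      using t by (intro integral_has_real_derivative cp) auto
    then have dI: "((\<lambda>t. integral {0..t} p) has_real_derivative p t) (at t)"
      unfolding at_within_Icc_at[OF t] .
    have "(K has_real_derivative p t - ?F') (at t)"
      unfolding K_def by (intro DERIV_diff dI dF)
    moreover have "0 \<le> p t - ?F'"
      unfolding p_def by (rule hardy_square_nonneg) (use t in auto)
    ultimately show "\<exists>y. (K has_real_derivative y) (at t) \<and> 0 \<le> y" by blast
  qed (use R in simp)
  moreover have "0 \<le> F R" using R by (simp add: F_def)
  ultimately show ?thesis using F0 by (simp add: K_def p_def)
qed

text \<open>Monotone convergence from bounded intervals; with values in \<open>ennreal\<close> no
  integrability of g or g' has to be assumed. The half-line is closed on the left and open on the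
  right so that this bound and its reflection can be added without counting the origin twice on the
  right.\<close>

lemma gaussian_hardy_half_line:
  fixes g g' :: "real \<Rightarrow> real"
  assumes lam: "lam > 0" and g: "\<And>t. (g has_real_derivative g' t) (at t)"
    and g': "continuous_on UNIV g'" and g0: "g 0 = 0"
  shows "(\<integral>\<^sup>+t. ennreal (exp (- lam * t\<^sup>2) * (2 * lam * (g t)\<^sup>2)) * indicator {0..} t \<partial>lborel)
    \<le> (\<integral>\<^sup>+t. ennreal (exp (- lam * t\<^sup>2) * (g' t)\<^sup>2) * indicator {0<..} t \<partial>lborel)"
proof -
  let ?a = "\<lambda>t. exp (- lam * t\<^sup>2) * (2 * lam * (g t)\<^sup>2)" and ?b = "\<lambda>t. exp (- lam * t\<^sup>2) * (g' t)\<^sup>2"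
  have cg: "continuous_on UNIV g"
    using g by (meson DERIV_continuous_on has_field_derivative_at_within)
  have ca: "continuous_on A ?a" and cb: "continuous_on A ?b" for A
    by (intro continuous_intros continuous_on_subset[OF g'] continuous_on_subset[OF cg]; simp)+
  have [measurable]: "?a \<in> borel_measurable borel" "?b \<in> borel_measurable borel"
    using ca[of UNIV] cb[of UNIV] by (auto intro: borel_measurable_continuous_onI)
  have nn: "(\<integral>\<^sup>+t. ennreal (u t) * indicator {0..R} t \<partial>lborel) = ennreal (integral {0..R} u)"
    if u: "continuous_on {0..R} u" "\<And>t. 0 \<le> u t" for u :: "real \<Rightarrow> real" and R
  proof -
    have si: "set_integrable lborel {0..R} u" by (rule borel_integrable_atLeastAtMost') fact
    have "(\<integral>\<^sup>+t. ennreal (u t) * indicator {0..R} t \<partial>lborel)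
        = (\<integral>\<^sup>+t. ennreal (indicator {0..R} t *\<^sub>R u t) \<partial>lborel)"
      by (intro nn_integral_cong) (auto simp: indicator_def)
    also have "\<dots> = ennreal (LINT t:{0..R}|lborel. u t)"
      unfolding set_lebesgue_integral_def
      by (rule nn_integral_eq_integral) (use si u in \<open>auto simp: set_integrable_def\<close>)
    finally show ?thesis using set_borel_integral_eq_integral[OF si] by simp
  qed
  have bound: "(\<integral>\<^sup>+t. ennreal (?a t) * indicator {0..real n} t \<partial>lborel)
      \<le> (\<integral>\<^sup>+t. ennreal (?b t) * indicator {0<..} t \<partial>lborel)" for n
  proof (cases "n = 0")
    case True
    have "(\<integral>\<^sup>+t. ennreal (?a t) * indicator {0..real n} t \<partial>lborel) = 0"
      using True nn[OF ca] lam by simp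
    then show ?thesis by simp
  next
    case False
    have "integral {0..real n} ?a \<le> integral {0..real n} ?b"
    proof -
      have "integral {0..real n} (\<lambda>t. exp (- lam * t\<^sup>2) * ((g' t)\<^sup>2 - 2 * lam * (g t)\<^sup>2))
          = integral {0..real n} ?b - integral {0..real n} ?a"
        unfolding Henstock_Kurzweil_Integration.integral_diff[OF integrable_continuous_real[OF cb]
            integrable_continuous_real[OF ca], symmetric]
        by (simp add: right_diff_distrib)
      then show ?thesis
        using gaussian_hardy_interval[OF lam g g' g0, of "real n"] False by simp
    qed
    then have "(\<integral>\<^sup>+t. ennreal (?a t) * indicator {0..real n} t \<partial>lborel)
        \<le> (\<integral>\<^sup>+t. ennreal (?b t) * indicator {0..real n} t \<partial>lborel)"
      using lam by (subst nn[OF ca], simp, subst nn[OF cb], simp) (rule ennreal_leI)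
    also have "\<dots> \<le> (\<integral>\<^sup>+t. ennreal (?b t) * indicator {0<..} t \<partial>lborel)"
    proof (rule nn_integral_mono_AE)
      show "AE t in lborel. ennreal (?b t) * indicator {0..real n} t \<le> ennreal (?b t) * indicator {0<..} t"
        using AE_lborel_singleton[of "0::real"] by eventually_elim (auto simp: indicator_def)
    qed
    finally show ?thesis .
  qed
  have lim: "(SUP n. ennreal (?a t) * indicator {0..real n} t) = ennreal (?a t) * indicator {0..} t" for t
  proof (rule antisym)
    obtain n where "t \<le> real n" using real_arch_simple by blast
    then have "ennreal (?a t) * indicator {0..} t \<le> ennreal (?a t) * indicator {0..real n} t"
      by (auto simp: indicator_def)
    then show "ennreal (?a t) * indicator {0..} t \<le> (SUP n. ennreal (?a t) * indicator {0..real n} t)"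
      by (rule SUP_upper2[OF UNIV_I])
  qed (auto intro!: SUP_least simp: indicator_def)
  have "(\<integral>\<^sup>+t. ennreal (?a t) * indicator {0..} t \<partial>lborel)
      = (\<integral>\<^sup>+t. (SUP n. ennreal (?a t) * indicator {0..real n} t) \<partial>lborel)"
    unfolding lim ..
  also have "\<dots> = (SUP n. \<integral>\<^sup>+t. ennreal (?a t) * indicator {0..real n} t \<partial>lborel)"
  proof (rule nn_integral_monotone_convergence_SUP)
    show "incseq (\<lambda>n t. ennreal (?a t) * indicator {0..real n} t)"
      by (auto simp: incseq_def le_fun_def indicator_def)
  qed measurable
  also have "\<dots> \<le> (\<integral>\<^sup>+t. ennreal (?b t) * indicator {0<..} t \<partial>lborel)"
    by (intro SUP_least bound)
  finally show ?thesis .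
qed

lemma gaussian_hardy:
  fixes g g' :: "real \<Rightarrow> real"
  assumes lam: "lam > 0" and g: "\<And>t. (g has_real_derivative g' t) (at t)"
    and g': "continuous_on UNIV g'" and g0: "g 0 = 0"
  shows "(\<integral>\<^sup>+t. ennreal (2 * lam * (g t)\<^sup>2) \<partial>gauss1 lam) \<le> (\<integral>\<^sup>+t. ennreal ((g' t)\<^sup>2) \<partial>gauss1 lam)"
proof -
  let ?a = "\<lambda>t. ennreal (exp (- lam * t\<^sup>2) * (2 * lam * (g t)\<^sup>2))"
  let ?b = "\<lambda>t. ennreal (exp (- lam * t\<^sup>2) * (g' t)\<^sup>2)"
  have cg: "continuous_on UNIV g"
    using g by (meson DERIV_continuous_on has_field_derivative_at_within)
  have mg [measurable]: "g \<in> borel_measurable borel" "g' \<in> borel_measurable borel"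
    using cg g' by (auto intro: borel_measurable_continuous_onI)
  have reflect: "(\<integral>\<^sup>+t. u (- t) \<partial>lborel) = (\<integral>\<^sup>+t. u t \<partial>lborel)"
    if [measurable]: "u \<in> borel_measurable borel" for u :: "real \<Rightarrow> ennreal"
    using nn_integral_real_affine[of u "-1" 0] by simp
  have neg: "(\<integral>\<^sup>+t. ?a t * indicator {..<0} t \<partial>lborel) \<le> (\<integral>\<^sup>+t. ?b t * indicator {..<0} t \<partial>lborel)"
  proof -
    have "(\<integral>\<^sup>+t. ?a t * indicator {..<0} t \<partial>lborel) = (\<integral>\<^sup>+t. ?a (- t) * indicator {..<0} (- t) \<partial>lborel)"
      by (rule reflect[symmetric]) measurable
    also have "\<dots> \<le> (\<integral>\<^sup>+t. ?a (- t) * indicator {0..} t \<partial>lborel)"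
      by (intro nn_integral_mono) (auto simp: indicator_def)
    also have "\<dots> = (\<integral>\<^sup>+t. ennreal (exp (- lam * t\<^sup>2) * (2 * lam * (g (- t))\<^sup>2)) * indicator {0..} t \<partial>lborel)"
      by simp
    also have "\<dots> \<le> (\<integral>\<^sup>+t. ennreal (exp (- lam * t\<^sup>2) * (- g' (- t))\<^sup>2) * indicator {0<..} t \<partial>lborel)"
    proof (rule gaussian_hardy_half_line[OF lam])
      show "((\<lambda>t. g (- t)) has_real_derivative - g' (- t)) (at t)" for t
        using DERIV_chain2[OF g, of uminus "-1" t UNIV] by (simp add: DERIV_minus)
      show "continuous_on UNIV (\<lambda>t. - g' (- t))"
        by (intro continuous_intros continuous_on_compose2[OF g']) auto
    qed (simp add: g0)
    also have "\<dots> = (\<integral>\<^sup>+t. ?b (- t) * indicator {..<0} (- t) \<partial>lborel)"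
      by (intro nn_integral_cong) (auto simp: indicator_def)
    also have "\<dots> = (\<integral>\<^sup>+t. ?b t * indicator {..<0} t \<partial>lborel)"
      by (rule reflect) measurable
    finally show ?thesis .
  qed
  have "(\<integral>\<^sup>+t. ?a t \<partial>lborel) = (\<integral>\<^sup>+t. ?a t * indicator {0..} t + ?a t * indicator {..<0} t \<partial>lborel)"
    by (intro nn_integral_cong) (auto simp: indicator_def)
  also have "\<dots> = (\<integral>\<^sup>+t. ?a t * indicator {0..} t \<partial>lborel) + (\<integral>\<^sup>+t. ?a t * indicator {..<0} t \<partial>lborel)"
    by (rule nn_integral_add) measurable
  also have "\<dots> \<le> (\<integral>\<^sup>+t. ?b t * indicator {0<..} t \<partial>lborel) + (\<integral>\<^sup>+t. ?b t * indicator {..<0} t \<partial>lborel)"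
    by (intro add_mono neg gaussian_hardy_half_line assms)
  also have "\<dots> = (\<integral>\<^sup>+t. ?b t * indicator {0<..} t + ?b t * indicator {..<0} t \<partial>lborel)"
    by (rule nn_integral_add[symmetric]) measurable
  also have "\<dots> \<le> (\<integral>\<^sup>+t. ?b t \<partial>lborel)"
    by (intro nn_integral_mono) (auto simp: indicator_def)
  finally have "(\<integral>\<^sup>+t. ?a t \<partial>lborel) \<le> (\<integral>\<^sup>+t. ?b t \<partial>lborel)" .
  then show ?thesis
    using lam by (auto simp: nn_integral_gauss1 ennreal_mult' intro!: mult_left_mono)
qed

text \<open>\<open>dvar\<close> ignores constants, so g may be replaced by g - g 0, and twice its
  second moment is controlled by the Hardy inequality. Centring at g 0 instead of the mean costs
  nothing: as \<open>dvar\<close> is twice the variance, this is the sharp Gaussian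
  constant.\<close>

lemma gaussian_poincare_1:
  fixes g g' :: "real \<Rightarrow> real"
  assumes lam: "lam > 0" and g: "\<And>t. (g has_real_derivative g' t) (at t)"
    and g': "continuous_on UNIV g'"
  shows "ennreal lam * dvar (gauss1 lam) g \<le> (\<integral>\<^sup>+t. ennreal ((g' t)\<^sup>2) \<partial>gauss1 lam)"
proof -
  have "continuous_on UNIV g"
    using g by (meson DERIV_continuous_on has_field_derivative_at_within)
  then have [measurable]: "g \<in> borel_measurable borel"
    by (rule borel_measurable_continuous_onI)
  have "ennreal lam * dvar (gauss1 lam) g = ennreal lam * dvar (gauss1 lam) (\<lambda>t. g t - g 0)"
    by (simp add: dvar_def)
  also have "\<dots> \<le> ennreal lam * (2 * (\<integral>\<^sup>+t. ennreal ((g t - g 0)\<^sup>2) \<partial>gauss1 lam))"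
    by (intro mult_left_mono dvar_le_second_moment prob_space_gauss1 lam) auto
  also have "\<dots> = (\<integral>\<^sup>+t. ennreal (2 * lam * (g t - g 0)\<^sup>2) \<partial>gauss1 lam)"
    using lam by (simp add: nn_integral_cmult ennreal_mult' mult_ac)
  also have "\<dots> \<le> (\<integral>\<^sup>+t. ennreal ((g' t)\<^sup>2) \<partial>gauss1 lam)"
    by (rule gaussian_hardy[OF lam _ g']) (auto intro!: derivative_eq_intros g)
  finally show ?thesis .
qed

section \<open>The Gaussian measure on R^d: measurability, bounded supports, tensorised
  inequality\<close>

abbreviation has_partial :: "((nat \<Rightarrow> real) \<Rightarrow> real) \<Rightarrow> real \<Rightarrow> nat \<Rightarrow> (nat \<Rightarrow> real) \<Rightarrow> bool" where
  "has_partial f D i x \<equiv> ((\<lambda>t. f (x(i := t))) has_real_derivative D) (at (x i))"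

definition gauss :: "nat \<Rightarrow> real \<Rightarrow> (nat \<Rightarrow> real) measure" where
  "gauss d lam = (\<Pi>\<^sub>M i\<in>{..<d}. gauss1 lam)"

lemma prob_space_gauss: "lam > 0 \<Longrightarrow> prob_space (gauss d lam)"
  unfolding gauss_def by (intro prob_space_PiM prob_space_gauss1)

lemma space_gauss [simp]: "space (gauss d lam) = Rd d"
  by (simp add: gauss_def space_PiM Rd_def)

lemma sets_gauss [measurable_cong]: "sets (gauss d lam) = sets (\<Pi>\<^sub>M i\<in>{..<d}. borel)"
  unfolding gauss_def by (rule sets_PiM_cong) auto

lemma sets_lborel_Rd [measurable_cong]: "sets (lborel_Rd d) = sets (\<Pi>\<^sub>M i\<in>{..<d}. borel)"
  unfolding lborel_Rd_def by (rule sets_PiM_cong) auto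

lemma space_lborel_Rd [simp]: "space (lborel_Rd d) = Rd d"
  by (simp add: lborel_Rd_def space_PiM Rd_def)

lemma fun_upd_in_Rd: "x \<in> Rd d \<Longrightarrow> i < d \<Longrightarrow> x(i := t) \<in> Rd d"
  by (auto simp: Rd_def PiE_def extensional_def)

lemma continuous_on_coordinate: "continuous_on A (\<lambda>x. x i :: real)"
  by (rule continuous_on_subset[OF continuous_on_product_coordinates]) simp

lemma continuous_on_fun_upd: "continuous_on UNIV (\<lambda>t. x(i := t :: real))"
proof (rule continuous_on_coordinatewise_then_product)
  show "continuous_on UNIV (\<lambda>t. (x(i := t)) j)" for j
    by (cases "j = i") auto
qed

lemma continuous_on_line:
  assumes "continuous_on (Rd d) f" "x \<in> Rd d" "i < d"
  shows "continuous_on UNIV (\<lambda>t. f (x(i := t)))"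
  by (rule continuous_on_compose2[OF assms(1) continuous_on_fun_upd]) (use assms fun_upd_in_Rd in auto)

text \<open>\<open>restrict\<close> is a continuous retraction of the full function space onto the
  carrier, so f composed with it is Borel there. On the carrier the coordinates outside
  \<open>{..<d}\<close> are constant, and the Borel sets of a countable product are generated by the
  coordinates.\<close>

lemma borel_measurable_continuous_on_Rd:
  fixes f :: "(nat \<Rightarrow> real) \<Rightarrow> real"
  assumes "continuous_on (Rd d) f"
  shows "f \<in> borel_measurable (\<Pi>\<^sub>M i\<in>{..<d}. borel)"
proof -
  let ?B = "\<Pi>\<^sub>M i\<in>{..<d}. (borel :: real measure)"
  have "continuous_on UNIV (\<lambda>x. restrict x {..<d} :: nat \<Rightarrow> real)"
  proof (rule continuous_on_coordinatewise_then_product)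
    show "continuous_on UNIV (\<lambda>x. restrict x {..<d} i :: real)" for i
      by (cases "i < d") auto
  qed
  then have "continuous_on UNIV (\<lambda>x. f (restrict x {..<d}))"
    by (rule continuous_on_compose2[OF assms]) (auto simp: Rd_def PiE_def extensional_def split: if_splits)
  then have "(\<lambda>x. f (restrict x {..<d})) \<in> borel_measurable borel"
    by (rule borel_measurable_continuous_onI)
  moreover have "(\<lambda>x. x) \<in> measurable ?B borel"
  proof -
    have "(\<lambda>x. x) \<in> measurable ?B (PiM UNIV (\<lambda>_. borel))"
    proof (rule measurable_PiM_single')
      fix i :: nat
      show "(\<lambda>x. x i) \<in> measurable ?B borel"
      proof (cases "i < d")
        case False
        have "(\<lambda>x. x i) \<in> measurable ?B borel \<longleftrightarrow> (\<lambda>x. undefined) \<in> measurable ?B (borel :: real measure)"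
          by (rule measurable_cong) (use False in \<open>auto simp: space_PiM PiE_def extensional_def\<close>)
        then show ?thesis by simp
      qed simp
    qed (auto simp: space_PiM)
    then show ?thesis using measurable_cong_sets[OF refl sets_PiM_equal_borel] by blast
  qed
  ultimately have "(\<lambda>x. f (restrict x {..<d})) \<in> borel_measurable ?B"
    by (rule measurable_compose[rotated])
  moreover have "(\<lambda>x. f (restrict x {..<d})) \<in> borel_measurable ?B \<longleftrightarrow> f \<in> borel_measurable ?B"
    by (rule measurable_cong) (auto simp: space_PiM)
  ultimately show ?thesis by blast
qed

lemma borel_measurable_gauss_continuous:
  fixes f :: "(nat \<Rightarrow> real) \<Rightarrow> real"
  shows "continuous_on (Rd d) f \<Longrightarrow> f \<in> borel_measurable (gauss d lam)"
  using borel_measurable_continuous_on_Rd measurable_cong_sets[OF sets_gauss refl] by blast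

text \<open>Tychonoff: the set is a product of compact intervals and, for the indices outside
  \<open>{..<d}\<close>, of singletons.\<close>

lemma compact_box_Rd: "compact {x \<in> Rd d. \<forall>j<d. \<bar>x j\<bar> \<le> R}"
proof -
  let ?S = "\<lambda>j. if j < d then {- R..R} else {undefined :: real}"
  have "compactin euclidean (PiE UNIV ?S)"
    unfolding euclidean_product_topology[symmetric] compactin_PiE by auto
  moreover have "PiE UNIV ?S = {x \<in> Rd d. \<forall>j<d. \<bar>x j\<bar> \<le> R}"
    by (auto simp: Rd_def PiE_def Pi_iff extensional_def abs_le_iff minus_le_iff all_conj_distrib
        split: if_splits)
  ultimately show ?thesis by simp
qed

lemma bounded_continuous_on_box:
  fixes f :: "(nat \<Rightarrow> real) \<Rightarrow> real"
  assumes f: "continuous_on (Rd d) f" and supp: "\<And>x j. x \<in> Rd d \<Longrightarrow> j < d \<Longrightarrow> R < \<bar>x j\<bar> \<Longrightarrow> f x = 0"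
  obtains B where "\<And>x. x \<in> Rd d \<Longrightarrow> \<bar>f x\<bar> \<le> B"
proof -
  let ?K = "{x \<in> Rd d. \<forall>j<d. \<bar>x j\<bar> \<le> R}"
  have "compact (f ` ?K)"
    by (rule compact_continuous_image[OF continuous_on_subset[OF f] compact_box_Rd]) auto
  then have "bounded (f ` ?K)" by (rule compact_imp_bounded)
  then obtain B where B: "\<And>x. x \<in> ?K \<Longrightarrow> \<bar>f x\<bar> \<le> B"
    unfolding bounded_iff by auto
  have "\<bar>f x\<bar> \<le> max B 0" if "x \<in> Rd d" for x
    using B[of x] supp[OF that] that by (cases "x \<in> ?K") (auto simp: not_le)
  then show ?thesis by (rule that)
qed

lemma integrable_gauss_bounded:
  fixes f :: "(nat \<Rightarrow> real) \<Rightarrow> real"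
  assumes "lam > 0" "f \<in> borel_measurable (gauss d lam)" "\<And>x. x \<in> Rd d \<Longrightarrow> \<bar>f x\<bar> \<le> B"
  shows "integrable (gauss d lam) f"
proof -
  interpret prob_space "gauss d lam" by (rule prob_space_gauss) fact
  show ?thesis by (rule integrable_const_bound[of _ B]) (use assms in \<open>auto intro!: AE_I2\<close>)
qed

lemma integrable_gauss_compact_support:
  fixes f :: "(nat \<Rightarrow> real) \<Rightarrow> real"
  assumes "lam > 0" "continuous_on (Rd d) f"
    and "\<And>x j. x \<in> Rd d \<Longrightarrow> j < d \<Longrightarrow> R < \<bar>x j\<bar> \<Longrightarrow> f x = 0"
  shows "integrable (gauss d lam) f"
proof -
  obtain B where "\<And>x. x \<in> Rd d \<Longrightarrow> \<bar>f x\<bar> \<le> B"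
    using bounded_continuous_on_box[of d f R] assms(2,3) by blast
  then show ?thesis
    by (rule integrable_gauss_bounded[OF assms(1) borel_measurable_gauss_continuous[OF assms(2)]])
qed

text \<open>Replacing one coordinate by an independent copy does not change the product law.\<close>

lemma nn_integral_PiM_resample:
  assumes N: "prob_space N" and "finite I" "i \<in> I" and u: "u \<in> borel_measurable (PiM I (\<lambda>_. N))"
  shows "(\<integral>\<^sup>+x. \<integral>\<^sup>+t. u (x(i := t)) \<partial>N \<partial>PiM I (\<lambda>_. N)) = (\<integral>\<^sup>+x. u x \<partial>PiM I (\<lambda>_. N))"
proof -
  interpret N: prob_space N by fact
  interpret product_prob_space "\<lambda>_. N" by unfold_locales
  define J where "J = I - {i}"
  have J: "finite J" "i \<notin> J" "I = insert i J" using assms by (auto simp: J_def)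
  have "(\<lambda>z. (fst z)(i := snd z)) \<in> measurable (PiM I (\<lambda>_. N) \<Otimes>\<^sub>M N) (PiM I (\<lambda>_. N))"
    by (rule measurable_fun_upd[where J = I]) (use assms(3) in auto)
  from measurable_compose[OF this u]
  have [measurable]: "(\<lambda>(x, t). u (x(i := t))) \<in> borel_measurable (PiM I (\<lambda>_. N) \<Otimes>\<^sub>M N)"
    unfolding case_prod_beta' .
  have "(\<lambda>x. \<integral>\<^sup>+t. u (x(i := t)) \<partial>N) \<in> borel_measurable (PiM I (\<lambda>_. N))"
    by measurable
  then show ?thesis
    using u unfolding J(3)
    by (subst (1 2) product_nn_integral_insert[OF J(1,2)]) (auto simp: N.emeasure_space_1)
qed

text \<open>Stated for continuous partial derivatives D instead of smooth functions, because it is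
  applied to f - a times a cutoff that is only C^1. Each summand of the Efron-Stein bound is handled
  by the one-dimensional inequality along a coordinate line.\<close>

lemma gaussian_poincare:
  assumes lam: "lam > 0" and f: "continuous_on (Rd d) f"
    and D: "\<And>i. i < d \<Longrightarrow> continuous_on (Rd d) (D i)"
    and fD: "\<And>i x. i < d \<Longrightarrow> x \<in> Rd d \<Longrightarrow> has_partial f (D i x) i x"
  shows "ennreal lam * dvar (gauss d lam) f \<le> (\<integral>\<^sup>+x. ennreal (\<Sum>i<d. (D i x)\<^sup>2) \<partial>gauss d lam)"
proof -
  note N = prob_space_gauss1[OF lam]
  have [measurable]: "f \<in> borel_measurable (gauss d lam)"
    and D_meas: "\<And>i. i < d \<Longrightarrow> D i \<in> borel_measurable (gauss d lam)"
    using f D by (auto intro: borel_measurable_gauss_continuous)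
  have "ennreal lam * dvar (gauss d lam) f
      \<le> ennreal lam * (\<Sum>i<d. \<integral>\<^sup>+x. dvar (gauss1 lam) (\<lambda>t. f (x(i := t))) \<partial>gauss d lam)"
    unfolding gauss_def by (intro mult_left_mono efron_stein_PiM N) (auto simp flip: gauss_def)
  also have "\<dots> = (\<Sum>i<d. \<integral>\<^sup>+x. ennreal lam * dvar (gauss1 lam) (\<lambda>t. f (x(i := t))) \<partial>gauss d lam)"
    unfolding sum_distrib_left
    by (intro sum.cong refl nn_integral_cmult[symmetric])
       (unfold gauss_def, intro measurable_dvar_fun_upd N, auto simp flip: gauss_def)
  also have "\<dots> \<le> (\<Sum>i<d. \<integral>\<^sup>+x. (D i x)\<^sup>2 \<partial>gauss d lam)"
  proof (rule sum_mono)
    fix i assume "i \<in> {..<d}"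
    then have i: "i < d" by simp
    have "(\<integral>\<^sup>+x. ennreal lam * dvar (gauss1 lam) (\<lambda>t. f (x(i := t))) \<partial>gauss d lam)
        \<le> (\<integral>\<^sup>+x. \<integral>\<^sup>+t. ennreal ((D i (x(i := t)))\<^sup>2) \<partial>gauss1 lam \<partial>gauss d lam)"
    proof (rule nn_integral_mono)
      fix x assume "x \<in> space (gauss d lam)"
      then have x: "x \<in> Rd d" by simp
      show "ennreal lam * dvar (gauss1 lam) (\<lambda>t. f (x(i := t))) \<le> (\<integral>\<^sup>+t. ennreal ((D i (x(i := t)))\<^sup>2) \<partial>gauss1 lam)"
      proof (rule gaussian_poincare_1[OF lam])
        show "((\<lambda>t. f (x(i := t))) has_real_derivative D i (x(i := t))) (at t)" for t
          using fD[OF i fun_upd_in_Rd[OF x i], of t] by simp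
        show "continuous_on UNIV (\<lambda>t. D i (x(i := t)))"
          by (rule continuous_on_line[OF D[OF i] x i])
      qed
    qed
    also have "\<dots> = (\<integral>\<^sup>+x. (D i x)\<^sup>2 \<partial>gauss d lam)"
      unfolding gauss_def
      by (rule nn_integral_PiM_resample[OF N])
         (use i D_meas[OF i, measurable] in \<open>auto simp flip: gauss_def\<close>)
    finally show "(\<integral>\<^sup>+x. ennreal lam * dvar (gauss1 lam) (\<lambda>t. f (x(i := t))) \<partial>gauss d lam)
        \<le> (\<integral>\<^sup>+x. (D i x)\<^sup>2 \<partial>gauss d lam)" .
  qed
  also have "\<dots> = (\<integral>\<^sup>+x. (\<Sum>i<d. ennreal ((D i x)\<^sup>2)) \<partial>gauss d lam)"
    using D_meas by (intro nn_integral_sum[symmetric]) auto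
  finally show ?thesis by (simp add: sum_ennreal)
qed

section \<open>Gaussian integration by parts\<close>

lemma integral_gauss1_divergence:
  fixes g g' :: "real \<Rightarrow> real"
  assumes lam: "lam > 0" and g: "\<And>t. (g has_real_derivative g' t) (at t)"
    and g': "continuous_on UNIV g'" and supp: "\<And>t. R < \<bar>t\<bar> \<Longrightarrow> g t = 0 \<and> g' t = 0"
  shows "(LINT t|gauss1 lam. g' t - 2 * lam * t * g t) = 0"
proof -
  \<comment> \<open>Chosen so that \<open>{- S..S}\<close> is a proper interval, for every sign of
    R, and g vanishes at both endpoints and outside.\<close>
  define S where "S = \<bar>R\<bar> + 1"
  define \<phi> where "\<phi> = normal_density 0 (1 / sqrt (2 * lam))"
  define h where "h = (\<lambda>t. \<phi> t * (g' t - 2 * lam * t * g t))"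
  have phi: "\<phi> t = sqrt (lam / pi) * exp (- lam * t\<^sup>2)" for t
    unfolding \<phi>_def by (rule normal_density_gauss1[OF lam])
  have cg: "continuous_on UNIV g"
    using g by (meson DERIV_continuous_on has_field_derivative_at_within)
  have ch: "continuous_on A h" for A
    unfolding h_def phi
    by (intro continuous_intros continuous_on_subset[OF g'] continuous_on_subset[OF cg]) auto
  have [measurable]: "g \<in> borel_measurable borel" "g' \<in> borel_measurable borel"
    using cg g' by (auto intro: borel_measurable_continuous_onI)
  have d: "((\<lambda>t. \<phi> t * g t) has_real_derivative h t) (at t)" for t
    unfolding h_def phi
    by (auto intro!: derivative_eq_intros g simp: algebra_simps)
  have "(h has_integral (\<phi> S * g S - \<phi> (- S) * g (- S))) {- S..S}"
    by (rule fundamental_theorem_of_calculus)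
       (auto simp: S_def has_real_derivative_iff_has_vector_derivative[symmetric]
             intro: has_field_derivative_at_within d)
  moreover have "g S = 0" "g (- S) = 0" using supp by (auto simp: S_def)
  ultimately have "integral {- S..S} h = 0" by (simp add: integral_unique)
  moreover have "(LINT t:{- S..S}|lborel. h t) = integral {- S..S} h"
    by (rule set_borel_integral_eq_integral(2)[OF borel_integrable_atLeastAtMost'[OF ch]])
  moreover have "(LINT t:{- S..S}|lborel. h t) = (LINT t|lborel. h t)"
    unfolding set_lebesgue_integral_def
  proof (rule Bochner_Integration.integral_cong[OF refl])
    fix t
    show "indicator {- S..S} t *\<^sub>R h t = h t"
      using supp[of t] by (cases "t \<in> {- S..S}") (auto simp: h_def S_def)
  qed
  ultimately have "(LINT t|lborel. h t) = 0" by simp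
  moreover have "(LINT t|gauss1 lam. g' t - 2 * lam * t * g t) = (LINT t|lborel. h t)"
    unfolding gauss1_def h_def \<phi>_def by (subst integral_density) auto
  ultimately show ?thesis by simp
qed

lemma integral_gauss_divergence:
  assumes lam: "lam > 0" and i: "i < d" and F: "continuous_on (Rd d) F" and D: "continuous_on (Rd d) D"
    and FD: "\<And>x. x \<in> Rd d \<Longrightarrow> has_partial F (D x) i x"
    and supp: "\<And>x j. x \<in> Rd d \<Longrightarrow> j < d \<Longrightarrow> R < \<bar>x j\<bar> \<Longrightarrow> F x = 0 \<and> D x = 0"
  shows "integrable (gauss d lam) (\<lambda>x. D x - 2 * lam * x i * F x)"
    and "(LINT x|gauss d lam. D x - 2 * lam * x i * F x) = 0"
proof -
  interpret N: prob_space "gauss1 lam" by (rule prob_space_gauss1[OF lam])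
  interpret product_prob_space "\<lambda>_. gauss1 lam" by unfold_locales
  let ?u = "\<lambda>x. D x - 2 * lam * x i * F x"
  show int: "integrable (gauss d lam) ?u"
    by (rule integrable_gauss_compact_support[OF lam, where R = R])
       (use supp in \<open>auto intro!: continuous_intros F D continuous_on_coordinate\<close>)
  define J where "J = {..<d} - {i}"
  have J: "finite J" "i \<notin> J" "{..<d} = insert i J" using i by (auto simp: J_def)
  have "(LINT x|gauss d lam. ?u x)
      = (LINT x|PiM J (\<lambda>_. gauss1 lam). LINT t|gauss1 lam. ?u (x(i := t)))"
    unfolding gauss_def J(3)
    by (rule product_integral_insert[OF J(1,2)]) (use int in \<open>simp add: gauss_def J(3)\<close>)
  also have "\<dots> = (LINT x|PiM J (\<lambda>_. gauss1 lam). 0)"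
  proof (rule Bochner_Integration.integral_cong[OF refl])
    fix x assume "x \<in> space (PiM J (\<lambda>_. gauss1 lam))"
    then have x: "x(i := t) \<in> Rd d" for t
      using i by (auto simp: space_PiM Rd_def PiE_def extensional_def J_def)
    have "(LINT t|gauss1 lam. D (x(i := t)) - 2 * lam * t * F (x(i := t))) = 0"
    proof (rule integral_gauss1_divergence[OF lam])
      show "((\<lambda>t. F (x(i := t))) has_real_derivative D (x(i := t))) (at t)" for t
        using FD[OF x, of t] by simp
      show "continuous_on UNIV (\<lambda>t. D (x(i := t)))"
        using continuous_on_line[OF D x i, of 0] by simp
      show "F (x(i := t)) = 0 \<and> D (x(i := t)) = 0" if "R < \<bar>t\<bar>" for t
        using supp[OF x i, of t] that by simp
    qed
    then show "(LINT t|gauss1 lam. ?u (x(i := t))) = 0" by simp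
  qed
  finally show "(LINT x|gauss d lam. ?u x) = 0" by simp
qed

section \<open>A weighted Hardy inequality\<close>

definition sq_dist :: "nat \<Rightarrow> (nat \<Rightarrow> real) \<Rightarrow> (nat \<Rightarrow> real) \<Rightarrow> real" where
  "sq_dist d y x = (\<Sum>j<d. (x j - y j)\<^sup>2)"

definition shift_inner :: "nat \<Rightarrow> (nat \<Rightarrow> real) \<Rightarrow> (nat \<Rightarrow> real) \<Rightarrow> real" where
  "shift_inner d y x = (\<Sum>j<d. y j * (x j - y j))"

lemma sq_dist_nonneg [simp]: "0 \<le> sq_dist d y x"
  by (simp add: sq_dist_def sum_nonneg)

lemma continuous_on_sq_dist [continuous_intros]: "continuous_on A (sq_dist d y)"
  unfolding sq_dist_def by (intro continuous_intros continuous_on_coordinate)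

lemma continuous_on_shift_inner [continuous_intros]: "continuous_on A (shift_inner d y)"
  unfolding shift_inner_def by (intro continuous_intros continuous_on_coordinate)

lemma has_partial_sq_dist:
  assumes "i < d"
  shows "has_partial (sq_dist d y) (2 * (x i - y i)) i x"
proof -
  have "sq_dist d y (x(i := t)) = (t - y i)\<^sup>2 + (\<Sum>j\<in>{..<d} - {i}. (x j - y j)\<^sup>2)" for t
    unfolding sq_dist_def by (subst sum.remove[of _ i]) (use assms in \<open>auto intro!: sum.cong\<close>)
  then show ?thesis by (auto intro!: derivative_eq_intros)
qed

lemma has_partial_shift_inner:
  assumes "i < d"
  shows "has_partial (shift_inner d y) (y i) i x"
proof -
  have "shift_inner d y (x(i := t)) = y i * (t - y i) + (\<Sum>j\<in>{..<d} - {i}. y j * (x j - y j))" for t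
    unfolding shift_inner_def by (subst sum.remove[of _ i]) (use assms in \<open>auto intro!: sum.cong\<close>)
  then show ?thesis by (auto intro!: derivative_eq_intros)
qed

text \<open>Translates a support condition on the distance to y into the coordinatewise one required
  by the integration by parts.\<close>

lemma sq_dist_gt_of_coordinate:
  assumes "j < d" and "sqrt R + (\<Sum>j<d. \<bar>y j\<bar>) < \<bar>x j\<bar>" and "0 \<le> R"
  shows "R < sq_dist d y x"
proof -
  have "\<bar>y j\<bar> \<le> (\<Sum>j<d. \<bar>y j\<bar>)" using assms(1) by (intro member_le_sum) auto
  then have "sqrt R < \<bar>x j - y j\<bar>" using assms(2) by linarith
  then have "(sqrt R)\<^sup>2 < \<bar>x j - y j\<bar>\<^sup>2" using assms(3) by (intro power_strict_mono) auto
  also have "\<dots> \<le> sq_dist d y x"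
    unfolding sq_dist_def power2_abs using assms(1) by (intro member_le_sum) auto
  finally show ?thesis using assms(3) by simp
qed

text \<open>With \<open>z = x - y\<close> and \<open>n = d - 1\<close>, the field \<open>z + (2 lam / n) ((y \<bullet> z) z - \<bar>z\<bar>\<^sup>2 y)\<close>: the correction to
  the radial field is orthogonal to \<open>z\<close> and cancels the term \<open>y \<bullet> z\<close> in the Gaussian divergence,
  whatever the size of \<open>y\<close>.\<close>

definition hardy_field :: "nat \<Rightarrow> real \<Rightarrow> (nat \<Rightarrow> real) \<Rightarrow> nat \<Rightarrow> (nat \<Rightarrow> real) \<Rightarrow> real" where
  "hardy_field d lam y i x = (x i - y i)
     + 2 * lam / (real d - 1) * (shift_inner d y x * (x i - y i) - sq_dist d y x * y i)"

lemma has_partial_hardy_field: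
  assumes "i < d"
  shows "has_partial (hardy_field d lam y i)
    (1 + 2 * lam / (real d - 1) * (shift_inner d y x - y i * (x i - y i))) i x"
proof -
  define b where "b = 2 * lam / (real d - 1)"
  show ?thesis
    unfolding hardy_field_def b_def[symmetric]
    by (auto intro!: derivative_eq_intros has_partial_sq_dist has_partial_shift_inner assms simp: algebra_simps)
qed

text \<open>Write V for the field and S for 1 + (2 lam / n)^2 (|z|^2 |y|^2 - (y.z)^2). The
  orthogonality of the correction gives z.V = |z|^2. The decisive point is that the same S
  multiplies |z|^2 in |V|^2 and n in the Gaussian divergence: however long the correction makes V,
  the divergence grows in proportion.\<close>

lemma hardy_field_sums:
  fixes d :: nat and y :: "nat \<Rightarrow> real"
  defines "n \<equiv> real d - 1" and "Y \<equiv> (\<Sum>j<d. (y j)\<^sup>2)"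
  assumes "d \<ge> 2"
  shows "(\<Sum>i<d. (x i - y i) * hardy_field d lam y i x) = sq_dist d y x" (is ?radial)
    and "(\<Sum>i<d. (hardy_field d lam y i x)\<^sup>2) = sq_dist d y x
        * (1 + (2 * lam / n)\<^sup>2 * (sq_dist d y x * Y - (shift_inner d y x)\<^sup>2))" (is ?norm)
    and "(\<Sum>i<d. 1 + 2 * lam / n * (shift_inner d y x - y i * (x i - y i)) - 2 * lam * x i * hardy_field d lam y i x)
        = n * (1 + (2 * lam / n)\<^sup>2 * (sq_dist d y x * Y - (shift_inner d y x)\<^sup>2)) - 2 * lam * sq_dist d y x + 1" (is ?div)
proof -
  let ?s = "sq_dist d y x" and ?p = "shift_inner d y x"
  define b where "b = 2 * lam / n"
  have n: "n > 0" using assms by simp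
  then have bn: "b * n = 2 * lam" by (simp add: b_def)
  define z where "z = (\<lambda>i. x i - y i)"
  have V: "hardy_field d lam y i x = z i + b * (?p * z i - ?s * y i)" for i
    by (simp add: hardy_field_def z_def b_def n_def)
  have zz: "(\<Sum>i<d. z i * z i) = ?s" and yz: "(\<Sum>i<d. y i * z i) = ?p" and yy: "(\<Sum>i<d. y i * y i) = Y"
    by (simp_all add: z_def sq_dist_def shift_inner_def Y_def power2_eq_square)
  have zV: "(\<Sum>i<d. z i * hardy_field d lam y i x) = ?s"
  proof -
    have "(\<Sum>i<d. z i * hardy_field d lam y i x)
        = (\<Sum>i<d. (1 + b * ?p) * (z i * z i) - b * ?s * (y i * z i))"
      by (intro sum.cong) (auto simp: V algebra_simps)
    also have "\<dots> = (1 + b * ?p) * ?s - b * ?s * ?p"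
      by (simp only: sum_subtractf sum_distrib_left[symmetric] zz yz)
    finally show ?thesis by (simp add: algebra_simps)
  qed
  then show ?radial by (simp add: z_def)
  have "(\<Sum>i<d. (hardy_field d lam y i x)\<^sup>2)
      = (\<Sum>i<d. (1 + b * ?p)\<^sup>2 * (z i * z i) - 2 * (1 + b * ?p) * b * ?s * (y i * z i) + (b * ?s)\<^sup>2 * (y i * y i))"
    by (intro sum.cong) (auto simp: V power2_eq_square algebra_simps)
  also have "\<dots> = (1 + b * ?p)\<^sup>2 * ?s - 2 * (1 + b * ?p) * b * ?s * ?p + (b * ?s)\<^sup>2 * Y"
    by (simp only: sum_subtractf sum.distrib sum_distrib_left[symmetric] zz yz yy)
  also have "\<dots> = ?s * (1 + b\<^sup>2 * (?s * Y - ?p\<^sup>2))"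
    by (simp add: power2_eq_square algebra_simps)
  finally show ?norm by (simp only: b_def)
  have yV: "(\<Sum>i<d. y i * hardy_field d lam y i x) = (1 + b * ?p) * ?p - b * ?s * Y"
  proof -
    have "(\<Sum>i<d. y i * hardy_field d lam y i x)
        = (\<Sum>i<d. (1 + b * ?p) * (y i * z i) - b * ?s * (y i * y i))"
      by (intro sum.cong) (auto simp: V algebra_simps)
    also have "\<dots> = (1 + b * ?p) * ?p - b * ?s * Y"
      by (simp only: sum_subtractf sum_distrib_left[symmetric] yy yz)
    finally show ?thesis .
  qed
  have "(\<Sum>i<d. 1 + b * (?p - y i * (x i - y i)) - 2 * lam * x i * hardy_field d lam y i x)
      = (\<Sum>i<d. (1 + b * ?p) - b * (y i * z i) - 2 * lam * (z i * hardy_field d lam y i x) - 2 * lam * (y i * hardy_field d lam y i x))"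
    by (intro sum.cong) (auto simp: z_def algebra_simps)
  also have "\<dots> = real d * (1 + b * ?p) - b * ?p - 2 * lam * ?s - 2 * lam * ((1 + b * ?p) * ?p - b * ?s * Y)"
    by (simp only: sum_subtractf sum_distrib_left[symmetric] yz zV yV sum_constant card_lessThan)
  also have "real d = n + 1" by (simp add: n_def)
  also have "(n + 1) * (1 + b * ?p) - b * ?p - 2 * lam * ?s - 2 * lam * ((1 + b * ?p) * ?p - b * ?s * Y)
      = n * (1 + b\<^sup>2 * (?s * Y - ?p\<^sup>2)) - 2 * lam * ?s + 1"
    unfolding bn[symmetric] by (simp add: power2_eq_square algebra_simps)
  finally show ?div by (simp add: b_def)
qed

lemma shift_inner_Cauchy_Schwarz: "(shift_inner d y x)\<^sup>2 \<le> sq_dist d y x * (\<Sum>j<d. (y j)\<^sup>2)"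
  using Cauchy_Schwarz_ineq_sum[of y "\<lambda>j. x j - y j" "{..<d}"]
  by (simp add: shift_inner_def sq_dist_def mult.commute)

text \<open>The Gaussian divergence of h^2 Q V integrates to zero. Young's inequality bounds the
  term with Dh at the price of the share e of n S, and S \<ge> 1 (Cauchy-Schwarz) then removes y
  from the remaining share 1 - e. The bounded support of Q makes all integrals finite without growth
  conditions on h.\<close>

lemma weighted_hardy:
  fixes Q Q' :: "real \<Rightarrow> real" and d :: nat
  defines "n \<equiv> real d - 1"
  assumes lam: "lam > 0" and d: "d \<ge> 2" and e: "0 < e" "e \<le> 1"
    and h: "continuous_on (Rd d) h" and Dh: "\<And>i. i < d \<Longrightarrow> continuous_on (Rd d) (Dh i)"
    and hD: "\<And>i x. i < d \<Longrightarrow> x \<in> Rd d \<Longrightarrow> has_partial h (Dh i x) i x"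
    and Q: "\<And>s. s \<ge> 0 \<Longrightarrow> (Q has_real_derivative Q' s) (at s)" and Q': "continuous_on {0..} Q'"
    and Qpos: "\<And>s. s \<ge> 0 \<Longrightarrow> Q s \<ge> 0" and R: "R \<ge> 0" "\<And>s. s > R \<Longrightarrow> Q s = 0 \<and> Q' s = 0"
  shows "integrable (gauss d lam) (\<lambda>x. (h x)\<^sup>2 * (Q (sq_dist d y x) * ((1 - e) * n - 2 * lam * sq_dist d y x + 1)
      + 2 * sq_dist d y x * Q' (sq_dist d y x)))" (is "integrable _ ?L")
    and "integrable (gauss d lam) (\<lambda>x. Q (sq_dist d y x) * sq_dist d y x / (e * n) * (\<Sum>i<d. (Dh i x)\<^sup>2))"
      (is "integrable _ ?R")
    and "integral\<^sup>L (gauss d lam) (\<lambda>x. (h x)\<^sup>2 * (Q (sq_dist d y x) * ((1 - e) * n - 2 * lam * sq_dist d y x + 1)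
          + 2 * sq_dist d y x * Q' (sq_dist d y x)))
      \<le> integral\<^sup>L (gauss d lam) (\<lambda>x. Q (sq_dist d y x) * sq_dist d y x / (e * n) * (\<Sum>i<d. (Dh i x)\<^sup>2))"
proof -
  let ?s = "sq_dist d y" and ?p = "shift_inner d y" and ?V = "hardy_field d lam y"
  define R' where "R' = sqrt R + (\<Sum>j<d. \<bar>y j\<bar>)"
  have n: "n > 0" using d by (simp add: n_def)
  have supp: "Q (?s x) = 0" "Q' (?s x) = 0" if "j < d" "R' < \<bar>x j\<bar>" for x j
    using sq_dist_gt_of_coordinate[of j d R y x] that R unfolding R'_def by auto
  have "continuous_on {0..} Q"
    using Q by (intro DERIV_continuous_on[where D = Q']) (auto intro: has_field_derivative_at_within)
  then have cQ: "continuous_on A (\<lambda>x. Q (?s x))" for A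
    by (rule continuous_on_compose2[OF _ continuous_on_sq_dist]) auto
  have cQ': "continuous_on A (\<lambda>x. Q' (?s x))" for A
    by (rule continuous_on_compose2[OF Q' continuous_on_sq_dist]) auto
  have cV: "continuous_on A (?V i)" for A i
    unfolding hardy_field_def by (intro continuous_intros continuous_on_coordinate)
  define G where "G = (\<lambda>i x. 2 * h x * Dh i x * Q (?s x) * ?V i x
      + (h x)\<^sup>2 * (2 * Q' (?s x) * ((x i - y i) * ?V i x)
        + Q (?s x) * (1 + 2 * lam / n * (?p x - y i * (x i - y i)))))"
  define F where "F = (\<lambda>i x. (h x)\<^sup>2 * Q (?s x) * ?V i x)"
  have Qd: "has_partial (\<lambda>x. Q (?s x)) (Q' (?s x) * (2 * (x i - y i))) i x" if "i < d" for i x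
    using DERIV_chain2[OF Q has_partial_sq_dist[OF that]] by simp
  have FG: "has_partial (F i) (G i x) i x" if "i < d" "x \<in> Rd d" for i x
    unfolding F_def G_def
    by (auto intro!: derivative_eq_intros hD that Qd has_partial_hardy_field
        simp: n_def power2_eq_square algebra_simps)
  have cF: "continuous_on (Rd d) (F i)" and cG: "continuous_on (Rd d) (G i)" if "i < d" for i
    unfolding F_def G_def
    by (intro continuous_intros h Dh that cQ cQ' cV continuous_on_coordinate)+
  have FG0: "F i x = 0 \<and> G i x = 0" if "j < d" "R' < \<bar>x j\<bar>" for i j x
    using supp[of j x] that by (simp add: F_def G_def)
  have "integrable (gauss d lam) (\<lambda>x. G i x - 2 * lam * x i * F i x)
      \<and> (LINT x|gauss d lam. G i x - 2 * lam * x i * F i x) = 0" if i: "i < d" for i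
    by (intro conjI integral_gauss_divergence[where R = R'] lam i cF cG FG) (use FG0 in blast)+
  then have int: "integrable (gauss d lam) (\<lambda>x. G i x - 2 * lam * x i * F i x)"
    and zero: "(LINT x|gauss d lam. G i x - 2 * lam * x i * F i x) = 0" if "i < d" for i
    using that by blast+
  have total: "(LINT x|gauss d lam. (\<Sum>i<d. G i x - 2 * lam * x i * F i x)) = 0"
    using int zero by (subst Bochner_Integration.integral_sum) auto
  show intL: "integrable (gauss d lam) ?L" and intR: "integrable (gauss d lam) ?R"
    by (rule integrable_gauss_compact_support[OF lam, where R = R'];
        use supp e n in \<open>auto intro!: continuous_intros h Dh cQ cQ'\<close>)+
  have "integral\<^sup>L (gauss d lam) ?L - integral\<^sup>L (gauss d lam) ?R = (LINT x|gauss d lam. ?L x - ?R x)"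
    using intL intR by simp
  also have "\<dots> \<le> (LINT x|gauss d lam. (\<Sum>i<d. G i x - 2 * lam * x i * F i x))"
  proof (rule integral_mono)
    show "integrable (gauss d lam) (\<lambda>x. ?L x - ?R x)" using intL intR by simp
    show "integrable (gauss d lam) (\<lambda>x. \<Sum>i<d. G i x - 2 * lam * x i * F i x)" using int by auto
  next
    fix x
    define S where "S = 1 + (2 * lam / n)\<^sup>2 * (?s x * (\<Sum>j<d. (y j)\<^sup>2) - (?p x)\<^sup>2)"
    have S: "S \<ge> 1" using shift_inner_Cauchy_Schwarz[of d y x] by (simp add: S_def)
    note sums = hardy_field_sums[OF d, where x = x and y = y and lam = lam, folded n_def, folded S_def]
    have q: "Q (?s x) \<ge> 0" by (rule Qpos) simp
    have eq: "(\<Sum>i<d. G i x - 2 * lam * x i * F i x)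
        = Q (?s x) * (\<Sum>i<d. 2 * h x * Dh i x * ?V i x) + (h x)\<^sup>2 * (2 * Q' (?s x) * ?s x
          + Q (?s x) * (n * S - 2 * lam * ?s x + 1))"
    proof -
      have "(\<Sum>i<d. G i x - 2 * lam * x i * F i x)
          = (\<Sum>i<d. Q (?s x) * (2 * h x * Dh i x * ?V i x) + ((h x)\<^sup>2 * (2 * Q' (?s x))) * ((x i - y i) * ?V i x)
            + ((h x)\<^sup>2 * Q (?s x)) * (1 + 2 * lam / n * (?p x - y i * (x i - y i)) - 2 * lam * x i * ?V i x))"
        by (intro sum.cong refl) (simp add: G_def F_def algebra_simps)
      also have "\<dots> = Q (?s x) * (\<Sum>i<d. 2 * h x * Dh i x * ?V i x) + ((h x)\<^sup>2 * (2 * Q' (?s x))) * ?s x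
          + ((h x)\<^sup>2 * Q (?s x)) * (n * S - 2 * lam * ?s x + 1)"
        by (simp only: sum.distrib sum_distrib_left[symmetric] sums)
      finally show ?thesis by (simp add: algebra_simps)
    qed
    have young: "- (e * n * S * (h x)\<^sup>2 + ?s x / (e * n) * (\<Sum>i<d. (Dh i x)\<^sup>2)) \<le> (\<Sum>i<d. 2 * h x * Dh i x * ?V i x)"
    proof (cases "?s x = 0")
      case True
      then have "\<And>i. i < d \<Longrightarrow> ?V i x = 0"
        using sums(2) by (simp add: sum_nonneg_eq_0_iff)
      then show ?thesis using True S e n by simp
    next
      case False
      then have s: "?s x > 0" using sq_dist_nonneg[of d y x] by linarith
      \<comment> \<open>With this Young parameter |V|^2 = s S contributes exactly e n S. It
        degenerates at s = 0, where V vanishes; hence the separate case.\<close>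
      let ?c = "e * n / ?s x"
      have c: "?c > 0" using s e n by simp
      have sq: "c * (u + v / c)\<^sup>2 = c * u\<^sup>2 + 2 * u * v + v\<^sup>2 / c" if "c \<noteq> 0" for c u v :: real
        using that by (simp add: field_simps power2_eq_square)
      have "- (?c * ((h x)\<^sup>2 * (?V i x)\<^sup>2) + ?s x / (e * n) * (Dh i x)\<^sup>2) \<le> 2 * h x * Dh i x * ?V i x" for i
      proof -
        have "0 \<le> ?c * (h x * ?V i x + Dh i x / ?c)\<^sup>2"
          by (intro mult_nonneg_nonneg less_imp_le[OF c] zero_le_power2)
        also have "\<dots> = ?c * ((h x)\<^sup>2 * (?V i x)\<^sup>2) + 2 * h x * Dh i x * ?V i x + (Dh i x)\<^sup>2 / ?c"
          using sq[of ?c "h x * ?V i x" "Dh i x"] less_imp_neq[OF c]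
          by (simp only: power_mult_distrib mult_ac)
        finally have "0 \<le> ?c * ((h x)\<^sup>2 * (?V i x)\<^sup>2) + 2 * h x * Dh i x * ?V i x + (Dh i x)\<^sup>2 / ?c" .
        moreover have "(Dh i x)\<^sup>2 / ?c = ?s x / (e * n) * (Dh i x)\<^sup>2" by simp
        ultimately show ?thesis by linarith
      qed
      then have "(\<Sum>i<d. - (?c * ((h x)\<^sup>2 * (?V i x)\<^sup>2) + ?s x / (e * n) * (Dh i x)\<^sup>2)) \<le> (\<Sum>i<d. 2 * h x * Dh i x * ?V i x)"
        by (intro sum_mono)
      also have "(\<Sum>i<d. - (?c * ((h x)\<^sup>2 * (?V i x)\<^sup>2) + ?s x / (e * n) * (Dh i x)\<^sup>2))
          = - (?c * ((h x)\<^sup>2 * (?s x * S)) + ?s x / (e * n) * (\<Sum>i<d. (Dh i x)\<^sup>2))"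
        by (simp only: sum_negf sum.distrib sum_distrib_left[symmetric] sums)
      also have "?c * ((h x)\<^sup>2 * (?s x * S)) = e * n * S * (h x)\<^sup>2"
        using s by simp
      finally show ?thesis .
    qed
    have "?L x - ?R x \<le> (h x)\<^sup>2 * (Q (?s x) * ((1 - e) * n * S - 2 * lam * ?s x + 1) + 2 * ?s x * Q' (?s x)) - ?R x"

    proof -
      have "(1 - e) * n * 1 \<le> (1 - e) * n * S"
        using S n e by (intro mult_left_mono) auto
      then show ?thesis
        using q by (intro diff_right_mono mult_left_mono add_right_mono) auto
    qed
    then show "?L x - ?R x \<le> (\<Sum>i<d. G i x - 2 * lam * x i * F i x)"
      using mult_left_mono[OF young q] unfolding eq by (simp add: algebra_simps)
  qed
  finally show "integral\<^sup>L (gauss d lam) ?L \<le> integral\<^sup>L (gauss d lam) ?R" using total by simp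
qed

section \<open>Cutoffs and the Hardy inequality outside the ball\<close>

text \<open>At 0 the difference quotient is that of f on one side and zero on the other, so it tends
  to 0 along with the quotient of f. All cutoffs below are built in this way, because the integral
  inequalities require continuous derivatives.\<close>

lemma has_real_derivative_max_0:
  fixes f f' :: "real \<Rightarrow> real"
  assumes f: "\<And>x. 0 \<le> x \<Longrightarrow> (f has_real_derivative f' x) (at x)" and f'0: "f' 0 = 0"
  shows "((\<lambda>x. f (max x 0)) has_real_derivative f' (max x 0)) (at x)"
proof -
  consider "x > 0" | "x < 0" | "x = 0" by linarith
  then show ?thesis
  proof cases
    case 1
    have "((\<lambda>x. f (max x 0)) has_real_derivative f' x) (at x)"
      by (rule has_field_derivative_transform_within_open[OF f, where S = "{0<..}"]) (use 1 in auto)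
    then show ?thesis using 1 by simp
  next
    case 2
    have "((\<lambda>x. f (max x 0)) has_real_derivative 0) (at x)"
      by (rule has_field_derivative_transform_within_open[OF DERIV_const, where S = "{..<0}"]) (use 2 in auto)
    then show ?thesis using 2 f'0 by simp
  next
    case 3
    have "((\<lambda>y. (f y - f 0) / (y - 0)) \<longlongrightarrow> 0) (at 0)"
      using f[of 0] f'0 by (simp add: has_field_derivative_iff)
    then have "((\<lambda>y. \<bar>(f y - f 0) / (y - 0)\<bar>) \<longlongrightarrow> 0) (at 0)"
      by (rule tendsto_rabs_zero)
    then have "((\<lambda>y. (f (max y 0) - f 0) / (y - 0)) \<longlongrightarrow> 0) (at 0)"
    proof (rule Lim_null_comparison[rotated])
      show "\<forall>\<^sub>F y in at 0. norm ((f (max y 0) - f 0) / (y - 0)) \<le> \<bar>(f y - f 0) / (y - 0)\<bar>"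
        by (intro always_eventually allI) (auto simp: max_def divide_le_0_iff)
    qed
    then show ?thesis using 3 f'0 by (simp add: has_field_derivative_iff)
  qed
qed

text \<open>A C^1 approximation of the indicator of u > 0; the square makes the derivative vanish at
  0. It is nondecreasing, and in this form the flux through the sphere has its favourable
  sign.\<close>

definition inner_cutoff :: "real \<Rightarrow> real \<Rightarrow> real" where
  "inner_cutoff \<epsilon> u = (max u 0 / (max u 0 + \<epsilon>))\<^sup>2"

definition inner_cutoff' :: "real \<Rightarrow> real \<Rightarrow> real" where
  "inner_cutoff' \<epsilon> u = 2 * \<epsilon> * max u 0 / (max u 0 + \<epsilon>) ^ 3"

lemma has_derivative_inner_cutoff:
  assumes "\<epsilon> > 0"
  shows "(inner_cutoff \<epsilon> has_real_derivative inner_cutoff' \<epsilon> u) (at u)"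
  unfolding inner_cutoff_def inner_cutoff'_def
proof (rule has_real_derivative_max_0[where f = "\<lambda>m. (m / (m + \<epsilon>))\<^sup>2" and f' = "\<lambda>m. 2 * \<epsilon> * m / (m + \<epsilon>) ^ 3"])
  fix m :: real assume "0 \<le> m"
  then have m: "m + \<epsilon> \<noteq> 0" using assms by simp
  have "((\<lambda>m. m / (m + \<epsilon>)) has_real_derivative (1 * (m + \<epsilon>) - m * (1 + 0)) / ((m + \<epsilon>) * (m + \<epsilon>))) (at m)"
    by (intro DERIV_divide DERIV_ident DERIV_add DERIV_const m)
  then have "((\<lambda>m. m / (m + \<epsilon>)) has_real_derivative \<epsilon> / (m + \<epsilon>)\<^sup>2) (at m)"
    by (simp add: power2_eq_square)
  from DERIV_power[OF this, of 2]
  have "((\<lambda>m. (m / (m + \<epsilon>))\<^sup>2) has_real_derivative 2 * (m / (m + \<epsilon>)) * (\<epsilon> / (m + \<epsilon>)\<^sup>2)) (at m)"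
    by (simp add: mult_ac)
  moreover have "2 * (m / (m + \<epsilon>)) * (\<epsilon> / (m + \<epsilon>)\<^sup>2) = 2 * \<epsilon> * m / (m + \<epsilon>) ^ 3"
    by (simp add: power2_eq_square power3_eq_cube mult_ac)
  ultimately show "((\<lambda>m. (m / (m + \<epsilon>))\<^sup>2) has_real_derivative 2 * \<epsilon> * m / (m + \<epsilon>) ^ 3) (at m)" by simp
qed simp

lemma continuous_on_inner_cutoff':
  "\<epsilon> > 0 \<Longrightarrow> continuous_on A (inner_cutoff' \<epsilon>)"
  unfolding inner_cutoff'_def by (intro continuous_intros) (simp add: max_def)

lemma inner_cutoff_bounds:
  assumes "\<epsilon> > 0"
  shows "0 \<le> inner_cutoff \<epsilon> u" "inner_cutoff \<epsilon> u \<le> 1" "0 \<le> inner_cutoff' \<epsilon> u"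
    "u \<le> 0 \<Longrightarrow> inner_cutoff \<epsilon> u = 0"
  using assms by (auto simp: inner_cutoff_def inner_cutoff'_def max_def power_le_one)

text \<open>Truncation to s \<le> 1 / \<epsilon>. The product of s with the derivative stays bounded
  uniformly in \<epsilon> and tends to 0 for fixed s, as dominated convergence requires.\<close>

definition outer_cutoff :: "real \<Rightarrow> real \<Rightarrow> real" where
  "outer_cutoff \<epsilon> s = (max (1 - \<epsilon> * s) 0)\<^sup>2"

definition outer_cutoff' :: "real \<Rightarrow> real \<Rightarrow> real" where
  "outer_cutoff' \<epsilon> s = - 2 * \<epsilon> * max (1 - \<epsilon> * s) 0"

lemma has_derivative_outer_cutoff:
  "(outer_cutoff \<epsilon> has_real_derivative outer_cutoff' \<epsilon> s) (at s)"
proof -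
  have sq: "((\<lambda>u. (max u 0)\<^sup>2) has_real_derivative 2 * max u 0) (at u)" for u :: real
    by (rule has_real_derivative_max_0[where f = "\<lambda>m. m\<^sup>2" and f' = "\<lambda>m. 2 * m"])
       (auto intro!: derivative_eq_intros)
  have "((\<lambda>s. 1 - \<epsilon> * s) has_real_derivative - \<epsilon>) (at s)"
    by (auto intro!: derivative_eq_intros)
  from DERIV_chain2[OF sq this] show ?thesis
    unfolding outer_cutoff_def outer_cutoff'_def by (simp add: mult_ac)
qed

lemma continuous_on_outer_cutoff': "continuous_on A (outer_cutoff' \<epsilon>)"
  unfolding outer_cutoff'_def by (intro continuous_intros)

lemma outer_cutoff_bounds:
  assumes "\<epsilon> > 0" "0 \<le> s"
  shows "0 \<le> outer_cutoff \<epsilon> s" "outer_cutoff \<epsilon> s \<le> 1" "outer_cutoff' \<epsilon> s \<le> 0" "\<bar>s * outer_cutoff' \<epsilon> s\<bar> \<le> 2"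
    "s > 1 / \<epsilon> \<Longrightarrow> outer_cutoff \<epsilon> s = 0 \<and> outer_cutoff' \<epsilon> s = 0"
proof -
  show "0 \<le> outer_cutoff \<epsilon> s" by (simp add: outer_cutoff_def)
  show "outer_cutoff \<epsilon> s \<le> 1" using assms by (auto simp: outer_cutoff_def power_le_one)
  show "outer_cutoff' \<epsilon> s \<le> 0" using assms by (simp add: outer_cutoff'_def)
  show "\<bar>s * outer_cutoff' \<epsilon> s\<bar> \<le> 2"
  proof (cases "\<epsilon> * s \<le> 1")
    case True
    have "\<bar>s * outer_cutoff' \<epsilon> s\<bar> = 2 * ((\<epsilon> * s) * (1 - \<epsilon> * s))"
      using True assms by (simp add: outer_cutoff'_def abs_mult mult_ac)
    also have "\<dots> \<le> 2 * (1 * 1)"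
      using True assms by (intro mult_left_mono mult_mono) auto
    finally show ?thesis by simp
  qed (simp add: outer_cutoff'_def)
  show "s > 1 / \<epsilon> \<Longrightarrow> outer_cutoff \<epsilon> s = 0 \<and> outer_cutoff' \<epsilon> s = 0"
    using assms by (auto simp: outer_cutoff_def outer_cutoff'_def field_simps)
qed

text \<open>The coefficients were found numerically, so as to keep the combined coefficients of \<open>h\<^sup>2\<close> above \<open>1/1000\<close>; the margin
  is small.\<close>

definition weight :: "real \<Rightarrow> real" where
  "weight t = (45 / (1 + t) - 26 / (1 + t)\<^sup>2 - 18 / (1 + t) ^ 3) / 100"

definition weight' :: "real \<Rightarrow> real" where
  "weight' t = - (45 / (1 + t)\<^sup>2 - 52 / (1 + t) ^ 3 - 54 / (1 + t) ^ 4) / 100"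

lemma has_derivative_inverse_power:
  fixes t :: real
  assumes "t > - 1"
  shows "((\<lambda>t. c / (1 + t) ^ k) has_real_derivative - real k * c / (1 + t) ^ Suc k) (at t)"
proof -
  have "((\<lambda>t. c / (1 + t) ^ k) has_real_derivative
      (0 * (1 + t) ^ k - c * (real k * (1 + t) ^ (k - 1) * (0 + 1))) / ((1 + t) ^ k * (1 + t) ^ k)) (at t)"
    using assms by (intro derivative_eq_intros refl) auto
  moreover have "(0 * (1 + t) ^ k - c * (real k * (1 + t) ^ (k - 1) * (0 + 1))) / ((1 + t) ^ k * (1 + t) ^ k)
      = - real k * c / (1 + t) ^ Suc k"
  proof (cases k)
    case (Suc m)
    define x where "x = 1 + t"
    have "x \<noteq> 0" using assms by (simp add: x_def)
    then show ?thesis unfolding x_def[symmetric] Suc by (simp add: divide_simps) (simp add: algebra_simps)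
  qed simp
  ultimately show ?thesis by simp
qed

lemma has_derivative_weight:
  assumes "t > - 1"
  shows "(weight has_real_derivative weight' t) (at t)"
proof -
  have "((\<lambda>t. (45 / (1 + t) ^ 1 - 26 / (1 + t) ^ 2 - 18 / (1 + t) ^ 3) / 100) has_real_derivative
      (- real 1 * 45 / (1 + t) ^ Suc 1 - - real 2 * 26 / (1 + t) ^ Suc 2 - - real 3 * 18 / (1 + t) ^ Suc 3) / 100) (at t)"
    by (intro DERIV_cdivide DERIV_diff has_derivative_inverse_power assms)
  moreover have "(\<lambda>t. (45 / (1 + t) ^ 1 - 26 / (1 + t) ^ 2 - 18 / (1 + t) ^ 3) / 100) = weight"
    by (simp add: weight_def fun_eq_iff)
  moreover have "(- real 1 * 45 / (1 + t) ^ Suc 1 - - real 2 * 26 / (1 + t) ^ Suc 2 - - real 3 * 18 / (1 + t) ^ Suc 3) / 100 = weight' t"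
    unfolding weight'_def by (simp only: numeral_2_eq_2 numeral_3_eq_3 eval_nat_numeral BitM.simps) simp
  ultimately show ?thesis by (simp only:)
qed

lemma continuous_on_weight': "continuous_on {0..} weight'"
  unfolding weight'_def by (intro continuous_intros) auto

context
  fixes t v :: real
  assumes t: "t \<ge> 0" and v: "v = 1 / (1 + t)"
begin

text \<open>The substitution takes t \<ge> 0 to (0, 1]. As \<open>weight\<close> and
  \<open>weight'\<close> are polynomials in v divisible by v, the identity t v = 1 - v makes their
  products with t polynomial as well.\<close>

lemma unit_variable: "0 < v" "v \<le> 1" "t * v = 1 - v"
  using t by (auto simp: v field_simps)

lemma weight_unit: "weight t = (45 * v - 26 * v\<^sup>2 - 18 * v ^ 3) / 100"
  by (simp add: weight_def v power_divide)

lemma t_weight_unit: "t * weight t = (1 - v) * (45 - 26 * v - 18 * v\<^sup>2) / 100"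
proof -
  have "t * weight t = (t * v) * (45 - 26 * v - 18 * v\<^sup>2) / 100"
    unfolding weight_unit by (simp add: power2_eq_square power3_eq_cube algebra_simps)
  then show ?thesis by (simp only: unit_variable)
qed

lemma t_weight'_unit: "t * weight' t = - (1 - v) * (45 * v - 52 * v\<^sup>2 - 54 * v ^ 3) / 100"
proof -
  have "weight' t = - v * (45 * v - 52 * v\<^sup>2 - 54 * v ^ 3) / 100"
    by (simp add: weight'_def v power_divide eval_nat_numeral algebra_simps)
  then have "t * weight' t = - (t * v) * (45 * v - 52 * v\<^sup>2 - 54 * v ^ 3) / 100" by simp
  then show ?thesis by (simp only: unit_variable)
qed

end

text \<open>Nonnegativity comes from 45 > 26 + 18 and from v^2 and v^3 being at most v. The bound on
  t \<open>weight t\<close> determines the gradient coefficient of the Hardy inequality; the other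
  upper bounds provide integrability and domination.\<close>

lemma weight_bounds:
  assumes "t \<ge> 0"
  shows "0 \<le> weight t" "weight t \<le> 1" "0 \<le> t * weight t" "t * weight t \<le> 1" "\<bar>t * weight' t\<bar> \<le> 2"
proof -
  define v where "v = 1 / (1 + t)"
  note eqs = weight_unit[OF assms v_def] t_weight_unit[OF assms v_def] t_weight'_unit[OF assms v_def]
  have v: "0 < v" "v \<le> 1" using unit_variable[OF assms v_def] by auto
  have v2: "0 \<le> v\<^sup>2" "v\<^sup>2 \<le> v" using v by (auto simp: power2_eq_square mult_left_le)
  have v3: "0 \<le> v ^ 3" "v ^ 3 \<le> v" using v v2 mult_mono[of v 1 "v\<^sup>2" v]
    by (auto simp: power3_eq_cube power2_eq_square mult_ac)
  have "0 \<le> 45 * v - 26 * v\<^sup>2 - 18 * v ^ 3" "45 * v - 26 * v\<^sup>2 - 18 * v ^ 3 \<le> 45"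
    using v v2 v3 by linarith+
  then show "0 \<le> weight t" "weight t \<le> 1" unfolding eqs by auto
  have w: "0 \<le> 45 - 26 * v - 18 * v\<^sup>2" "45 - 26 * v - 18 * v\<^sup>2 \<le> 45" using v v2 by linarith+
  have "0 \<le> (1 - v) * (45 - 26 * v - 18 * v\<^sup>2)" using v w by (intro mult_nonneg_nonneg) auto
  moreover have "(1 - v) * (45 - 26 * v - 18 * v\<^sup>2) \<le> 1 * 45" using v w by (intro mult_mono) auto
  ultimately show "0 \<le> t * weight t" "t * weight t \<le> 1" unfolding eqs(2) by auto
  have "\<bar>45 * v - 52 * v\<^sup>2 - 54 * v ^ 3\<bar> \<le> 200" using v v2 v3 by linarith
  then have "\<bar>(1 - v) * (45 * v - 52 * v\<^sup>2 - 54 * v ^ 3)\<bar> \<le> 1 * 200"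
    unfolding abs_mult using v by (intro mult_mono) auto
  then show "\<bar>t * weight' t\<bar> \<le> 2" unfolding eqs(3) by linarith
qed

lemma integrable_mult_bounded:
  fixes f g :: "'a \<Rightarrow> real"
  assumes "integrable M f" "g \<in> borel_measurable M" "\<And>x. x \<in> space M \<Longrightarrow> \<bar>g x\<bar> \<le> B"
  shows "integrable M (\<lambda>x. g x * f x)"
proof (rule Bochner_Integration.integrable_bound)
  show "integrable M (\<lambda>x. B * f x)" using assms(1) by simp
  show "(\<lambda>x. g x * f x) \<in> borel_measurable M" using assms(1,2) by measurable
  show "AE x in M. norm (g x * f x) \<le> norm (B * f x)"
  proof (rule AE_I2)
    fix x assume "x \<in> space M"
    then have "\<bar>g x\<bar> \<le> \<bar>B\<bar>" using assms(3) by fastforce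
    then show "norm (g x * f x) \<le> norm (B * f x)" by (simp add: abs_mult mult_right_mono)
  qed
qed

section \<open>Removing the cutoffs: the Hardy inequality on the complement of the ball\<close>

definition scaled_sq_dist :: "nat \<Rightarrow> real \<Rightarrow> (nat \<Rightarrow> real) \<Rightarrow> (nat \<Rightarrow> real) \<Rightarrow> real" where
  "scaled_sq_dist d lam y x = lam * sq_dist d y x / (real d - 1)"

definition ball_complement :: "nat \<Rightarrow> (nat \<Rightarrow> real) \<Rightarrow> real \<Rightarrow> (nat \<Rightarrow> real) set" where
  "ball_complement d y r = {x. r\<^sup>2 < sq_dist d y x}"

lemma measurable_ball_complement [measurable]:
  "(indicator (ball_complement d y r) :: _ \<Rightarrow> real) \<in> borel_measurable (gauss d lam)"
proof -
  have [measurable]: "sq_dist d y \<in> borel_measurable (gauss d lam)"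
    by (intro borel_measurable_gauss_continuous continuous_on_sq_dist)
  have "(\<lambda>x. if r\<^sup>2 < sq_dist d y x then 1 else 0 :: real) \<in> borel_measurable (gauss d lam)" by measurable
  then show ?thesis by (simp add: indicator_def ball_complement_def of_bool_def)
qed

text \<open>The coefficient of h^2 in \<open>weighted_hardy\<close> for Q s =
  \<open>weight (lam * s / n)\<close>, divided by n and written in t = lam s / n.\<close>

definition potential :: "real \<Rightarrow> real \<Rightarrow> real \<Rightarrow> real" where
  "potential n e t = weight t * (1 - e - 2 * t + 1 / n) + 2 * t * weight' t / n"

lemma potential_bound:
  assumes "t \<ge> 0" "n \<ge> 1" "0 < e" "e \<le> 1"
  shows "\<bar>potential n e t\<bar> \<le> 10"
proof -
  note w = weight_bounds[OF assms(1)]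
  have n: "0 \<le> 1 / n" "1 / n \<le> 1" using assms(2) by auto
  have "\<bar>weight t * (1 - e + 1 / n)\<bar> \<le> 1 * 2"
    unfolding abs_mult
  proof (rule mult_mono)
    show "\<bar>1 - e + 1 / n\<bar> \<le> 2" using n assms by linarith
  qed (use w in auto)
  moreover have "\<bar>(t * weight' t) * (1 / n)\<bar> \<le> 2 * 1"
    unfolding abs_mult[of "t * weight' t"] using w n by (intro mult_mono) auto
  moreover have "potential n e t = weight t * (1 - e + 1 / n) - 2 * (t * weight t) + 2 * ((t * weight' t) * (1 / n))"
    by (simp add: potential_def algebra_simps)
  ultimately show ?thesis using w by linarith
qed

text \<open>A, B, w stand for the inner cutoff, the outer cutoff and the weight. The derivative of
  the inner cutoff is isolated in the last summand, which is nonnegative and will be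
  dropped.\<close>

lemma hardy_coefficients:
  fixes n :: real
  assumes "n \<noteq> 0"
  shows "hh * (A * B * w * ((1 - e) * n - 2 * lam * s + 1)
        + 2 * s * (A' * (B * w) + A * (B' * w + B * (w' * (lam / n)))))
      = n * (A * (B * (w * (1 - e - 2 * (lam * s / n) + 1 / n) + 2 * (lam * s / n) * w' / n) + 2 * (s * B') * w / n) * hh)
        + hh * (2 * s * (A' * (B * w)))"
proof -
  define m where "m = 1 / n"
  have m: "n * m = 1" "lam * s / n = lam * s * m" "lam / n = lam * m" "1 / n = m"
    "2 * (lam * s * m) * w' / n = 2 * (lam * s * m) * w' * m" "2 * (s * B') * w / n = 2 * (s * B') * w * m"
    using assms by (simp_all add: m_def)
  have "n * (A * (B * (w * (1 - e - 2 * (lam * s * m) + m) + 2 * (lam * s * m) * w' * m) + 2 * (s * B') * w * m) * hh)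
      = hh * (A * (B * (w * ((1 - e) * n - 2 * lam * s * (n * m) + n * m) + 2 * (lam * s * m) * w' * (n * m)) + 2 * (s * B') * w * (n * m)))"
    by (simp add: algebra_simps)
  then show ?thesis unfolding m(1) m(2-6) by (simp add: algebra_simps)
qed

lemma hardy_gradient_coefficient:
  fixes n e lam :: real
  assumes "n \<noteq> 0" "e \<noteq> 0" "lam \<noteq> 0"
  shows "A * B * w * s / (e * n) * g = A * B * (lam * s / n * w) * (1 / (e * lam) * g)"
  using assms by (simp add: mult_ac)

text \<open>\<open>weighted_hardy\<close> is applied to the product of both cutoffs and the weight,
  and the cutoffs are removed together as \<epsilon> tends to 0. The limit uses square integrability
  of h only off the ball, because the inner cutoff vanishes inside.\<close>

lemma hardy_ball_complement:
  fixes d :: nat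
  defines "n \<equiv> real d - 1"
  assumes lam: "lam > 0" and d: "d \<ge> 2" and e: "0 < e" "e \<le> 1"
    and h: "continuous_on (Rd d) h" and Dh: "\<And>i. i < d \<Longrightarrow> continuous_on (Rd d) (Dh i)"
    and hD: "\<And>i x. i < d \<Longrightarrow> x \<in> Rd d \<Longrightarrow> has_partial h (Dh i x) i x"
    and h2: "integrable (gauss d lam) (\<lambda>x. indicator (ball_complement d y r) x * (h x)\<^sup>2)"
    and Dh2: "integrable (gauss d lam) (\<lambda>x. indicator (ball_complement d y r) x * (\<Sum>i<d. (Dh i x)\<^sup>2))"
  shows "(LINT x|gauss d lam. potential n e (scaled_sq_dist d lam y x) * (indicator (ball_complement d y r) x * (h x)\<^sup>2))
      \<le> 1 / (e * lam) * (LINT x|gauss d lam. indicator (ball_complement d y r) x * (\<Sum>i<d. (Dh i x)\<^sup>2))"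
    (is "?lhs \<le> ?rhs")
proof -
  let ?M = "gauss d lam" and ?s = "sq_dist d y" and ?D = "ball_complement d y r"
  let ?t = "\<lambda>s. lam * s / n" and ?W = "\<lambda>s. potential n e (lam * s / n)"
  have n: "n \<ge> 1" using d by (simp add: n_def)
  have t0: "?t s \<ge> 0" if "s \<ge> 0" for s using that lam n by simp
  define A where "A = (\<lambda>\<epsilon> s. inner_cutoff \<epsilon> (s - r\<^sup>2))"
  define A' where "A' = (\<lambda>\<epsilon> s. inner_cutoff' \<epsilon> (s - r\<^sup>2))"
  define Q where "Q = (\<lambda>\<epsilon> s. A \<epsilon> s * outer_cutoff \<epsilon> s * weight (?t s))"
  define Q' where "Q' = (\<lambda>\<epsilon> s. A' \<epsilon> s * (outer_cutoff \<epsilon> s * weight (?t s))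
      + A \<epsilon> s * (outer_cutoff' \<epsilon> s * weight (?t s) + outer_cutoff \<epsilon> s * (weight' (?t s) * (lam / n))))"
  \<comment> \<open>The coefficient of h^2 divided by n, without the derivative of the inner cutoff:
    that derivative is not bounded uniformly in \<epsilon>, but its contribution has the right
    sign.\<close>
  define T where "T = (\<lambda>\<epsilon> s. A \<epsilon> s * (outer_cutoff \<epsilon> s * ?W s + 2 * (s * outer_cutoff' \<epsilon> s) * weight (?t s) / n))"
  have Td: "\<bar>T \<epsilon> (?s x)\<bar> \<le> 14" "T \<epsilon> (?s x) = T \<epsilon> (?s x) * indicator ?D x" if eps: "\<epsilon> > 0" for \<epsilon> x
  proof -
    have s: "?s x \<ge> 0" by simp
    note b = inner_cutoff_bounds[OF eps, of "?s x - r\<^sup>2"] outer_cutoff_bounds[OF eps s]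
    note w = weight_bounds[OF t0[OF s]]
    have "\<bar>outer_cutoff \<epsilon> (?s x) * ?W (?s x)\<bar> \<le> 1 * 10"
      unfolding abs_mult using b potential_bound[OF t0[OF s] n e] by (intro mult_mono) auto
    moreover have "\<bar>2 * (?s x * outer_cutoff' \<epsilon> (?s x)) * (weight (?t (?s x)) / n)\<bar> \<le> 4 * 1"
    proof (subst abs_mult, rule mult_mono)
      have "weight (?t (?s x)) / n \<le> 1 / 1" using w n by (intro frac_le) auto
      then show "\<bar>weight (?t (?s x)) / n\<bar> \<le> 1" using w n by simp
    qed (use b in auto)
    moreover have "2 * (?s x * outer_cutoff' \<epsilon> (?s x)) * (weight (?t (?s x)) / n)
        = 2 * (?s x * outer_cutoff' \<epsilon> (?s x)) * weight (?t (?s x)) / n" by simp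
    ultimately have "\<bar>outer_cutoff \<epsilon> (?s x) * ?W (?s x) + 2 * (?s x * outer_cutoff' \<epsilon> (?s x)) * weight (?t (?s x)) / n\<bar> \<le> 14"
      by linarith
    then have "\<bar>T \<epsilon> (?s x)\<bar> \<le> 1 * 14"
      unfolding T_def A_def abs_mult using b by (intro mult_mono) auto
    then show "\<bar>T \<epsilon> (?s x)\<bar> \<le> 14" by simp
    show "T \<epsilon> (?s x) = T \<epsilon> (?s x) * indicator ?D x"
      using b(4) by (cases "x \<in> ?D") (auto simp: T_def A_def ball_complement_def)
  qed
  have cA: "continuous_on X (A \<epsilon>)" and cA': "continuous_on X (A' \<epsilon>)" if "\<epsilon> > 0" for \<epsilon> X
  proof -
    have "continuous_on UNIV (inner_cutoff \<epsilon>)"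
      by (rule DERIV_continuous_on[OF has_field_derivative_at_within[OF has_derivative_inner_cutoff[OF that]]])
    then show "continuous_on X (A \<epsilon>)"
      unfolding A_def by (rule continuous_on_compose2) (auto intro!: continuous_intros)
    show "continuous_on X (A' \<epsilon>)"
      unfolding A'_def by (rule continuous_on_compose2[OF continuous_on_inner_cutoff'[OF that, of UNIV]])
        (auto intro!: continuous_intros)
  qed
  have cB: "continuous_on X (outer_cutoff \<epsilon>)" for \<epsilon> X
    unfolding outer_cutoff_def by (intro continuous_intros)
  have ct: "continuous_on {0..} ?t"
    using n by (intro continuous_on_divide continuous_on_mult continuous_on_const continuous_on_id) simp
  have t_image: "?t ` {0..} \<subseteq> {0..}"
    by (rule image_subsetI) (simp only: atLeast_iff t0)
  have cweight: "continuous_on {0..} weight"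
    by (rule DERIV_continuous_on[OF has_field_derivative_at_within[OF has_derivative_weight]]) simp
  have cw: "continuous_on {0..} (\<lambda>s. weight (?t s))"
    by (rule continuous_on_compose2[OF cweight ct t_image])
  have cw': "continuous_on {0..} (\<lambda>s. weight' (?t s))"
    by (rule continuous_on_compose2[OF continuous_on_weight' ct t_image])
  have cW: "continuous_on {0..} ?W"
    unfolding potential_def using n
    by (intro continuous_on_add continuous_on_mult continuous_on_diff continuous_on_divide continuous_on_const
        continuous_on_id cw cw') simp_all
  have cT: "continuous_on {0..} (T \<epsilon>)" if "\<epsilon> > 0" for \<epsilon>
    unfolding T_def using n
    by (intro continuous_intros cA that cB cW cw continuous_on_outer_cutoff') auto
  have meas: "(\<lambda>x. u (?s x)) \<in> borel_measurable ?M" if "continuous_on {0..} u" for u :: "real \<Rightarrow> real"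
    by (intro borel_measurable_gauss_continuous continuous_on_compose2[OF that continuous_on_sq_dist]) auto
  have step: "(LINT x|?M. T \<epsilon> (?s x) * (indicator ?D x * (h x)\<^sup>2)) \<le> ?rhs" if eps: "\<epsilon> > 0" for \<epsilon>
  proof -
    let ?L = "\<lambda>x. (h x)\<^sup>2 * (Q \<epsilon> (?s x) * ((1 - e) * n - 2 * lam * ?s x + 1) + 2 * ?s x * Q' \<epsilon> (?s x))"
    let ?R = "\<lambda>x. Q \<epsilon> (?s x) * ?s x / (e * n) * (\<Sum>i<d. (Dh i x)\<^sup>2)"
    have dw: "((\<lambda>s. weight (?t s)) has_real_derivative weight' (?t s) * (lam / n)) (at s)" if "s \<ge> 0" for s
    proof -
      have "((\<lambda>s. lam * s / n) has_real_derivative lam / n) (at s)"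
        by (rule DERIV_cdivide[OF DERIV_cmult_Id])
      moreover have "?t s > - 1" using t0[OF that] by linarith
      ultimately show ?thesis by (intro DERIV_chain2[where g = ?t, OF has_derivative_weight])
    qed
    have dA: "(A \<epsilon> has_real_derivative A' \<epsilon> s) (at s)" for s
      unfolding A_def A'_def
      using DERIV_chain2[OF has_derivative_inner_cutoff[OF eps], of "\<lambda>s. s - r\<^sup>2" 1 s UNIV]
      by (simp add: DERIV_diff[OF DERIV_ident DERIV_const, simplified])
    have Qd: "(Q \<epsilon> has_real_derivative Q' \<epsilon> s) (at s)" if s: "0 \<le> s" for s
    proof -
      have "(Q \<epsilon> has_real_derivative A' \<epsilon> s * (outer_cutoff \<epsilon> s * weight (?t s))
          + (outer_cutoff' \<epsilon> s * weight (?t s) + weight' (?t s) * (lam / n) * outer_cutoff \<epsilon> s) * A \<epsilon> s) (at s)"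
        unfolding Q_def mult.assoc
        by (rule DERIV_mult[OF dA DERIV_mult[OF has_derivative_outer_cutoff dw[OF s], unfolded mult.assoc], unfolded mult.assoc])
      then show ?thesis by (simp add: Q'_def mult_ac)
    qed
    have Q0: "0 \<le> Q \<epsilon> s" if s: "0 \<le> s" for s
        unfolding Q_def A_def
        using inner_cutoff_bounds[OF eps] outer_cutoff_bounds[OF eps s] weight_bounds[OF t0[OF s]] by simp
    have cQ': "continuous_on {0..} (Q' \<epsilon>)"
      unfolding Q'_def by (intro continuous_intros cA cA' cB cw cw' continuous_on_outer_cutoff' eps)
    have R0: "1 / \<epsilon> \<ge> 0" using eps by simp
    \<comment> \<open>The outer cutoff provides the bounded support that
      \<open>weighted_hardy\<close> demands.\<close>
    have supp: "Q \<epsilon> s = 0 \<and> Q' \<epsilon> s = 0" if "s > 1 / \<epsilon>" for s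
      using outer_cutoff_bounds(5)[OF eps] that R0 by (simp add: Q_def Q'_def)
    note hardy = weighted_hardy[OF lam d e h Dh hD Qd cQ' Q0 R0 supp, of y, folded n_def]
    have intT: "integrable ?M (\<lambda>x. T \<epsilon> (?s x) * (indicator ?D x * (h x)\<^sup>2))"
      by (rule integrable_mult_bounded[OF h2 meas[OF cT[OF eps]]]) (rule Td(1)[OF eps])
    have "n * (LINT x|?M. T \<epsilon> (?s x) * (indicator ?D x * (h x)\<^sup>2)) \<le> (LINT x|?M. ?L x)"
      unfolding integral_mult_right_zero[symmetric]
    proof (rule integral_mono)
      fix x
      have s: "?s x \<ge> 0" by simp
      have "?L x = n * ((T \<epsilon> (?s x)) * (h x)\<^sup>2)
          + (h x)\<^sup>2 * (2 * ?s x * (A' \<epsilon> (?s x) * (outer_cutoff \<epsilon> (?s x) * weight (?t (?s x)))))"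
        unfolding T_def Q_def Q'_def potential_def
        by (rule hardy_coefficients) (use n in simp)
      moreover have "0 \<le> (h x)\<^sup>2 * (2 * ?s x * (A' \<epsilon> (?s x) * (outer_cutoff \<epsilon> (?s x) * weight (?t (?s x)))))"
        unfolding A'_def
        using inner_cutoff_bounds[OF eps] outer_cutoff_bounds[OF eps s] weight_bounds[OF t0[OF s]] s
        by (intro mult_nonneg_nonneg) auto
      moreover have "T \<epsilon> (?s x) * (indicator ?D x * (h x)\<^sup>2) = T \<epsilon> (?s x) * (h x)\<^sup>2"
        using Td(2)[OF eps, of x] by (simp add: mult.assoc[symmetric])
      ultimately show "n * (T \<epsilon> (?s x) * (indicator ?D x * (h x)\<^sup>2)) \<le> ?L x"
        by (simp only: le_add_same_cancel1)
    qed (use intT hardy(1) in auto)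
    also have "\<dots> \<le> (LINT x|?M. ?R x)" by (rule hardy(3))
    also have "\<dots> \<le> ?rhs"
      unfolding integral_mult_right_zero[symmetric]
    proof (rule integral_mono)
      fix x
      have s: "?s x \<ge> 0" by simp
      note w = weight_bounds[OF t0[OF s]]
      let ?c = "A \<epsilon> (?s x) * outer_cutoff \<epsilon> (?s x) * (?t (?s x) * weight (?t (?s x)))"
      have "A \<epsilon> (?s x) \<le> indicator ?D x"
        using inner_cutoff_bounds[OF eps, of "?s x - r\<^sup>2"] by (auto simp: A_def indicator_def ball_complement_def)
      then have "?c \<le> indicator ?D x * 1 * 1"
        using inner_cutoff_bounds[OF eps, of "?s x - r\<^sup>2"] outer_cutoff_bounds[OF eps s] w
        by (intro mult_mono) (auto simp: A_def)
      then have "?c * (1 / (e * lam) * (\<Sum>i<d. (Dh i x)\<^sup>2)) \<le> indicator ?D x * 1 * 1 * (1 / (e * lam) * (\<Sum>i<d. (Dh i x)\<^sup>2))"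
        by (intro mult_right_mono mult_nonneg_nonneg sum_nonneg) (use e lam in auto)
      moreover have "?R x = ?c * (1 / (e * lam) * (\<Sum>i<d. (Dh i x)\<^sup>2))"
        unfolding Q_def by (rule hardy_gradient_coefficient) (use n e lam in auto)
      ultimately show "?R x \<le> 1 / (e * lam) * (indicator ?D x * (\<Sum>i<d. (Dh i x)\<^sup>2))"
        by (simp add: mult_ac)
    qed (use hardy(2) Dh2 in auto)
    finally have "(LINT x|?M. T \<epsilon> (?s x) * (indicator ?D x * (h x)\<^sup>2)) \<le> ?rhs / n"
      using n by (intro mult_imp_le_div_pos) (auto simp only: mult.commute)
    \<comment> \<open>The gain 1 / n is given away, so that the gradient coefficient no longer
      depends on the dimension.\<close>
    also have "\<dots> \<le> ?rhs / 1"
    proof (rule divide_left_mono)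
      show "0 \<le> ?rhs"
        using e lam by (intro mult_nonneg_nonneg Bochner_Integration.integral_nonneg) (auto intro!: sum_nonneg)
    qed (use n in auto)
    finally show ?thesis by simp
  qed
  have "(\<lambda>k. LINT x|?M. T (inverse (real (Suc k))) (?s x) * (indicator ?D x * (h x)\<^sup>2))
      \<longlonglongrightarrow> (LINT x|?M. ?W (?s x) * (indicator ?D x * (h x)\<^sup>2))"
  \<comment> \<open>The dominating factor 14 is 10 from the potential plus 4 from the derivative of
    the outer cutoff.\<close>
  proof (rule integral_dominated_convergence[where w = "\<lambda>x. 14 * (indicator ?D x * (h x)\<^sup>2)"])
    show "(\<lambda>x. ?W (?s x) * (indicator ?D x * (h x)\<^sup>2)) \<in> borel_measurable ?M"
      by (intro borel_measurable_times meas cW borel_measurable_integrable[OF h2])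
    show "(\<lambda>x. T (inverse (real (Suc k))) (?s x) * (indicator ?D x * (h x)\<^sup>2)) \<in> borel_measurable ?M" for k
      by (intro borel_measurable_times meas cT borel_measurable_integrable[OF h2]) simp
    show "integrable ?M (\<lambda>x. 14 * (indicator ?D x * (h x)\<^sup>2))" using h2 by simp
    show "AE x in ?M. norm (T (inverse (real (Suc k))) (?s x) * (indicator ?D x * (h x)\<^sup>2)) \<le> 14 * (indicator ?D x * (h x)\<^sup>2)" for k
    proof (rule AE_I2)
      fix x
      show "norm (T (inverse (real (Suc k))) (?s x) * (indicator ?D x * (h x)\<^sup>2)) \<le> 14 * (indicator ?D x * (h x)\<^sup>2)"
        using Td(1)[of "inverse (real (Suc k))" x] by (auto simp: abs_mult intro!: mult_right_mono)
    qed
    show "AE x in ?M. (\<lambda>k. T (inverse (real (Suc k))) (?s x) * (indicator ?D x * (h x)\<^sup>2))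
        \<longlonglongrightarrow> ?W (?s x) * (indicator ?D x * (h x)\<^sup>2)"
    proof (rule AE_I2)
      fix x
      let ?m = "?s x - r\<^sup>2"
      have "(\<lambda>k. T (inverse (real (Suc k))) (?s x)) \<longlonglongrightarrow> ?W (?s x)" if "x \<in> ?D"
      proof -
        have m: "?m > 0" using that by (simp add: ball_complement_def)
        note lim = LIMSEQ_inverse_real_of_nat
        have "(\<lambda>k. inner_cutoff (inverse (real (Suc k))) ?m) \<longlonglongrightarrow> (max ?m 0 / (max ?m 0 + 0))\<^sup>2"
          unfolding inner_cutoff_def by (intro tendsto_intros lim) (use m in auto)
        then have 1: "(\<lambda>k. A (inverse (real (Suc k))) (?s x)) \<longlonglongrightarrow> 1"
          using m by (simp add: A_def)
        have "(\<lambda>k. outer_cutoff (inverse (real (Suc k))) (?s x)) \<longlonglongrightarrow> (max (1 - 0 * ?s x) 0)\<^sup>2"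
          unfolding outer_cutoff_def by (intro tendsto_intros lim)
        then have 2: "(\<lambda>k. outer_cutoff (inverse (real (Suc k))) (?s x)) \<longlonglongrightarrow> 1" by simp
        have "(\<lambda>k. outer_cutoff' (inverse (real (Suc k))) (?s x)) \<longlonglongrightarrow> - 2 * 0 * max (1 - 0 * ?s x) 0"
          unfolding outer_cutoff'_def by (intro tendsto_intros lim)
        then have 3: "(\<lambda>k. outer_cutoff' (inverse (real (Suc k))) (?s x)) \<longlonglongrightarrow> 0" by simp
        have "(\<lambda>k. T (inverse (real (Suc k))) (?s x))
            \<longlonglongrightarrow> 1 * (1 * ?W (?s x) + 2 * (?s x * 0) * weight (?t (?s x)) / n)"
          unfolding T_def by (intro tendsto_intros 1 2 3) (use n in auto)
        then show ?thesis by simp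
      qed
      then show "(\<lambda>k. T (inverse (real (Suc k))) (?s x) * (indicator ?D x * (h x)\<^sup>2))
          \<longlonglongrightarrow> ?W (?s x) * (indicator ?D x * (h x)\<^sup>2)"
        by (cases "x \<in> ?D") (auto intro!: tendsto_intros)
    qed
  qed
  then have "(LINT x|?M. ?W (?s x) * (indicator ?D x * (h x)\<^sup>2)) \<le> ?rhs"
    by (rule LIMSEQ_le_const2) (intro exI allI impI step, simp)
  then show ?thesis by (simp add: scaled_sq_dist_def n_def)
qed

section \<open>Positivity of the combined coefficients\<close>

text \<open>Writing \<open>v = 1 / (1 + t)\<close>, these are the coefficients of \<open>h\<^sup>2\<close> for \<open>n = \<infinity>\<close> (limit)
  and \<open>n = 1\<close> (plane), for \<open>t \<ge> 1/8\<close> (interior) and \<open>t \<le> 1/8\<close> (near the ball). The expansions are Bernstein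
  forms on subintervals.\<close>

lemma nonneg_of_scaled:
  fixes c q r :: real
  assumes "c * q = r" "0 \<le> r" "0 < c"
  shows "0 \<le> q"
  using assms by (metis zero_le_mult_iff not_less)

lemma coefficient_interior_limit:
  fixes v :: real
  assumes "0 \<le> v" "v \<le> 8 / 9"
  shows "1 / 1000 \<le> (1 - 9 * v / 8)\<^sup>2 - 2 * (1 / 2000) * ((1 - 9 * v / 8) * v)
    + ((1 - 1 / 1000) * ((45 * v - 26 * v\<^sup>2 - 18 * v ^ 3) / 100)
      - 2 * ((1 - v) * (45 - 26 * v - 18 * v\<^sup>2) / 100))" (is "_ \<le> ?p")
proof -
  let ?q = "9900 - 38145 * v + 84701 * v ^ 2 - 53982 * v ^ 3"
  have "0 \<le> ?q"
  proof -
    \<comment> \<open>On the whole of [0, 8/9] the Bernstein coefficient next to the one at v = 0 is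
      negative; after the split all coefficients are positive. The factor in front of
      \<open>?q\<close>, here 81, clears denominators.\<close>
    consider "v \<le> 9 / 20" | "9 / 20 \<le> v" by linarith
    then show ?thesis
    proof cases
      case 1
      have "81 * ?q = 1100 * (9 - 20 * v) ^ 3
          + 27855 * v * (9 - 20 * v) ^ 2
          + 556509 * v ^ 2 * (9 - 20 * v)
          + 4415638 * v ^ 3"
        by (simp add: eval_nat_numeral algebra_simps)
      moreover have "0 \<le> \<dots>"
        using 1 assms by (intro add_nonneg_nonneg mult_nonneg_nonneg zero_le_power) auto
      ultimately show ?thesis by (rule nonneg_of_scaled) simp
    next
      case 2
      have "493039 * ?q = 39740742 * (8 - 9 * v) ^ 3
          + 62011101 * (20 * v - 9) * (8 - 9 * v) ^ 2
          + 35357575 * (20 * v - 9) ^ 2 * (8 - 9 * v)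
          + 3648132 * (20 * v - 9) ^ 3"
        by (simp add: eval_nat_numeral algebra_simps)
      moreover have "0 \<le> \<dots>"
        using 2 assms by (intro add_nonneg_nonneg mult_nonneg_nonneg zero_le_power) auto
      ultimately show ?thesis by (rule nonneg_of_scaled) simp
    qed
  qed
  then have "0 \<le> ?q / 100000" by (rule divide_nonneg_nonneg) simp
  also have "?q / 100000 = ?p - 1 / 1000"
    by (simp add: eval_nat_numeral field_simps)
  finally show ?thesis unfolding diff_ge_0_iff_ge .
qed

lemma coefficient_interior_plane:
  fixes v :: real
  assumes "0 \<le> v" "v \<le> 8 / 9"
  shows "1 / 1000 \<le> (1 - 9 * v / 8)\<^sup>2 - 2 * (1 / 2000) * ((1 - 9 * v / 8) * v)
    - 2 * (1 + 1 / 1000) * ((9 / 8 + 1 / 2000)\<^sup>2 * (v ^ 3 * (1 - v)))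
    + ((2 - 1 / 1000) * ((45 * v - 26 * v\<^sup>2 - 18 * v ^ 3) / 100)
      - 2 * ((1 - v) * (45 - 26 * v - 18 * v\<^sup>2) / 100)
      + 2 * (- (1 - v) * (45 * v - 52 * v\<^sup>2 - 54 * v ^ 3) / 100))" (is "_ \<le> ?p")
proof -
  let ?q = "198000000 - 1662900000 * v + 5054020000 * v ^ 2 - 6431708001 * v ^ 3 + 2912068001 * v ^ 4"
  have "0 \<le> ?q"
  proof -
    \<comment> \<open>A single Bernstein form fails as before. The finer subdivision reflects how
      close the polynomial comes to zero: at v = 39/50 the bound exceeds 1/1000 by less than another
      1/1000.\<close>
    consider "v \<le> 1 / 5" | "1 / 5 \<le> v" "v \<le> 2 / 5"
      | "2 / 5 \<le> v" "v \<le> 13 / 20" | "13 / 20 \<le> v" "v \<le> 39 / 50" | "39 / 50 \<le> v" by linarith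
    then show ?thesis
    proof cases
      case 1
      have "1 * ?q = 198000000 * (1 - 5 * v) ^ 4
          + 2297100000 * v * (1 - 5 * v) ^ 3
          + 9810520000 * v ^ 2 * (1 - 5 * v) ^ 2
          + 18390991999 * v ^ 3 * (1 - 5 * v)
          + 12991527996 * v ^ 4"
        by (simp add: eval_nat_numeral algebra_simps)
      moreover have "0 \<le> \<dots>"
        using 1 assms by (intro add_nonneg_nonneg mult_nonneg_nonneg zero_le_power) auto
      ultimately show ?thesis by (rule nonneg_of_scaled) simp
    next
      case 2
      have "625 * ?q = 12991527996 * (2 - 5 * v) ^ 4
          + 11977263973 * (5 * v - 1) * (2 - 5 * v) ^ 3
          + 5329911934 * (5 * v - 1) ^ 2 * (2 - 5 * v) ^ 2
          + 6183875932 * (5 * v - 1) ^ 3 * (2 - 5 * v)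
          + 2751767976 * (5 * v - 1) ^ 4"
        by (simp add: eval_nat_numeral algebra_simps)
      moreover have "0 \<le> \<dots>"
        using 2 assms by (intro add_nonneg_nonneg mult_nonneg_nonneg zero_le_power) auto
      ultimately show ?thesis by (rule nonneg_of_scaled) simp
    next
      case 3
      have "390625 * ?q = 2751767976 * (13 - 20 * v) ^ 4
          + 68144267476 * (5 * v - 2) * (13 - 20 * v) ^ 3
          + 635783783866 * (5 * v - 2) ^ 2 * (13 - 20 * v) ^ 2
          + 1412048534311 * (5 * v - 2) ^ 3 * (13 - 20 * v)
          + 952476612621 * (5 * v - 2) ^ 4"
        by (simp add: eval_nat_numeral algebra_simps)
      moreover have "0 \<le> \<dots>"
        using 3 assms by (intro add_nonneg_nonneg mult_nonneg_nonneg zero_le_power) auto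
      ultimately show ?thesis by (rule nonneg_of_scaled) simp
    next
      case 4
      have "285610000 * ?q = 952476612621 * (39 - 50 * v) ^ 4
          + 7134992133422 * (20 * v - 13) * (39 - 50 * v) ^ 3
          + 16007930119264 * (20 * v - 13) ^ 2 * (39 - 50 * v) ^ 2
          + 12047967276258 * (20 * v - 13) ^ 3 * (39 - 50 * v)
          + 9546712735491 * (20 * v - 13) ^ 4"
        by (simp add: eval_nat_numeral algebra_simps)
      moreover have "0 \<le> \<dots>"
        using 4 assms by (intro add_nonneg_nonneg mult_nonneg_nonneg zero_le_power) auto
      ultimately show ?thesis by (rule nonneg_of_scaled) simp
    next
      case 5
      have "5764801 * ?q = 9546712735491 * (8 - 9 * v) ^ 4
          + 8089878415137 * (50 * v - 39) * (8 - 9 * v) ^ 3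
          + 4034974565128 * (50 * v - 39) ^ 2 * (8 - 9 * v) ^ 2
          + 1013853926880 * (50 * v - 39) ^ 3 * (8 - 9 * v)
          + 91604943488 * (50 * v - 39) ^ 4"
        by (simp add: eval_nat_numeral algebra_simps)
      moreover have "0 \<le> \<dots>"
        using 5 assms by (intro add_nonneg_nonneg mult_nonneg_nonneg zero_le_power) auto
      ultimately show ?thesis by (rule nonneg_of_scaled) simp
    qed
  qed
  then have "0 \<le> ?q / 2000000000" by (rule divide_nonneg_nonneg) simp
  also have "?q / 2000000000 = ?p - 1 / 1000"
    by (simp add: eval_nat_numeral field_simps)
  finally show ?thesis unfolding diff_ge_0_iff_ge .
qed

lemma coefficient_near_limit:
  fixes v :: real
  assumes "8 / 9 \<le> v" "v \<le> 1"
  shows "1 / 1000 \<le> (1 - 1 / 1000) * ((45 * v - 26 * v\<^sup>2 - 18 * v ^ 3) / 100)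
      - 2 * ((1 - v) * (45 - 26 * v - 18 * v\<^sup>2) / 100)" (is "_ \<le> ?p")
proof -
  let ?q = "- 90100 + 186955 * v - 41974 * v ^ 2 - 53982 * v ^ 3"
  have "0 \<le> ?q"
  proof -
    have "1 * ?q = 3648132 * (1 - v) ^ 3
        + 1075439 * (9 * v - 8) * (1 - v) ^ 2
        + 83212 * (9 * v - 8) ^ 2 * (1 - v)
        + 899 * (9 * v - 8) ^ 3"
      by (simp add: eval_nat_numeral algebra_simps)
    moreover have "0 \<le> \<dots>"
      using assms by (intro add_nonneg_nonneg mult_nonneg_nonneg zero_le_power) auto
    ultimately show ?thesis by (rule nonneg_of_scaled) simp
  qed
  then have "0 \<le> ?q / 100000" by (rule divide_nonneg_nonneg) simp
  also have "?q / 100000 = ?p - 1 / 1000"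
    by (simp add: eval_nat_numeral field_simps)
  finally show ?thesis unfolding diff_ge_0_iff_ge .
qed

lemma coefficient_near_plane:
  fixes v :: real
  assumes "8 / 9 \<le> v" "v \<le> 1"
  shows "1 / 1000 \<le> (2 - 1 / 1000) * ((45 * v - 26 * v\<^sup>2 - 18 * v ^ 3) / 100)
      - 2 * ((1 - v) * (45 - 26 * v - 18 * v\<^sup>2) / 100)
      + 2 * (- (1 - v) * (45 * v - 52 * v\<^sup>2 - 54 * v ^ 3) / 100)" (is "_ \<le> ?p")
proof -
  let ?q = "- 90100 + 141955 * v + 126026 * v ^ 2 - 67982 * v ^ 3 - 108000 * v ^ 4"
  have "0 \<le> ?q"
  proof -
    have "1 * ?q = 134425188 * (1 - v) ^ 4
        + 51762083 * (9 * v - 8) * (1 - v) ^ 3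
        + 6729347 * (9 * v - 8) ^ 2 * (1 - v) ^ 2
        + 310303 * (9 * v - 8) ^ 3 * (1 - v)
        + 1899 * (9 * v - 8) ^ 4"
      by (simp add: eval_nat_numeral algebra_simps)
    moreover have "0 \<le> \<dots>"
      using assms by (intro add_nonneg_nonneg mult_nonneg_nonneg zero_le_power) auto
    ultimately show ?thesis by (rule nonneg_of_scaled) simp
  qed
  then have "0 \<le> ?q / 100000" by (rule divide_nonneg_nonneg) simp
  also have "?q / 100000 = ?p - 1 / 1000"
    by (simp add: eval_nat_numeral field_simps)
  finally show ?thesis unfolding diff_ge_0_iff_ge .
qed

section \<open>The Poincare inequality outside the ball\<close>

text \<open>The chi of the Gaussian part: the positive part of t - 1/8 divided by 1 + t, with the
  corner at 1/8 rounded by \<open>\<kappa>\<close> to make it C^1. It increases to 1, and its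
  derivative decays like (1 + t)^(-2), which keeps t times the squared derivative bounded.\<close>

definition bump :: "real \<Rightarrow> real \<Rightarrow> real" where
  "bump \<kappa> t = (max (t - 1 / 8) 0)\<^sup>2 / (max (t - 1 / 8) 0 + \<kappa>) / (1 + t)"

definition bump' :: "real \<Rightarrow> real \<Rightarrow> real" where
  "bump' \<kappa> t = ((max (t - 1 / 8) 0)\<^sup>2 + 2 * \<kappa> * max (t - 1 / 8) 0) / (max (t - 1 / 8) 0 + \<kappa>)\<^sup>2 / (1 + t)
     - (max (t - 1 / 8) 0)\<^sup>2 / (max (t - 1 / 8) 0 + \<kappa>) / (1 + t)\<^sup>2"

lemma has_derivative_bump:
  assumes \<kappa>: "\<kappa> > 0" and t: "t > - 1"
  shows "(bump \<kappa> has_real_derivative bump' \<kappa> t) (at t)"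
proof -
  let ?g = "\<lambda>m. m\<^sup>2 / (m + \<kappa>)" and ?g' = "\<lambda>m. (m\<^sup>2 + 2 * \<kappa> * m) / (m + \<kappa>)\<^sup>2"
  have g: "((\<lambda>u. ?g (max u 0)) has_real_derivative ?g' (max u 0)) (at u)" for u
  proof (rule has_real_derivative_max_0)
    fix m :: real assume "0 \<le> m"
    then have m: "m + \<kappa> \<noteq> 0" using \<kappa> by simp
    have "((\<lambda>m. m ^ 2) has_real_derivative real 2 * (1 * m ^ (2 - Suc 0))) (at m)"
      by (rule DERIV_power[OF DERIV_ident])
    then have "(?g has_real_derivative
        (real 2 * (1 * m ^ (2 - Suc 0)) * (m + \<kappa>) - m\<^sup>2 * (1 + 0)) / ((m + \<kappa>) * (m + \<kappa>))) (at m)"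
      by (intro DERIV_divide DERIV_add DERIV_ident DERIV_const m)
    moreover have "(real 2 * (1 * m ^ (2 - Suc 0)) * (m + \<kappa>) - m\<^sup>2 * (1 + 0)) / ((m + \<kappa>) * (m + \<kappa>)) = ?g' m"
      by (simp add: power2_eq_square algebra_simps)
    ultimately show "(?g has_real_derivative ?g' m) (at m)" by simp
  qed simp
  have "((\<lambda>t. ?g (max (t - 1 / 8) 0)) has_real_derivative ?g' (max (t - 1 / 8) 0)) (at t)"
    using DERIV_chain2[OF g, of "\<lambda>t. t - 1 / 8" 1 t UNIV]
    by (simp add: DERIV_diff[OF DERIV_ident DERIV_const, simplified])
  moreover have "1 + t \<noteq> 0" using t by simp
  ultimately have "(bump \<kappa> has_real_derivative
      (?g' (max (t - 1 / 8) 0) * (1 + t) - ?g (max (t - 1 / 8) 0) * (0 + 1)) / ((1 + t) * (1 + t))) (at t)"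
    unfolding bump_def by (intro DERIV_divide DERIV_add DERIV_ident DERIV_const)
  moreover have "(?g' (max (t - 1 / 8) 0) * (1 + t) - ?g (max (t - 1 / 8) 0) * (0 + 1)) / ((1 + t) * (1 + t)) = bump' \<kappa> t"
  proof -
    have "(a * (1 + t) - b * (0 + 1)) / ((1 + t) * (1 + t)) = a / (1 + t) - b / (1 + t)\<^sup>2" for a b :: real
      using \<open>1 + t \<noteq> 0\<close> by (simp add: diff_divide_distrib power2_eq_square)
    then show ?thesis unfolding bump'_def .
  qed
  ultimately show ?thesis by (simp only:)
qed

lemma continuous_on_bump:
  assumes "\<kappa> > 0"
  shows "continuous_on {0..} (bump \<kappa>)" "continuous_on {0..} (bump' \<kappa>)"
proof -
  have nz: "max (t - 1 / 8) 0 + \<kappa> \<noteq> 0" "(max (t - 1 / 8) 0 + \<kappa>)\<^sup>2 \<noteq> 0" for t using assms by (auto simp: max_def)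
  have nz': "1 + t \<noteq> 0" "(1 + t)\<^sup>2 \<noteq> 0" if "t \<in> {0..}" for t :: real using that by auto
  show "continuous_on {0..} (bump \<kappa>)" unfolding bump_def
    by (intro continuous_intros ballI nz nz')
  show "continuous_on {0..} (bump' \<kappa>)" unfolding bump'_def
    by (intro continuous_intros ballI nz nz')
qed

text \<open>With m the positive part of t - 1/8 and g = m^2 / (m + \<kappa>), everything follows
  from m - \<kappa> \<le> g \<le> m, g \<le> g' m, g' \<le> 1 and, for t > 1/8, m v = 1 - 9 v / 8.
  The unrounded function has value 1 - 9 v / 8 and derivative 9 v^2 / 8, so the rounding costs only
  terms linear in \<open>\<kappa>\<close>.\<close>

lemma bump_bounds:
  fixes t \<kappa> :: real
  defines "v \<equiv> 1 / (1 + t)"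
  assumes \<kappa>: "\<kappa> > 0" and t: "t \<ge> 0"
  shows "0 \<le> bump \<kappa> t" "bump \<kappa> t \<le> 1"
    "t \<le> 1 / 8 \<Longrightarrow> bump \<kappa> t = 0 \<and> bump' \<kappa> t = 0"
    "t > 1 / 8 \<Longrightarrow> 0 < bump \<kappa> t"
    "t > 1 / 8 \<Longrightarrow> (1 - 9 * v / 8) - \<kappa> * v \<le> bump \<kappa> t"
    "0 \<le> bump' \<kappa> t" "bump' \<kappa> t \<le> (9 / 8 + \<kappa>) * v\<^sup>2"
proof -
  define m where "m = max (t - 1 / 8) 0"
  define g where "g = m\<^sup>2 / (m + \<kappa>)"
  define g' where "g' = (m\<^sup>2 + 2 * \<kappa> * m) / (m + \<kappa>)\<^sup>2"
  have b: "bump \<kappa> t = g * v" and b': "bump' \<kappa> t = g' * v - g * v\<^sup>2"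
    by (simp_all add: bump_def bump'_def g_def g'_def m_def v_def power_divide)
  note v = unit_variable[OF t v_def[THEN meta_eq_to_obj_eq]]
  have m0: "m \<ge> 0" by (simp add: m_def)
  have g0: "0 \<le> g" using m0 \<kappa> by (simp add: g_def)
  have gm: "g \<le> m"
  proof -
    have "m\<^sup>2 \<le> m * (m + \<kappa>)" using m0 \<kappa> by (simp add: power2_eq_square algebra_simps)
    then show ?thesis using m0 \<kappa> by (simp add: g_def pos_divide_le_eq)
  qed
  have mg: "m - \<kappa> \<le> g"
  proof -
    have "(m - \<kappa>) * (m + \<kappa>) \<le> m\<^sup>2" by (simp add: power2_eq_square algebra_simps)
    then show ?thesis using m0 \<kappa> by (simp add: g_def pos_le_divide_eq)
  qed
  have g'1: "g' \<le> 1"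
  proof -
    have "m\<^sup>2 + 2 * \<kappa> * m \<le> (m + \<kappa>)\<^sup>2" by (simp add: power2_eq_square algebra_simps)
    then show ?thesis using m0 \<kappa> by (simp add: g'_def)
  qed
  have g'0: "0 \<le> g'" using m0 \<kappa> by (simp add: g'_def)
  have gg': "g \<le> g' * m"
  proof -
    have "g = m\<^sup>2 * (m + \<kappa>) / (m + \<kappa>)\<^sup>2" using m0 \<kappa> by (simp add: g_def power2_eq_square)
    also have "\<dots> \<le> (m\<^sup>2 + 2 * \<kappa> * m) * m / (m + \<kappa>)\<^sup>2"
      using m0 \<kappa> by (intro divide_right_mono) (auto simp: power2_eq_square algebra_simps)
    finally show ?thesis by (simp add: g'_def)
  qed
  have mv: "m * v = 1 - 9 * v / 8" if "t > 1 / 8"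
    using that v(3) by (simp add: m_def left_diff_distrib)
  have mv1: "m * v \<le> 1"
  proof (cases "t > 1 / 8")
    case False
    then show ?thesis by (simp add: m_def)
  qed (use mv v in simp)
  show "0 \<le> bump \<kappa> t" unfolding b using g0 v by simp
  have "g * v \<le> m * v" using gm v by (intro mult_right_mono) auto
  then show "bump \<kappa> t \<le> 1" unfolding b using mv1 by linarith
  show "t \<le> 1 / 8 \<Longrightarrow> bump \<kappa> t = 0 \<and> bump' \<kappa> t = 0" by (simp add: bump_def bump'_def)
  show "t > 1 / 8 \<Longrightarrow> 0 < bump \<kappa> t" using \<kappa> by (simp add: bump_def)
  show "(1 - 9 * v / 8) - \<kappa> * v \<le> bump \<kappa> t" if "t > 1 / 8"
  proof -
    have "(m - \<kappa>) * v \<le> g * v" using mg v by (intro mult_right_mono) auto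
    then show ?thesis unfolding b using mv[OF that] by (simp add: left_diff_distrib)
  qed
  have "g * v\<^sup>2 \<le> (g' * m) * v\<^sup>2" using gg' by (intro mult_right_mono) auto
  also have "\<dots> = (g' * v) * (m * v)" by (simp add: power2_eq_square)
  also have "\<dots> \<le> (g' * v) * 1" using mv1 g'0 v by (intro mult_left_mono) auto
  finally show "0 \<le> bump' \<kappa> t" unfolding b' by simp
  show "bump' \<kappa> t \<le> (9 / 8 + \<kappa>) * v\<^sup>2"
  proof (cases "t > 1 / 8")
    case True
    have "g' * v - g * v\<^sup>2 \<le> 1 * v - (m - \<kappa>) * v\<^sup>2"
      using g'1 mg v by (intro diff_mono mult_right_mono) auto
    also have "\<dots> = v * (1 - m * v) + \<kappa> * v\<^sup>2" by (simp add: power2_eq_square algebra_simps)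
    also have "\<dots> = (9 / 8 + \<kappa>) * v\<^sup>2" unfolding mv[OF True] by (simp add: power2_eq_square algebra_simps)
    finally show ?thesis unfolding b' .
  next
    case False
    then have "bump' \<kappa> t = 0" by (simp add: bump'_def)
    then show ?thesis using \<kappa> by simp
  qed
qed

text \<open>The right side is affine in m = 1 / n, hence the convex combination with weights 1 - m
  and m of its values for n = infinity and n = 1. Only these two polynomial inequalities in v have
  to be checked, and the bound is uniform in the dimension.\<close>

lemma total_coefficient:
  fixes t n :: real
  assumes t: "t \<ge> 0" and n: "n \<ge> 1"
  shows "1 / 1000 \<le> (bump (1 / 2000) t)\<^sup>2 - 2 * (1 + 1 / 1000) * (t * (bump' (1 / 2000) t)\<^sup>2) / n
    + potential n (1 / 1000) t"
proof -
  define v where "v = 1 / (1 + t)"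
  define w where "w = (45 * v - 26 * v\<^sup>2 - 18 * v ^ 3) / 100"
  define tw where "tw = (1 - v) * (45 - 26 * v - 18 * v\<^sup>2) / 100"
  define tw' where "tw' = - (1 - v) * (45 * v - 52 * v\<^sup>2 - 54 * v ^ 3) / 100"
  let ?c = "(bump (1 / 2000) t)\<^sup>2" and ?c' = "2 * (1 + 1 / 1000) * (t * (bump' (1 / 2000) t)\<^sup>2)"
  note v = unit_variable[OF t v_def]
  have eqs: "weight t = w" "t * weight t = tw" "t * weight' t = tw'"
    using weight_unit[OF t v_def] t_weight_unit[OF t v_def] t_weight'_unit[OF t v_def]
    by (simp_all add: w_def tw_def tw'_def)
  have A: "1 / 1000 \<le> ?c + ((1 - 1 / 1000) * w - 2 * tw)"
    and B: "1 / 1000 \<le> ?c - ?c' + ((2 - 1 / 1000) * w - 2 * tw + 2 * tw')"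
  proof -
    note bb = bump_bounds[where \<kappa> = "1 / 2000", OF _ t, folded v_def, simplified]
    have "1 / 1000 \<le> ?c + ((1 - 1 / 1000) * w - 2 * tw) \<and> 1 / 1000 \<le> ?c - ?c' + ((2 - 1 / 1000) * w - 2 * tw + 2 * tw')"
    proof (cases "t > 1 / 8")
      case True
      then have v89: "v \<le> 8 / 9" by (simp add: v_def field_simps)
      let ?base = "1 - 9 * v / 8"
      have c0: "0 \<le> ?base" using v89 by simp
      have c: "?base\<^sup>2 - 2 * (1 / 2000) * (?base * v) \<le> ?c"
      \<comment> \<open>The lower bound for the bump can be squared only where it is nonnegative;
        elsewhere \<open>?base\<close> is below \<kappa> v and the left side is itself
        nonpositive.\<close>
      proof (cases "?base - 1 / 2000 * v \<ge> 0")
        case ge: True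
        have "?base\<^sup>2 - 2 * (1 / 2000) * (?base * v) \<le> (?base - 1 / 2000 * v)\<^sup>2"
        proof -
          have "(a - k * v)\<^sup>2 = a\<^sup>2 - 2 * k * (a * v) + (k * v)\<^sup>2" for a k :: real
            by (simp add: power2_eq_square algebra_simps)
          from this[of ?base "1 / 2000"] show ?thesis using zero_le_power2[of "1 / 2000 * v"] by linarith
        qed
        also have "\<dots> \<le> ?c" using ge bb(5) True by (intro power_mono) auto
        finally show ?thesis .
      next
        case False
        then have "?base * (?base - 2 * (1 / 2000) * v) \<le> 0"
          using c0 v by (intro mult_nonneg_nonpos) auto
        then have "?base\<^sup>2 - 2 * (1 / 2000) * (?base * v) \<le> 0"
        proof -
          have "b * (b - 2 * k * v) = b\<^sup>2 - 2 * k * (b * v)" for b k :: real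
            by (simp add: power2_eq_square algebra_simps)
          from this[of ?base "1 / 2000"] \<open>?base * (?base - 2 * (1 / 2000) * v) \<le> 0\<close> show ?thesis by linarith
        qed
        also have "0 \<le> ?c" by simp
        finally show ?thesis .
      qed
      have "(bump' (1 / 2000) t)\<^sup>2 \<le> ((9 / 8 + 1 / 2000) * v\<^sup>2)\<^sup>2"
        using bump_bounds(6,7)[OF _ t, of "1 / 2000", folded v_def] by (intro power_mono) auto
      then have "t * (bump' (1 / 2000) t)\<^sup>2 \<le> t * ((9 / 8 + 1 / 2000) * v\<^sup>2)\<^sup>2"
        using t by (rule mult_left_mono)
      also have "\<dots> = (9 / 8 + 1 / 2000)\<^sup>2 * (v ^ 3 * (t * v))"
        by (simp add: power_mult_distrib eval_nat_numeral)
      finally have c': "?c' \<le> 2 * (1 + 1 / 1000) * ((9 / 8 + 1 / 2000)\<^sup>2 * (v ^ 3 * (1 - v)))"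
        unfolding v(3) by (intro mult_left_mono) auto
      have v0: "0 \<le> v" using v by simp
      note limits = coefficient_interior_limit[OF v0 v89, folded w_def tw_def]
        coefficient_interior_plane[OF v0 v89, folded w_def tw_def tw'_def]
      show ?thesis
        using order_trans[OF limits(1) add_right_mono[OF c]]
          order_trans[OF limits(2) add_right_mono[OF diff_mono[OF c c']]] by blast
    next
      case False
      then have "8 / 9 \<le> v" using t by (simp add: v_def field_simps)
      moreover have "bump (1 / 2000) t = 0" "bump' (1 / 2000) t = 0"
        using False by (simp_all add: bump_def bump'_def)
      ultimately show ?thesis
        using coefficient_near_limit[of v] coefficient_near_plane[of v] v
        unfolding w_def tw_def tw'_def by auto
    qed
    then show "1 / 1000 \<le> ?c + ((1 - 1 / 1000) * w - 2 * tw)"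
      and "1 / 1000 \<le> ?c - ?c' + ((2 - 1 / 1000) * w - 2 * tw + 2 * tw')" by blast+
  qed
  define m where "m = 1 / n"
  have m: "0 \<le> m" "m \<le> 1" using n by (auto simp: m_def)
  have pot: "potential n (1 / 1000) t = (1 - m) * ((1 - 1 / 1000) * w - 2 * tw)
      + m * ((2 - 1 / 1000) * w - 2 * tw + 2 * tw')"
  proof -
    have "potential n (1 / 1000) t = weight t * (1 - 1 / 1000 + m) - 2 * (t * weight t) + 2 * (t * weight' t) * m"
      by (simp add: potential_def m_def algebra_simps)
    then show ?thesis unfolding eqs(2,3) unfolding eqs(1) by (simp add: field_simps)
  qed
  have "(1 - m) * (1 / 1000) + m * (1 / 1000)
      \<le> (1 - m) * (?c + ((1 - 1 / 1000) * w - 2 * tw)) + m * (?c - ?c' + ((2 - 1 / 1000) * w - 2 * tw + 2 * tw'))"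
    using A B m by (intro add_mono mult_left_mono) auto
  also have "\<dots> = ?c - ?c' * m + potential n (1 / 1000) t"
    unfolding pot by (simp only: algebra_simps) 
  finally have "(1 - m) * (1 / 1000) + m * (1 / 1000) \<le> ?c - ?c' * m + potential n (1 / 1000) t" .
  moreover have "(1 - m) * (1 / 1000) + m * (1 / 1000) = 1 / 1000" by (simp add: field_simps)
  moreover have "?c' * m = ?c' / n" by (simp add: m_def)
  ultimately show ?thesis by linarith
qed

text \<open>Far out along one coordinate axis every point lies outside the ball, so positive mass of
  all such half-spaces shows that neither the normalising mass nor the integral of the bump
  vanishes.\<close>

lemma not_AE_gauss_coordinate_le:
  assumes lam: "lam > 0" and i: "i < d"
  shows "\<not> (AE x in gauss d lam. x i \<le> c)"
proof
  assume *: "AE x in gauss d lam. x i \<le> c"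
  have "distr (gauss d lam) (gauss1 lam) (\<lambda>x. x i) = gauss1 lam"
    unfolding gauss_def by (rule distr_PiM_component[OF prob_space_gauss1[OF lam]]) (use i in auto)
  moreover have "AE t in distr (gauss d lam) (gauss1 lam) (\<lambda>x. x i). t \<le> c"
    using * i by (subst AE_distr_iff) (auto simp: gauss_def)
  ultimately have "AE t in gauss1 lam. t \<le> c" by (simp only:)
  then have "AE t in lborel. t \<le> c"
    unfolding gauss1_def using lam
    by (subst (asm) AE_density) (auto simp: normal_density_pos)
  then have "emeasure lborel {c<..c + 1} = 0"
    by (subst AE_iff_measurable[symmetric, of _ _ "\<lambda>t. \<not> t \<in> {c<..c + 1}"]) (auto elim!: eventually_mono)
  then show False by simp
qed

lemma scaled_sq_dist_gt_of_coordinate: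
  assumes lam: "lam > 0" and d: "d \<ge> 2"
    and x: "y 0 + sqrt ((real d - 1) / (8 * lam)) < x 0"
  shows "1 / 8 < scaled_sq_dist d lam y x"
proof -
  have n: "real d - 1 > 0" using d by simp
  have "(sqrt ((real d - 1) / (8 * lam)))\<^sup>2 < (x 0 - y 0)\<^sup>2"
    using x n lam by (intro power_strict_mono) auto
  also have "\<dots> \<le> sq_dist d y x"
    unfolding sq_dist_def using d by (intro member_le_sum) auto
  finally have "(real d - 1) / (8 * lam) < sq_dist d y x" using n lam by simp
  then show ?thesis using n lam by (simp add: scaled_sq_dist_def field_simps)
qed

text \<open>The Gaussian Poincare inequality for \<open>bump (f - a)\<close>, which vanishes near the ball, controls \<open>f - a\<close> away from
  the ball up to the term with the derivative of \<open>bump\<close>; that term and the region near the ball are absorbed by the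
  weighted Hardy inequality.\<close>

lemma poincare_ball_complement:
  fixes d :: nat
  assumes lam: "lam > 0" and d: "d \<ge> 2" and r: "lam * r\<^sup>2 \<le> (real d - 1) / 8"
    and f: "continuous_on (Rd d) f" and Df: "\<And>i. i < d \<Longrightarrow> continuous_on (Rd d) (Df i)"
    and fD: "\<And>i x. i < d \<Longrightarrow> x \<in> Rd d \<Longrightarrow> has_partial f (Df i x) i x"
    and f2: "integrable (gauss d lam) (\<lambda>x. indicator (ball_complement d y r) x * (f x)\<^sup>2)"
    and Df2: "integrable (gauss d lam) (\<lambda>x. indicator (ball_complement d y r) x * (\<Sum>i<d. (Df i x)\<^sup>2))"
  obtains a where "(LINT x|gauss d lam. indicator (ball_complement d y r) x * (f x - a)\<^sup>2)
    \<le> 2000000 / lam * (LINT x|gauss d lam. indicator (ball_complement d y r) x * (\<Sum>i<d. (Df i x)\<^sup>2))"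
proof -
  let ?M = "gauss d lam" and ?D = "ball_complement d y r" and ?\<kappa> = "1 / 2000 :: real" and ?e = "1 / 1000 :: real"
  interpret prob_space ?M by (rule prob_space_gauss[OF lam])
  define n where "n = real d - 1"
  have n: "n \<ge> 1" using d by (simp add: n_def)
  define \<tau> where "\<tau> = scaled_sq_dist d lam y"
  have \<tau>_eq: "\<tau> x = lam * sq_dist d y x / n" for x by (simp add: \<tau>_def scaled_sq_dist_def n_def)
  have \<tau>0: "\<tau> x \<ge> 0" for x using lam n by (simp add: \<tau>_eq)
  \<comment> \<open>The smallness of r enters here: the region where the bump is positive lies
    outside the ball.\<close>
  have \<tau>D: "x \<in> ?D" if "1 / 8 < \<tau> x" for x
  proof -
    have "lam * r\<^sup>2 < lam * sq_dist d y x"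
      using that r n by (simp add: \<tau>_eq n_def field_simps)
    then show ?thesis using lam by (simp add: ball_complement_def)
  qed
  have cs: "continuous_on A (\<lambda>x. sq_dist d y x)" for A by (rule continuous_on_sq_dist)
  have c\<tau>: "continuous_on A \<tau>" for A
    unfolding \<tau>_eq[abs_def] using n by (intro continuous_intros cs) auto
  let ?b = "\<lambda>x. bump ?\<kappa> (\<tau> x)" and ?b' = "\<lambda>x. bump' ?\<kappa> (\<tau> x)"
  have cb: "continuous_on A ?b" and cb': "continuous_on A ?b'" for A
    by (rule continuous_on_compose2[OF continuous_on_bump(1) c\<tau>] continuous_on_compose2[OF continuous_on_bump(2) c\<tau>];
        use \<tau>0 in auto)+
  note bb = bump_bounds[where \<kappa> = ?\<kappa>, OF _ \<tau>0, simplified]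
  have b0: "0 \<le> ?b x" and b1: "?b x \<le> 1" and b'0: "0 \<le> ?b' x" for x
    using bb(1,2,6) by auto
  have bD: "?b x = indicator ?D x * ?b x" "?b' x = indicator ?D x * ?b' x" for x
  proof -
    have "?b x = 0 \<and> ?b' x = 0" if "x \<notin> ?D"
      using bump_bounds(3)[of ?\<kappa> "\<tau> x"] \<tau>0 \<tau>D that by (force simp: not_less)
    then show "?b x = indicator ?D x * ?b x" "?b' x = indicator ?D x * ?b' x"
      by (auto simp: indicator_def)
  qed
  have tb'_bound: "\<tau> x * (?b' x)\<^sup>2 \<le> 4" for x
  proof -
    define v where "v = 1 / (1 + \<tau> x)"
    note v = unit_variable[OF \<tau>0 v_def]
    have "?b' x \<le> (9 / 8 + ?\<kappa>) * v\<^sup>2" using bump_bounds(7)[of ?\<kappa> "\<tau> x"] \<tau>0 by (simp add: v_def)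
    also have "\<dots> \<le> 2 * v"
    proof -
      have "v\<^sup>2 \<le> v" using v by (simp add: power2_eq_square mult_left_le)
      then show ?thesis using v by simp
    qed
    finally have "(?b' x)\<^sup>2 \<le> (2 * v)\<^sup>2" using b'0 by (intro power_mono) auto
    then have "\<tau> x * (?b' x)\<^sup>2 \<le> \<tau> x * (2 * v)\<^sup>2" using \<tau>0 by (rule mult_left_mono)
    also have "\<dots> = 4 * (v * (\<tau> x * v))" by (simp add: power2_eq_square)
    also have "\<dots> \<le> 4 * (1 * 1)" unfolding v(3) using v by (intro mult_left_mono mult_mono) auto
    finally show ?thesis by simp
  qed
  note meas = borel_measurable_gauss_continuous[where lam = lam]
  have intb: "integrable ?M ?b"
    by (rule integrable_gauss_bounded[OF lam meas[OF cb], where B = 1]) (use b0 b1 in simp)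
  have D1: "integrable ?M (indicator ?D :: _ \<Rightarrow> real)"
    by (rule integrable_gauss_bounded[OF lam measurable_ball_complement, where B = 1]) simp
  have f1: "integrable ?M (\<lambda>x. indicator ?D x * f x)"
  proof (rule square_integrable_imp_integrable)
    show "(\<lambda>x. indicator ?D x * f x) \<in> borel_measurable ?M"
      by (intro borel_measurable_times measurable_ball_complement meas f)
    have "(\<lambda>x. (indicator ?D x * f x)\<^sup>2) = (\<lambda>x. indicator ?D x * (f x)\<^sup>2)"
      by (auto simp: fun_eq_iff indicator_def)
    then show "integrable ?M (\<lambda>x. (indicator ?D x * f x)\<^sup>2)" using f2 by simp
  qed
  have intbf: "integrable ?M (\<lambda>x. ?b x * f x)"
  proof -
    have "integrable ?M (\<lambda>x. ?b x * (indicator ?D x * f x))"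
      by (rule integrable_mult_bounded[OF f1 meas[OF cb], where B = 1]) (use b0 b1 in simp)
    moreover have "?b x * (indicator ?D x * f x) = ?b x * f x" for x
      using bD(1)[of x] by (metis mult.assoc mult.commute)
    ultimately show ?thesis by simp
  qed
  have pos: "(LINT x|?M. ?b x) > 0"
  proof (rule ccontr)
    assume "\<not> (LINT x|?M. ?b x) > 0"
    moreover have "(LINT x|?M. ?b x) \<ge> 0" using b0 by (intro Bochner_Integration.integral_nonneg) auto
    ultimately have "(LINT x|?M. ?b x) = 0" by simp
    then have "AE x in ?M. ?b x = 0"
      using integral_nonneg_eq_0_iff_AE[OF intb] b0 by simp
    then have "AE x in ?M. x 0 \<le> y 0 + sqrt ((real d - 1) / (8 * lam))"
    proof (rule eventually_mono)
      fix x assume "?b x = 0"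
      then have "\<not> 1 / 8 < \<tau> x" using bump_bounds(4)[of ?\<kappa> "\<tau> x"] \<tau>0 by fastforce
      then show "x 0 \<le> y 0 + sqrt ((real d - 1) / (8 * lam))"
        using scaled_sq_dist_gt_of_coordinate[OF lam d, of y x] unfolding \<tau>_def by linarith
    qed
    then show False using not_AE_gauss_coordinate_le[OF lam, of 0 d] d by auto
  qed
  \<comment> \<open>This weighted mean makes the bump times f - a centred, so its variance is its
    second moment. In the end any constant will do, since the variance of f is the least second
    moment about a constant.\<close>
  define a where "a = (LINT x|?M. ?b x * f x) / (LINT x|?M. ?b x)"
  define h where "h = (\<lambda>x. f x - a)"
  have ch: "continuous_on (Rd d) h" unfolding h_def by (intro continuous_intros f)
  have hD: "has_partial h (Df i x) i x" if "i < d" "x \<in> Rd d" for i x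
    unfolding h_def using fD[OF that] by (auto intro!: derivative_eq_intros)
  have h2: "integrable ?M (\<lambda>x. indicator ?D x * (h x)\<^sup>2)"
  proof -
    have "integrable ?M (\<lambda>x. indicator ?D x * (f x)\<^sup>2 - 2 * a * (indicator ?D x * f x) + a\<^sup>2 * indicator ?D x)"
      using f2 f1 D1 by simp
    then show ?thesis by (simp add: h_def power2_diff algebra_simps)
  qed
  define u where "u = (\<lambda>x. ?b x * h x)"
  define Du where "Du = (\<lambda>i x. ?b' x * (2 * lam / n * (x i - y i)) * h x + ?b x * Df i x)"
  have cu: "continuous_on (Rd d) u" unfolding u_def by (intro continuous_intros cb ch)
  have cDu: "continuous_on (Rd d) (Du i)" if "i < d" for i
    unfolding Du_def by (intro continuous_intros cb cb' ch Df that continuous_on_coordinate)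
  have uD: "has_partial u (Du i x) i x" if i: "i < d" and x: "x \<in> Rd d" for i x
  proof -
    have "has_partial \<tau> (2 * lam / n * (x i - y i)) i x"
    proof -
      have "has_partial (\<lambda>x. lam * sq_dist d y x / n) (lam * (2 * (x i - y i)) / n) i x"
        by (rule DERIV_cdivide[OF DERIV_cmult[OF has_partial_sq_dist[OF i]]])
      then show ?thesis by (simp add: \<tau>_eq mult_ac)
    qed
    moreover have "(bump ?\<kappa> has_real_derivative ?b' x) (at (\<tau> (x(i := x i))))"
      using has_derivative_bump[of ?\<kappa> "\<tau> x"] \<tau>0[of x] by simp
    ultimately have "has_partial ?b (?b' x * (2 * lam / n * (x i - y i))) i x"
      by (rule DERIV_chain2[rotated])
    from DERIV_mult[OF this hD[OF i x]] show ?thesis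
      unfolding u_def Du_def by (simp add: mult_ac)
  qed
  have u_sq: "(u x)\<^sup>2 = (?b x)\<^sup>2 * (indicator ?D x * (h x)\<^sup>2)" for x
    using bD(1)[of x] by (cases "x \<in> ?D") (auto simp: u_def power_mult_distrib)
  have u2: "integrable ?M (\<lambda>x. (u x)\<^sup>2)"
    unfolding u_sq
    by (rule integrable_mult_bounded[OF h2, where B = 1])
       (use b0 b1 in \<open>auto intro!: meas continuous_intros cb simp: power_le_one\<close>)
  have u1: "integrable ?M u"
    by (rule square_integrable_imp_integrable[OF meas[OF cu] u2])
  have u_mean: "(LINT x|?M. u x) = 0"
  proof -
    have "(LINT x|?M. u x) = (LINT x|?M. ?b x * f x - a * ?b x)"
      by (simp add: u_def h_def algebra_simps)
    also have "\<dots> = (LINT x|?M. ?b x * f x) - a * (LINT x|?M. ?b x)"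
      using intb intbf by simp
    also have "\<dots> = 0" using pos by (simp add: a_def)
    finally show ?thesis .
  qed
  let ?I = "LINT x|?M. indicator ?D x * (\<Sum>i<d. (Df i x)\<^sup>2)"
  define P where "P = (\<lambda>x. (1 + 1 / ?e) * (indicator ?D x * (\<Sum>i<d. (Df i x)\<^sup>2))
      + (1 + ?e) * (4 * lam / n) * (\<tau> x * (?b' x)\<^sup>2 * (indicator ?D x * (h x)\<^sup>2)))"
  have int_tb: "integrable ?M (\<lambda>x. \<tau> x * (?b' x)\<^sup>2 * (indicator ?D x * (h x)\<^sup>2))"
    by (rule integrable_mult_bounded[OF h2, where B = 4])
       (use tb'_bound \<tau>0 in \<open>auto intro!: meas continuous_intros cb' c\<tau> simp: abs_mult\<close>)
  have intP: "integrable ?M P" unfolding P_def using Df2 int_tb by simp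
  have grad: "(\<Sum>i<d. (Du i x)\<^sup>2) \<le> P x" for x
  proof -
    let ?\<alpha> = "?b' x * (2 * lam / n) * h x"
    \<comment> \<open>The weights are unequal on purpose: the term with the derivative of the bump
      must be absorbed within a small margin and may only gain the factor 1 + 1/1000, whereas the
      gradient of f can afford 1001.\<close>
    have young: "(p * z + b * g)\<^sup>2 \<le> (1 + ?e) * p\<^sup>2 * z\<^sup>2 + (1 + 1 / ?e) * b\<^sup>2 * g\<^sup>2" for p z b g :: real
    proof -
      have "0 \<le> (p * z - 1000 * (b * g))\<^sup>2" by simp
      then show ?thesis by (simp add: power2_eq_square algebra_simps)
    qed
    have "(\<Sum>i<d. (Du i x)\<^sup>2) \<le> (\<Sum>i<d. (1 + ?e) * ?\<alpha>\<^sup>2 * (x i - y i)\<^sup>2 + (1 + 1 / ?e) * (?b x)\<^sup>2 * (Df i x)\<^sup>2)"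
    proof (rule sum_mono)
      fix i
      show "(Du i x)\<^sup>2 \<le> (1 + ?e) * ?\<alpha>\<^sup>2 * (x i - y i)\<^sup>2 + (1 + 1 / ?e) * (?b x)\<^sup>2 * (Df i x)\<^sup>2"
      proof -
        have "Du i x = ?\<alpha> * (x i - y i) + ?b x * Df i x" by (simp add: Du_def mult_ac)
        then show ?thesis by (simp only: young)
      qed
    qed
    also have "\<dots> = (1 + ?e) * (?\<alpha>\<^sup>2 * sq_dist d y x) + (1 + 1 / ?e) * (?b x)\<^sup>2 * (\<Sum>i<d. (Df i x)\<^sup>2)"
      by (simp only: sq_dist_def sum.distrib sum_distrib_left mult.assoc)
    also have "\<dots> \<le> (1 + ?e) * (?\<alpha>\<^sup>2 * sq_dist d y x) + (1 + 1 / ?e) * (indicator ?D x) * (\<Sum>i<d. (Df i x)\<^sup>2)"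
    proof -
      have "(?b x)\<^sup>2 \<le> indicator ?D x"
        using bD(1)[of x] b0[of x] b1[of x] by (cases "x \<in> ?D") (auto simp: power_le_one)
      then show ?thesis by (intro add_left_mono mult_right_mono mult_left_mono sum_nonneg) auto
    qed
    \<comment> \<open>The squared gradient of \<open>\<tau>\<close> is 4 lam \<open>\<tau>\<close> /
      n; this is where the error term acquires its 1 / n.\<close>
    also have "?\<alpha>\<^sup>2 * sq_dist d y x = (4 * lam / n) * (\<tau> x * (?b' x)\<^sup>2 * (indicator ?D x * (h x)\<^sup>2))"
    proof -
      have "?\<alpha>\<^sup>2 * sq_dist d y x = (4 * lam / n) * (\<tau> x * (?b' x)\<^sup>2 * (h x)\<^sup>2)"
        by (simp add: \<tau>_eq power_mult_distrib power_divide power2_eq_square mult_ac)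
      then show ?thesis using bD(2)[of x] by (cases "x \<in> ?D") auto
    qed
    finally show ?thesis by (simp add: P_def mult_ac add.commute)
  qed
  have gp: "2 * lam * (LINT x|?M. (u x)\<^sup>2) \<le> (LINT x|?M. P x)"
  proof -
    have "ennreal (2 * lam * (LINT x|?M. (u x)\<^sup>2)) = ennreal lam * dvar ?M u"
      unfolding dvar_eq_variance[OF prob_space_gauss[OF lam] u1 u2] u_mean
      using lam by (simp add: ennreal_mult'[symmetric] mult_ac)
    also have "\<dots> \<le> (\<integral>\<^sup>+x. ennreal (\<Sum>i<d. (Du i x)\<^sup>2) \<partial>?M)"
      by (rule gaussian_poincare[OF lam cu cDu uD])
    also have "\<dots> \<le> (\<integral>\<^sup>+x. ennreal (P x) \<partial>?M)"
      by (intro nn_integral_mono ennreal_leI grad)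
    also have "\<dots> = ennreal (LINT x|?M. P x)"
    proof (rule nn_integral_eq_integral[OF intP])
      have "0 \<le> P x" for x
        using grad[of x] sum_nonneg[of "{..<d}" "\<lambda>i. (Du i x)\<^sup>2"] by (meson order_trans zero_le_power2)
      then show "AE x in ?M. 0 \<le> P x" by simp
    qed
    finally show ?thesis
    proof (subst (asm) ennreal_le_iff)
      have "0 \<le> P x" for x
        using grad[of x] sum_nonneg[of "{..<d}" "\<lambda>i. (Du i x)\<^sup>2"] by (meson order_trans zero_le_power2)
      then show "0 \<le> (LINT x|?M. P x)" by simp
    qed
  qed
  have hardy: "(LINT x|?M. potential n ?e (\<tau> x) * (indicator ?D x * (h x)\<^sup>2)) \<le> 1 / (?e * lam) * ?I"
    unfolding n_def \<tau>_def
    by (rule hardy_ball_complement[OF lam d _ _ ch Df hD h2 Df2]) auto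
  let ?J = "LINT x|?M. \<tau> x * (?b' x)\<^sup>2 * (indicator ?D x * (h x)\<^sup>2)"
  let ?H = "LINT x|?M. indicator ?D x * (h x)\<^sup>2"
  have int_pot: "integrable ?M (\<lambda>x. potential n ?e (\<tau> x) * (indicator ?D x * (h x)\<^sup>2))"
  proof (rule integrable_mult_bounded[OF h2, where B = 10])
    have "continuous_on {0..} weight"
      by (rule DERIV_continuous_on[OF has_field_derivative_at_within[OF has_derivative_weight]]) simp
    then have "continuous_on {0..} (potential n ?e)"
      unfolding potential_def using n
      by (intro continuous_on_add continuous_on_mult continuous_on_diff continuous_on_divide continuous_on_const
          continuous_on_id continuous_on_weight') simp_all
    then show "(\<lambda>x. potential n ?e (\<tau> x)) \<in> borel_measurable ?M"
      by (intro meas continuous_on_compose2[OF _ c\<tau>]) (use \<tau>0 in auto)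
    show "\<bar>potential n ?e (\<tau> x)\<bar> \<le> 10" for x
      by (rule potential_bound[OF \<tau>0 n]) auto
  qed
  have "1 / 1000 * ?H = (LINT x|?M. 1 / 1000 * (indicator ?D x * (h x)\<^sup>2))" by simp
  also have "\<dots> \<le> (LINT x|?M. (u x)\<^sup>2 - 2 * (1 + ?e) / n * (\<tau> x * (?b' x)\<^sup>2 * (indicator ?D x * (h x)\<^sup>2))
      + potential n ?e (\<tau> x) * (indicator ?D x * (h x)\<^sup>2))"
  proof (rule integral_mono)
    fix x
    have "1 / 1000 * (indicator ?D x * (h x)\<^sup>2)
        \<le> ((?b x)\<^sup>2 - 2 * (1 + ?e) * (\<tau> x * (?b' x)\<^sup>2) / n + potential n ?e (\<tau> x)) * (indicator ?D x * (h x)\<^sup>2)"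
      by (intro mult_right_mono total_coefficient \<tau>0 n) simp
    also have "\<dots> = (u x)\<^sup>2 - 2 * (1 + ?e) / n * (\<tau> x * (?b' x)\<^sup>2 * (indicator ?D x * (h x)\<^sup>2))
        + potential n ?e (\<tau> x) * (indicator ?D x * (h x)\<^sup>2)"
      unfolding u_sq by (simp add: left_diff_distrib distrib_right)
    finally show "1 / 1000 * (indicator ?D x * (h x)\<^sup>2) \<le> (u x)\<^sup>2
        - 2 * (1 + ?e) / n * (\<tau> x * (?b' x)\<^sup>2 * (indicator ?D x * (h x)\<^sup>2))
        + potential n ?e (\<tau> x) * (indicator ?D x * (h x)\<^sup>2)" .
  qed (use h2 u2 int_tb int_pot in auto)
  also have "\<dots> = (LINT x|?M. (u x)\<^sup>2) - 2 * (1 + ?e) / n * ?J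
      + (LINT x|?M. potential n ?e (\<tau> x) * (indicator ?D x * (h x)\<^sup>2))"
    using u2 int_tb int_pot by simp
  also have "\<dots> \<le> (1 + 1 / ?e) / (2 * lam) * ?I + 1 / (?e * lam) * ?I"
  proof -
    have "(LINT x|?M. P x) = (1 + 1 / ?e) * ?I + (1 + ?e) * (4 * lam / n) * ?J"
      unfolding P_def using Df2 int_tb by simp
    then have "(LINT x|?M. (u x)\<^sup>2) \<le> ((1 + 1 / ?e) * ?I + (1 + ?e) * (4 * lam / n) * ?J) / (2 * lam)"
      using gp lam by (simp add: pos_le_divide_eq mult_ac)
    \<comment> \<open>Dividing by 2 lam turns 4 lam / n into 2 / n, so the \<open>?J\<close> term is
      exactly the one that \<open>total_coefficient\<close> subtracted, and it cancels.\<close>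
    also have "\<dots> = (1 + 1 / ?e) / (2 * lam) * ?I + 2 * (1 + ?e) / n * ?J"
      using lam by (simp add: add_divide_distrib)
    finally show ?thesis using hardy by linarith
  qed
  \<comment> \<open>The Gaussian part gives 1001 / 2 and the Hardy part 1000. Dividing by the lower
    bound 1/1000 yields 1500500, rounded up to 2000000.\<close>
  also have "\<dots> = 3001 / 2 / lam * ?I" using lam by (simp add: field_simps)
  finally have "?H \<le> 1000 * (3001 / 2 / lam * ?I)" by simp
  also have "\<dots> \<le> 2000000 / lam * ?I"
  proof -
    have "0 \<le> ?I" by (intro Bochner_Integration.integral_nonneg mult_nonneg_nonneg sum_nonneg) auto
    then show ?thesis using lam by (simp add: divide_right_mono)
  qed
  finally show ?thesis unfolding h_def by (rule that)
qed

section \<open>The restricted Gaussian measure\<close>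

lemma nn_integral_PiM_gauss1:
  assumes lam: "lam > 0" and "finite I" and "f \<in> borel_measurable (PiM I (\<lambda>_. borel))"
  shows "(\<integral>\<^sup>+x. f x \<partial>PiM I (\<lambda>_. gauss1 lam))
    = (\<integral>\<^sup>+x. ennreal (\<Prod>i\<in>I. normal_density 0 (1 / sqrt (2 * lam)) (x i)) * f x \<partial>PiM I (\<lambda>_. lborel))"
  using assms(2,3)
proof (induction I arbitrary: f rule: finite_induct)
  case empty
  show ?case by (simp add: PiM_empty)
next
  case (insert i I)
  let ?\<phi> = "normal_density 0 (1 / sqrt (2 * lam))"
  interpret gauss1: prob_space "gauss1 lam" by (rule prob_space_gauss1[OF lam])
  interpret G: product_prob_space "\<lambda>_. gauss1 lam" by unfold_locales
  interpret L: product_sigma_finite "\<lambda>_. lborel :: real measure" by unfold_locales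
  have setsG: "sets (PiM J (\<lambda>_. gauss1 lam)) = sets (PiM J (\<lambda>_. borel))" for J
    by (rule sets_PiM_cong) auto
  have setsL: "sets (PiM J (\<lambda>_. lborel :: real measure)) = sets (PiM J (\<lambda>_. borel))" for J
    by (rule sets_PiM_cong) auto
  note f = insert.prems
  have upd: "(\<lambda>z. (fst z)(i := snd z)) \<in> measurable (PiM I (\<lambda>_. borel) \<Otimes>\<^sub>M borel) (PiM (insert i I) (\<lambda>_. borel))"
    by (rule measurable_fun_upd[where J = I]) auto
  have f2 [measurable]: "(\<lambda>(x, t). f (x(i := t))) \<in> borel_measurable (PiM I (\<lambda>_. borel) \<Otimes>\<^sub>M borel)"
    using measurable_compose[OF upd f] unfolding case_prod_beta' .
  have "(\<lambda>x. \<integral>\<^sup>+t. f (x(i := t)) \<partial>gauss1 lam) \<in> borel_measurable (PiM I (\<lambda>_. borel))"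
    by measurable
  note IH = insert.IH[OF this]
  have "(\<integral>\<^sup>+x. f x \<partial>PiM (insert i I) (\<lambda>_. gauss1 lam))
      = (\<integral>\<^sup>+x. \<integral>\<^sup>+t. f (x(i := t)) \<partial>gauss1 lam \<partial>PiM I (\<lambda>_. gauss1 lam))"
    using f by (intro G.product_nn_integral_insert insert.hyps) (simp add: measurable_cong_sets[OF setsG refl])
  also have "\<dots> = (\<integral>\<^sup>+x. ennreal (\<Prod>j\<in>I. ?\<phi> (x j)) * (\<integral>\<^sup>+t. f (x(i := t)) \<partial>gauss1 lam) \<partial>PiM I (\<lambda>_. lborel))"
    by (rule IH)
  also have "\<dots> = (\<integral>\<^sup>+x. \<integral>\<^sup>+t. ennreal (\<Prod>j\<in>insert i I. ?\<phi> ((x(i := t)) j)) * f (x(i := t)) \<partial>lborel \<partial>PiM I (\<lambda>_. lborel))"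
  proof (rule nn_integral_cong)
    fix x :: "'a \<Rightarrow> real" assume "x \<in> space (PiM I (\<lambda>_. lborel :: real measure))"
    then have "x \<in> space (PiM I (\<lambda>_. borel :: real measure))" by (simp add: space_PiM)
    then have [measurable]: "(\<lambda>t. f (x(i := t))) \<in> borel_measurable borel"
      using measurable_Pair2[OF f2] by simp
    have prod: "(\<Prod>j\<in>insert i I. ?\<phi> ((x(i := t)) j)) = (\<Prod>j\<in>I. ?\<phi> (x j)) * ?\<phi> t" for t
      using insert.hyps by (subst prod.insert) (auto intro!: prod.cong simp: mult.commute)
    have "ennreal (\<Prod>j\<in>I. ?\<phi> (x j)) * (\<integral>\<^sup>+t. f (x(i := t)) \<partial>gauss1 lam)
        = ennreal (\<Prod>j\<in>I. ?\<phi> (x j)) * (\<integral>\<^sup>+t. ennreal (?\<phi> t) * f (x(i := t)) \<partial>lborel)"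
      unfolding gauss1_def by (subst nn_integral_density) auto
    also have "\<dots> = (\<integral>\<^sup>+t. ennreal (\<Prod>j\<in>insert i I. ?\<phi> ((x(i := t)) j)) * f (x(i := t)) \<partial>lborel)"
      unfolding prod by (subst nn_integral_cmult[symmetric]) (auto simp: ennreal_mult' prod_nonneg mult.assoc)
    finally show "ennreal (\<Prod>j\<in>I. ?\<phi> (x j)) * (\<integral>\<^sup>+t. f (x(i := t)) \<partial>gauss1 lam)
        = (\<integral>\<^sup>+t. ennreal (\<Prod>j\<in>insert i I. ?\<phi> ((x(i := t)) j)) * f (x(i := t)) \<partial>lborel)" .
  qed
  also have "\<dots> = (\<integral>\<^sup>+x. ennreal (\<Prod>j\<in>insert i I. ?\<phi> (x j)) * f x \<partial>PiM (insert i I) (\<lambda>_. lborel))"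
  proof (rule L.product_nn_integral_insert[symmetric, OF insert.hyps])
    have [measurable]: "f \<in> borel_measurable (PiM (insert i I) (\<lambda>_. lborel))"
      using f by (simp add: measurable_cong_sets[OF setsL refl])
    show "(\<lambda>x. ennreal (\<Prod>j\<in>insert i I. ?\<phi> (x j)) * f x) \<in> borel_measurable (PiM (insert i I) (\<lambda>_. lborel))"
      by measurable
  qed
  finally show ?case .
qed

lemma norm_Rd_power2: "(norm_Rd d x)\<^sup>2 = (\<Sum>i<d. (x i)\<^sup>2)"
  by (simp add: norm_Rd_def L2_set_def sum_nonneg)

lemma gauss_eq_density:
  assumes lam: "lam > 0"
  shows "gauss d lam = density (lborel_Rd d) (\<lambda>x. ennreal (sqrt (lam / pi) ^ d * exp (- lam * (norm_Rd d x)\<^sup>2)))"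
proof (rule measure_eqI)
  let ?g = "\<lambda>x. ennreal (sqrt (lam / pi) ^ d * exp (- lam * (norm_Rd d x)\<^sup>2))"
  have [measurable]: "?g \<in> borel_measurable (lborel_Rd d)"
    unfolding norm_Rd_power2 lborel_Rd_def by measurable
  show "sets (gauss d lam) = sets (density (lborel_Rd d) ?g)"
    by (simp add: sets_gauss sets_lborel_Rd)
  fix A assume A: "A \<in> sets (gauss d lam)"
  then have A': "A \<in> sets (lborel_Rd d)" by (simp add: sets_gauss sets_lborel_Rd)
  have prod: "ennreal (\<Prod>i<d. normal_density 0 (1 / sqrt (2 * lam)) (x i)) = ?g x" for x
    by (simp add: normal_density_gauss1[OF lam] norm_Rd_power2 prod.distrib exp_sum[symmetric]
        sum_distrib_left sum_negf)
  have "emeasure (gauss d lam) A = (\<integral>\<^sup>+x. indicator A x \<partial>PiM {..<d} (\<lambda>_. gauss1 lam))"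
    using A by (simp add: gauss_def)
  also have "\<dots> = (\<integral>\<^sup>+x. ?g x * indicator A x \<partial>lborel_Rd d)"
    unfolding lborel_Rd_def prod[symmetric]
    by (rule nn_integral_PiM_gauss1[OF lam]) (use A in \<open>auto simp: sets_gauss\<close>)
  also have "\<dots> = emeasure (density (lborel_Rd d) ?g) A"
    by (rule emeasure_density[symmetric]) (use A' in measurable)
  finally show "emeasure (gauss d lam) A = emeasure (density (lborel_Rd d) ?g) A" .
qed

lemma dist_Rd_gt_iff: "r \<ge> 0 \<Longrightarrow> r < dist_Rd d x y \<longleftrightarrow> x \<in> ball_complement d y r"
proof -
  assume r: "r \<ge> 0"
  have "r < dist_Rd d x y \<longleftrightarrow> sqrt (r\<^sup>2) < sqrt (sq_dist d y x)"
    using r by (simp add: dist_Rd_def L2_set_def sq_dist_def)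
  then show ?thesis unfolding real_sqrt_less_iff by (simp add: ball_complement_def)
qed

text \<open>Guarantees that the normalisation of \<open>mu\<close> is not a division by zero: the
  half-space x 0 > y 0 + r avoids the ball.\<close>

lemma measure_ball_complement_pos:
  assumes lam: "lam > 0" and d: "d > 0" and r: "r \<ge> 0"
  shows "0 < (LINT x|gauss d lam. indicator (ball_complement d y r) x :: real)"
proof (rule ccontr)
  let ?I = "indicator (ball_complement d y r) :: _ \<Rightarrow> real"
  assume "\<not> 0 < (LINT x|gauss d lam. ?I x)"
  moreover have "0 \<le> (LINT x|gauss d lam. ?I x)" by (intro Bochner_Integration.integral_nonneg) auto
  ultimately have "(LINT x|gauss d lam. ?I x) = 0" by linarith
  moreover have "integrable (gauss d lam) ?I"
    by (rule integrable_gauss_bounded[OF lam measurable_ball_complement, where B = 1]) simp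
  ultimately have "AE x in gauss d lam. ?I x = 0"
    by (intro iffD1[OF integral_nonneg_eq_0_iff_AE]) auto
  then have "AE x in gauss d lam. x 0 \<le> y 0 + r"
  proof (rule eventually_mono)
    fix x assume x: "?I x = 0"
    show "x 0 \<le> y 0 + r"
    proof (rule ccontr)
      assume "\<not> x 0 \<le> y 0 + r"
      then have "r\<^sup>2 < (x 0 - y 0)\<^sup>2" using r by (intro power_strict_mono) auto
      also have "\<dots> \<le> sq_dist d y x" unfolding sq_dist_def using d by (intro member_le_sum) auto
      finally show False using x by (simp add: ball_complement_def)
    qed
  qed
  then show False using not_AE_gauss_coordinate_le[OF lam d] by simp
qed

text \<open>The Gaussian normalisation sqrt (lam / pi)^d occurs in both the weight and Z and
  cancels; \<open>mu\<close> is the Gaussian law conditioned on the complement of the ball.\<close>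

lemma mu_eq_density_gauss:
  assumes lam: "lam > 0" and d: "d > 0" and r: "r \<ge> 0"
  shows "mu d lam y r = density (gauss d lam)
    (\<lambda>x. ennreal (indicator (ball_complement d y r) x / (LINT x|gauss d lam. indicator (ball_complement d y r) x)))"
proof -
  let ?I = "indicator (ball_complement d y r) :: _ \<Rightarrow> real" and ?w = "\<lambda>x. exp (- lam * (norm_Rd d x)\<^sup>2)"
  define k where "k = sqrt (lam / pi) ^ d"
  have k: "k > 0" using lam by (simp add: k_def)
  define m where "m = (LINT x|gauss d lam. ?I x)"
  have m: "m > 0" unfolding m_def by (rule measure_ball_complement_pos[OF assms])
  note gauss = gauss_eq_density[OF lam, of d, folded k_def]
  have [measurable]: "?w \<in> borel_measurable (lborel_Rd d)"
    unfolding norm_Rd_power2 lborel_Rd_def by measurable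
  have [measurable]: "?I \<in> borel_measurable (lborel_Rd d)"
    using measurable_ball_complement[of d y r lam] measurable_cong_sets[of "lborel_Rd d" "gauss d lam"]
    by (simp add: sets_gauss sets_lborel_Rd)
  have weight: "gauss_weight d lam y r = (\<lambda>x. ?I x * ?w x)"
    using dist_Rd_gt_iff[OF r] by (auto simp: gauss_weight_def fun_eq_iff indicator_def)
  have "m = (LINT x|lborel_Rd d. (k * ?w x) *\<^sub>R ?I x)"
    unfolding m_def gauss by (rule integral_density, measurable) (simp add: less_imp_le[OF k])
  also have "\<dots> = k * (LINT x|lborel_Rd d. ?I x * ?w x)"
    by (subst integral_mult_right_zero[symmetric]) (simp add: mult_ac)
  finally have Z: "(LINT x|lborel_Rd d. gauss_weight d lam y r x) = m / k"
    using k by (simp add: weight)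
  have "density (gauss d lam) (\<lambda>x. ennreal (?I x / m))
      = density (lborel_Rd d) (\<lambda>x. ennreal (k * ?w x) * ennreal (?I x / m))"
    unfolding gauss by (rule density_density_eq) measurable
  also have "\<dots> = density (lborel_Rd d) (\<lambda>x. ennreal (gauss_weight d lam y r x / (m / k)))"
  proof (rule arg_cong[where f = "density (lborel_Rd d)"], rule ext)
    fix x
    show "ennreal (k * ?w x) * ennreal (?I x / m) = ennreal (gauss_weight d lam y r x / (m / k))"
      using k m by (simp add: ennreal_mult'[symmetric] weight mult_ac)
  qed
  also have "\<dots> = mu d lam y r" by (simp add: mu_def Z Let_def)
  finally show ?thesis by (simp add: m_def)
qed

section \<open>Smooth functions and the coordinate test function\<close>

lemma smooth_Rd_partial:
  assumes "smooth_Rd d f" "i < d"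
  shows "continuous_on (Rd d) f" "continuous_on (Rd d) (partial i f)"
    "x \<in> Rd d \<Longrightarrow> has_partial f (partial i f x) i x"
proof -
  have *: "continuous_on (Rd d) (foldr partial is f) \<and>
      (\<forall>i<d. \<forall>x\<in>Rd d. (\<lambda>t. foldr partial is f (x(i := t))) differentiable (at (x i)))"
    if "set is \<subseteq> {..<d}" for "is"
    using assms(1) that by (auto simp: smooth_Rd_def)
  show "continuous_on (Rd d) f" using *[of "[]"] by simp
  show "continuous_on (Rd d) (partial i f)" using *[of "[i]"] assms(2) by simp
  show "has_partial f (partial i f x) i x" if "x \<in> Rd d"
    using *[of "[]"] assms(2) that
    by (simp add: partial_def DERIV_deriv_iff_real_differentiable)
qed

lemma grad_norm_power2: "(grad_norm d f x)\<^sup>2 = (\<Sum>i<d. (partial i f x)\<^sup>2)"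
  by (simp add: grad_norm_def norm_Rd_power2)

lemma partial_const: "partial i (\<lambda>x. c) = (\<lambda>x. 0)"
  by (simp add: partial_def fun_eq_iff)

lemma partial_coordinate: "partial i (\<lambda>x. x j) = (\<lambda>x. if i = j then 1 else 0)"
  by (simp add: partial_def fun_eq_iff)

text \<open>The coordinate function together with the constants is closed under partial
  derivatives.\<close>

lemma foldr_partial_coordinate:
  "foldr partial is (\<lambda>x. x j) \<in> insert (\<lambda>x. x j) (range (\<lambda>c x. c))"
proof (induction "is")
  case (Cons i js)
  define G where "G = foldr partial js (\<lambda>x. x j)"
  have "partial i G \<in> range (\<lambda>c x. c)" if "G \<in> insert (\<lambda>x. x j) (range (\<lambda>c x. c))"
    using that
  proof
    assume "G = (\<lambda>x. x j)"
    then have "partial i G = (\<lambda>x. if i = j then 1 else 0)" by (simp only: partial_coordinate)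
    then show ?thesis by (rule range_eqI)
  next
    assume "G \<in> range (\<lambda>c x. c)"
    then obtain c where "G = (\<lambda>x. c)" by (rule rangeE)
    then have "partial i G = (\<lambda>x. 0)" by (simp only: partial_const)
    then show ?thesis by (rule range_eqI)
  qed
  then show ?case using Cons by (simp only: foldr_Cons o_apply G_def insert_iff simp_thms)
qed simp
lemma smooth_Rd_coordinate: "smooth_Rd d (\<lambda>x. x j)"
  unfolding smooth_Rd_def
proof (intro allI impI)
  fix "is" :: "nat list"
  have coordinate: "(\<lambda>t. (x(i := t)) j) differentiable (at s)" for x :: "nat \<Rightarrow> real" and i s
    by (cases "i = j") simp_all
  show "continuous_on (Rd d) (foldr partial is (\<lambda>x. x j)) \<and>
      (\<forall>i<d. \<forall>x\<in>Rd d. (\<lambda>t. foldr partial is (\<lambda>x. x j) (x(i := t))) differentiable at (x i))"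
    using foldr_partial_coordinate[of "is" j]
  proof
    assume *: "foldr partial is (\<lambda>x. x j) = (\<lambda>x. x j)"
    show ?thesis unfolding * by (intro conjI allI impI ballI coordinate continuous_on_coordinate)
  next
    assume "foldr partial is (\<lambda>x. x j) \<in> range (\<lambda>c x. c)"
    then obtain c where *: "foldr partial is (\<lambda>x. x j) = (\<lambda>x. c)" by (rule rangeE)
    show ?thesis unfolding * by simp
  qed
qed

lemma integrable_gauss_coordinate_square:
  assumes lam: "lam > 0" and i: "i < d"
  shows "integrable (gauss d lam) (\<lambda>x. (x i)\<^sup>2)"
proof -
  have "integrable (gauss1 lam) (\<lambda>t. t\<^sup>2)"
    unfolding gauss1_def
    using integrable_normal_moment[of "1 / sqrt (2 * lam)" 0 2] lam
    by (subst integrable_density) auto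
  moreover have "distr (gauss d lam) (gauss1 lam) (\<lambda>x. x i) = gauss1 lam"
    unfolding gauss_def by (rule distr_PiM_component[OF prob_space_gauss1[OF lam]]) (use i in auto)
  ultimately have "integrable (distr (gauss d lam) (gauss1 lam) (\<lambda>x. x i)) (\<lambda>t. t\<^sup>2)" by (simp only:)
  then show ?thesis
    using i by (subst (asm) integrable_distr_eq) (auto simp: gauss_def)
qed

section \<open>The restricted measure as a probability space and its Poincare constant\<close>

context
  fixes d :: nat and lam r :: real and y :: "nat \<Rightarrow> real"
  assumes lam: "lam > 0" and d: "d > 0" and r: "r \<ge> 0"
begin

interpretation gauss: prob_space "gauss d lam" by (rule prob_space_gauss[OF lam])

abbreviation "mass \<equiv> LINT x|gauss d lam. indicator (ball_complement d y r) x :: real"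

lemma mu_integral:
  assumes [measurable]: "f \<in> borel_measurable (gauss d lam)"
  shows "integrable (mu d lam y r) f \<longleftrightarrow> integrable (gauss d lam) (\<lambda>x. indicator (ball_complement d y r) x * f x :: real)"
    and "(LINT x|mu d lam y r. f x) = (LINT x|gauss d lam. indicator (ball_complement d y r) x * f x) / mass"
proof -
  note m = measure_ball_complement_pos[OF lam d r, of y]
  have "integrable (mu d lam y r) f \<longleftrightarrow> integrable (gauss d lam) (\<lambda>x. (indicator (ball_complement d y r) x / mass) *\<^sub>R f x)"
    unfolding mu_eq_density_gauss[OF lam d r] using m by (intro integrable_density) auto
  also have "\<dots> \<longleftrightarrow> integrable (gauss d lam) (\<lambda>x. 1 / mass * (indicator (ball_complement d y r) x * f x))" by simp
  also have "\<dots> \<longleftrightarrow> integrable (gauss d lam) (\<lambda>x. indicator (ball_complement d y r) x * f x)"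
    unfolding integrable_mult_left_iff using m by auto
  finally show "integrable (mu d lam y r) f \<longleftrightarrow> integrable (gauss d lam) (\<lambda>x. indicator (ball_complement d y r) x * f x :: real)" .
  have "(LINT x|mu d lam y r. f x) = (LINT x|gauss d lam. (indicator (ball_complement d y r) x / mass) *\<^sub>R f x)"
    unfolding mu_eq_density_gauss[OF lam d r] using m by (intro integral_density) auto
  then show "(LINT x|mu d lam y r. f x) = (LINT x|gauss d lam. indicator (ball_complement d y r) x * f x) / mass" by simp
qed

lemma prob_space_mu: "prob_space (mu d lam y r)"
proof (rule prob_spaceI)
  note m = measure_ball_complement_pos[OF lam d r, of y]
  have int: "integrable (gauss d lam) (\<lambda>x. indicator (ball_complement d y r) x / mass)"
  proof (rule integrable_gauss_bounded[OF lam, where B = "1 / mass"])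
    show "(\<lambda>x. indicator (ball_complement d y r) x / mass) \<in> borel_measurable (gauss d lam)"
      by (intro borel_measurable_divide measurable_ball_complement borel_measurable_const)
    show "\<bar>indicator (ball_complement d y r) x / mass\<bar> \<le> 1 / mass" for x
      by (cases "x \<in> ball_complement d y r") (use m in simp_all)
  qed
  have "emeasure (mu d lam y r) (space (mu d lam y r))
      = (\<integral>\<^sup>+x. ennreal (indicator (ball_complement d y r) x / mass) * indicator (space (gauss d lam)) x \<partial>gauss d lam)"
    unfolding mu_eq_density_gauss[OF lam d r] by (subst emeasure_density) (simp_all del: space_gauss)
  also have "\<dots> = (\<integral>\<^sup>+x. ennreal (indicator (ball_complement d y r) x / mass) \<partial>gauss d lam)"
    by (intro nn_integral_cong) (simp del: space_gauss)
  also have "\<dots> = ennreal (LINT x|gauss d lam. indicator (ball_complement d y r) x / mass)"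
    by (rule nn_integral_eq_integral[OF int]) (use m in simp)
  also have "\<dots> = 1" using m by simp
  finally show "emeasure (mu d lam y r) (space (mu d lam y r)) = 1" .
qed

lemma borel_measurable_mu: "borel_measurable (mu d lam y r) = borel_measurable (gauss d lam)"
  unfolding mu_eq_density_gauss[OF lam d r] by (rule measurable_cong_sets[OF sets_density refl])

text \<open>The variance is at most the second moment about the constant a supplied by
  \<open>poincare_ball_complement\<close>, and passing from the Gaussian integrals to
  \<open>mu\<close> divides both sides by the same \<open>mass\<close>.\<close>

lemma poincare_inequality_mu:
  assumes d2: "d \<ge> 2" and small: "lam * r\<^sup>2 \<le> (real d - 1) / 8"
  shows "poincare_inequality d (mu d lam y r) (2000000 / lam)"
  unfolding poincare_inequality_def
proof (intro allI impI, elim conjE)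
  fix f assume f: "smooth_Rd d f" and f2: "integrable (mu d lam y r) (\<lambda>x. (f x)\<^sup>2)"
    and g2: "integrable (mu d lam y r) (\<lambda>x. (grad_norm d f x)\<^sup>2)"
  let ?I = "indicator (ball_complement d y r) :: _ \<Rightarrow> real"
  interpret mu: prob_space "mu d lam y r" by (rule prob_space_mu)
  note m = measure_ball_complement_pos[OF lam d r, of y]
  have cf: "continuous_on (Rd d) f" using smooth_Rd_partial(1)[OF f d] .
  have cpf: "continuous_on (Rd d) (partial i f)" if "i < d" for i using smooth_Rd_partial(2)[OF f that] .
  have [measurable]: "f \<in> borel_measurable (gauss d lam)"
    by (rule borel_measurable_gauss_continuous[OF cf])
  have mg: "(\<lambda>x. (grad_norm d f x)\<^sup>2) \<in> borel_measurable (gauss d lam)"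
    unfolding grad_norm_power2
    by (intro borel_measurable_sum borel_measurable_power borel_measurable_gauss_continuous cpf) simp
  have f2': "integrable (gauss d lam) (\<lambda>x. ?I x * (f x)\<^sup>2)"
    using f2 by (subst (asm) mu_integral) auto
  have g2': "integrable (gauss d lam) (\<lambda>x. ?I x * (\<Sum>i<d. (partial i f x)\<^sup>2))"
    using g2 mu_integral(1)[OF mg] by (simp add: grad_norm_power2)
  obtain a where a: "(LINT x|gauss d lam. ?I x * (f x - a)\<^sup>2)
      \<le> 2000000 / lam * (LINT x|gauss d lam. ?I x * (\<Sum>i<d. (partial i f x)\<^sup>2))"
    using poincare_ball_complement[OF lam d2 small cf cpf smooth_Rd_partial(3)[OF f] f2' g2'] by blast
  have f1: "integrable (mu d lam y r) f"
    by (rule mu.square_integrable_imp_integrable[OF _ f2]) (simp add: borel_measurable_mu)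
  have "mu.variance f \<le> (LINT x|mu d lam y r. (f x - a)\<^sup>2)"
  proof -
    let ?E = "mu.expectation f"
    have "(LINT x|mu d lam y r. (f x - a)\<^sup>2) = mu.expectation (\<lambda>x. (f x)\<^sup>2) - 2 * a * ?E + a\<^sup>2"
    proof -
      have "(\<lambda>x. (f x - a)\<^sup>2) = (\<lambda>x. (f x)\<^sup>2 - 2 * a * f x + a\<^sup>2)"
        by (simp add: fun_eq_iff power2_diff)
      then show ?thesis using f1 f2 by (simp add: mu.prob_space)
    qed
    moreover have "mu.variance f = mu.expectation (\<lambda>x. (f x)\<^sup>2) - ?E\<^sup>2"
      by (rule mu.variance_eq[OF f1 f2])
    moreover have "0 \<le> (?E - a)\<^sup>2" by simp
    moreover have "(?E - a)\<^sup>2 = ?E\<^sup>2 - 2 * a * ?E + a\<^sup>2" by (simp add: power2_diff)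
    ultimately show ?thesis by linarith
  qed
  also have "\<dots> = (LINT x|gauss d lam. ?I x * (f x - a)\<^sup>2) / mass"
    by (rule mu_integral(2)) measurable
  also have "\<dots> \<le> (2000000 / lam * (LINT x|gauss d lam. ?I x * (\<Sum>i<d. (partial i f x)\<^sup>2))) / mass"
    using a m by (intro divide_right_mono) auto
  also have "\<dots> = 2000000 / lam * (LINT x|mu d lam y r. (grad_norm d f x)\<^sup>2)"
    unfolding mu_integral(2)[OF mg] by (simp add: grad_norm_power2)
  finally show "mu.variance f \<le> 2000000 / lam * (LINT x|mu d lam y r. (grad_norm d f x)\<^sup>2)" .
qed

text \<open>The coordinate function \<open>x 0\<close> has gradient of norm one, so the admissible constants are bounded below.\<close>

lemma poincare_inequality_mu_nonneg:
  assumes C: "poincare_inequality d (mu d lam y r) C"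
  shows "0 \<le> C"
proof -
  interpret mu: prob_space "mu d lam y r" by (rule prob_space_mu)
  let ?f = "\<lambda>x :: nat \<Rightarrow> real. x 0"
  have g: "(grad_norm d ?f x)\<^sup>2 = 1" for x
    using d by (simp add: grad_norm_power2 partial_coordinate if_distrib[where f = "\<lambda>t. t\<^sup>2"] cong: if_cong)
  have "integrable (gauss d lam) (\<lambda>x. indicator (ball_complement d y r) x * (x 0)\<^sup>2)"
    by (rule integrable_mult_bounded[OF integrable_gauss_coordinate_square[OF lam d] measurable_ball_complement, where B = 1])
       simp
  then have "integrable (mu d lam y r) (\<lambda>x. (?f x)\<^sup>2)"
    using integrable_gauss_coordinate_square[OF lam d] by (subst mu_integral) auto
  moreover have "integrable (mu d lam y r) (\<lambda>x. (grad_norm d ?f x)\<^sup>2)" by (simp add: g)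
  ultimately have "mu.variance ?f \<le> C * (LINT x|mu d lam y r. (grad_norm d ?f x)\<^sup>2)"
    using C smooth_Rd_coordinate[of d 0] unfolding poincare_inequality_def by blast
  moreover have "0 \<le> mu.variance ?f" by (intro Bochner_Integration.integral_nonneg) simp
  moreover have "C * (LINT x|mu d lam y r. (grad_norm d ?f x)\<^sup>2) = C" by (simp add: g mu.prob_space)
  ultimately show ?thesis by linarith
qed

text \<open>Each test function imposes a closed condition on C, and admissible constants are
  nonnegative, so the infimum is itself admissible and \<open>LEAST\<close> denotes a true
  minimum.\<close>

lemma poincare_constant_attained:
  assumes K: "poincare_inequality d (mu d lam y r) K"
  shows "poincare_inequality d (mu d lam y r) (poincare_constant d lam y r)"
    and "poincare_constant d lam y r \<le> K"
proof -
  define S where "S = {C. poincare_inequality d (mu d lam y r) C}"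
  have S: "K \<in> S" "bdd_below S"
    using K poincare_inequality_mu_nonneg by (auto simp: S_def bdd_below_def)
  have Inf: "poincare_inequality d (mu d lam y r) (Inf S)"
    unfolding poincare_inequality_def
  proof (intro allI impI)
    fix f
    assume f: "smooth_Rd d f \<and> integrable (mu d lam y r) (\<lambda>x. (f x)\<^sup>2) \<and> integrable (mu d lam y r) (\<lambda>x. (grad_norm d f x)\<^sup>2)"
    let ?V = "prob_space.variance (mu d lam y r) f" and ?E = "LINT x|mu d lam y r. (grad_norm d f x)\<^sup>2"
    have le: "?V \<le> C * ?E" if "C \<in> S" for C
      using f that by (auto simp: S_def poincare_inequality_def)
    have "0 \<le> ?E" by (intro Bochner_Integration.integral_nonneg) simp
    \<comment> \<open>For zero energy the inequality does not involve the constant and is inherited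
      from K; for positive energy \<open>?V / ?E\<close> is a lower bound of S.\<close>
    then consider "?E = 0" | "?E > 0" by linarith
    then show "?V \<le> Inf S * ?E"
    proof cases
      case 2
      then have "?V / ?E \<le> C" if "C \<in> S" for C using le[OF that] by (simp add: pos_divide_le_eq)
      then have "?V / ?E \<le> Inf S" using S(1) by (intro cInf_greatest) auto
      then show ?thesis using 2 by (simp add: pos_divide_le_eq)
    qed (use le[OF S(1)] in simp)
  qed
  have "poincare_constant d lam y r = Inf S"
    unfolding poincare_constant_def
  proof (rule Least_equality)
    show "Inf S \<le> C" if "poincare_inequality d (mu d lam y r) C" for C
      using that S(2) by (intro cInf_lower) (auto simp: S_def)
  qed (rule Inf)
  then show "poincare_inequality d (mu d lam y r) (poincare_constant d lam y r)"
    and "poincare_constant d lam y r \<le> K"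
    using Inf cInf_lower[OF S] by simp_all
qed

end

theorem theorem5p16:
  "\<exists>c::real. \<forall>(d::nat) (lam::real) (y :: nat \<Rightarrow> real) (r::real).
     d \<ge> 2 \<and> lam > 0 \<and> y \<in> Rd d \<and> r \<ge> 0 \<and>
     r * sqrt lam \<le> 1 / 2 * sqrt ((real d - 1) / 2) \<longrightarrow>
       poincare_inequality d (mu d lam y r) (poincare_constant d lam y r) \<and>
       poincare_constant d lam y r \<le> c / lam"
proof (intro exI[of _ 2000000] allI impI, elim conjE)
  fix d :: nat and lam :: real and y :: "nat \<Rightarrow> real" and r :: real
  assume d: "d \<ge> 2" and lam: "lam > 0" and r: "r \<ge> 0"
    and small: "r * sqrt lam \<le> 1 / 2 * sqrt ((real d - 1) / 2)"
  \<comment> \<open>Squared, the hypothesis reads lam r^2 / (d - 1) \<le> 1/8, the threshold at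
    which the bump starts.\<close>
  have "(r * sqrt lam)\<^sup>2 \<le> (1 / 2 * sqrt ((real d - 1) / 2))\<^sup>2"
    using small r lam by (intro power_mono) auto
  then have "lam * r\<^sup>2 \<le> (real d - 1) / 8"
    using lam d by (simp add: power_mult_distrib power_divide mult.commute)
  then have "poincare_inequality d (mu d lam y r) (2000000 / lam)"
    using poincare_inequality_mu[OF lam _ r d] d by simp
  from poincare_constant_attained[OF lam _ r this] d
  show "poincare_inequality d (mu d lam y r) (poincare_constant d lam y r) \<and>
      poincare_constant d lam y r \<le> 2000000 / lam" by simp
qed

end
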